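(* Let $L>0$, let $f:\mathbb{R}^d\to\mathbb{R}$ be convex and $L$-smooth, and let $x^\star$ be a minimizer of $f$, with $f^\star=f(x^\star)$. Let $V_k\sim\operatorname{Unif}[1,2]$ and $U_k\sim\operatorname{Unif}[0,1]$, $k\ge0$, be mutually independent random variables, and define, for $k\ge0$, $$A_0=1,\qquad A_{k+1}=A_k+\frac{A_k^{1/3}}{512}V_k,\qquad u_k=A_k+(A_{k+1}-A_k)U_k,$$ $$\eta_k=\frac{A_{k+1}-A_k}{2L}\Big(1-\frac{u_k^2}{u_{k+1}^2}\Big)\ (k\ge0),\qquad \beta_k=\frac{u_k^{-2}-u_{k+1}^{-2}}{u_{k-1}^{-2}-u_k^{-2}}\ (k\ge1),\qquad\beta_0=0$$ (the denominators are positive almost surely). For any starting point $x^0\in\mathbb{R}^d$, set $x^{-1}=x^0$ and run the heavy-ball method $$x^{k+1}=x^k-\eta_k\nabla f(x^k)+\beta_k(x^k-x^{k-1}),\quad k\ge0.$$ Then, for every deterministic $K\ge1$, $$\mathbb{E}[f(x^K)-f^\star]\le\frac{4L\|x^0-x^\star\|^2}{(1+K/1024)^{3/2}}\le\frac{131072\,L\|x^0-x^\star\|^2}{K^{3/2}}.$$ Along the same infinite trajectory, $$\mathbb{P}\Big(\sup_{K\ge1}K^{3/2}[f(x^K)-f^\star]<\infty\Big)=1.$$ In particular, $f(x^K)-f^\star=O(K^{-3/2})$ almost surely.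
   Context: $\|\cdot\|$ is the Euclidean norm on $\mathbb{R}^d$. A function $f$ is $L$-smooth if it is differentiable and $\|\nabla f(x)-\nabla f(y)\|\le L\|x-y\|$ for all $x,y\in\mathbb{R}^d$. The starting point $x^0$ is deterministic and the gradient oracle is exact; the only randomness is in $(V_k,U_k)_{k\ge0}$. *)

theory Defs
  imports "HOL-Probability.Probability"
begin

definition grad :: "('a::real_inner \<Rightarrow> real) \<Rightarrow> 'a \<Rightarrow> 'a" where
  "grad f x = (THE D. GDERIV f x :> D)"

definition L_smooth :: "real \<Rightarrow> ('a::real_inner \<Rightarrow> real) \<Rightarrow> bool" where
  "L_smooth L f \<longleftrightarrow> (\<forall>x. f differentiable (at x)) \<and>
     (\<forall>x y. norm (grad f x - grad f y) \<le> L * norm (x - y))"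

text \<open>
  All quantities are functions of a realization \<open>v\<close> of \<open>(V\<^sub>k)\<close> and a realization \<open>w\<close> of
  \<open>(U\<^sub>k)\<close>; the random variables arise by composition with \<open>V\<close> and \<open>U\<close>.
\<close>

primrec A_seq :: "(nat \<Rightarrow> real) \<Rightarrow> nat \<Rightarrow> real" where
  "A_seq v 0 = 1"
| "A_seq v (Suc k) = A_seq v k + A_seq v k powr (1/3) / 512 * v k"

definition u_seq :: "(nat \<Rightarrow> real) \<Rightarrow> (nat \<Rightarrow> real) \<Rightarrow> nat \<Rightarrow> real" where
  "u_seq v w k = A_seq v k + (A_seq v (Suc k) - A_seq v k) * w k"

definition step_size :: "real \<Rightarrow> (nat \<Rightarrow> real) \<Rightarrow> (nat \<Rightarrow> real) \<Rightarrow> nat \<Rightarrow> real" where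
  "step_size L v w k =
     (A_seq v (Suc k) - A_seq v k) / (2 * L) * (1 - (u_seq v w k)\<^sup>2 / (u_seq v w (Suc k))\<^sup>2)"

definition momentum :: "(nat \<Rightarrow> real) \<Rightarrow> (nat \<Rightarrow> real) \<Rightarrow> nat \<Rightarrow> real" where
  "momentum v w k =
     (if k = 0 then 0
      else (u_seq v w k powi (-2) - u_seq v w (Suc k) powi (-2)) /
           (u_seq v w (k - 1) powi (-2) - u_seq v w k powi (-2)))"

text \<open>
  On \<^typ>\<open>nat\<close> we have \<open>0 - 1 = 0\<close>, so for \<open>k = 0\<close> the term \<open>x\<^bsub>k-1\<^esub>\<close> is \<open>x\<^sub>0\<close>, which is exactly
  the convention \<open>x\<^bsub>-1\<^esub> = x\<^sub>0\<close>.
\<close>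

fun heavy_ball ::
  "real \<Rightarrow> ('a::real_inner \<Rightarrow> real) \<Rightarrow> 'a \<Rightarrow> (nat \<Rightarrow> real) \<Rightarrow> (nat \<Rightarrow> real) \<Rightarrow> nat \<Rightarrow> 'a"
where
  "heavy_ball L f x0 v w 0 = x0"
| "heavy_ball L f x0 v w (Suc k) =
     heavy_ball L f x0 v w k
     - step_size L v w k *\<^sub>R grad f (heavy_ball L f x0 v w k)
     + momentum v w k *\<^sub>R (heavy_ball L f x0 v w k - heavy_ball L f x0 v w (k - 1))"

end

theory Submission
  imports Defs "HOL-Real_Asymp.Real_Asymp"
begin

text \<open>
  Rescale to \<open>L = 1\<close>, \<open>f\<^sup>\<star> = 0\<close>. With \<open>a = A\<^sub>k\<^sub>+\<^sub>1 - A\<^sub>k\<close>, the iterate \<open>x\<^sub>k\<close> is the point at time \<open>u\<^sub>k\<close> of the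
  curve \<open>t \<mapsto> z - (A\<^sub>k / t)\<^sup>2 d\<close>; at that time \<open>z\<close> jumps by \<open>- (a / 2) \<nabla>f(x\<^sub>k)\<close>. The energy
  \<open>A f(z - d) + \<parallel>z - x\<^sup>\<star>\<parallel>\<^sup>2 + \<parallel>d\<parallel>\<^sup>2\<close> is dissipated along the curve. Averaging over \<open>U\<^sub>k\<close> makes the jump
  unbiased, and its variance cost \<open>(a / 2) \<integral> \<parallel>\<nabla>f\<parallel>\<^sup>2\<close> is cancelled to leading order by the descent that the
  jump causes during the rest of the cell. What is left is
  \<open>\<integral> (t - A\<^sub>k) / 2 \<parallel>\<nabla>f\<parallel>\<^sup>2 dt - a\<^sup>2 / 4 \<parallel>\<nabla>f\<parallel>\<^sup>2\<close> with the last gradient taken at the end of the cell. It is too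
  large to be absorbed by the dissipation, but after averaging over \<open>V\<^sub>k\<close> it is a linear functional of
  \<open>\<parallel>\<nabla>f\<parallel>\<^sup>2\<close> of total mass zero, hence a coboundary for the renewal process of cell boundaries: solving the
  renewal equation gives an exponentially decaying kernel \<open>n\<close>, and adding
  \<open>e\<^sup>2 \<integral> n(r) \<parallel>\<nabla>f\<parallel>\<^sup>2 dr\<close>, with \<open>e = A\<^sup>1\<^sup>/\<^sup>3 / 512\<close> and the gradient at time \<open>A + e r\<close> of the uninterrupted
  curve, turns the energy into a nonnegative supermartingale. Its expectation gives the bound in mean,
  and the maximal inequality gives the almost sure bound.
\<close>

section \<open>The renewal kernel\<close>

text \<open>With mesh e, one cell dissipates e |g|^2, by cocoercivity, and (e / A) |d|^2, because d
  shrinks, up to constants. Along a cell the gradient moves by O((e / A) |d|); squared with weight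
  e^2 this is e^3 / A times the second dissipation, and the quadratic term of the descent inequality
  is e^3 / A times the first. These estimates let e grow like A^(1/3) and no faster, and increments
  of that size make A of order k^(3/2). The leftover, of size e^2 |g|^2, exceeds the dissipation by
  a factor e, so it has to cancel. It compares gradients at different times of one cell; freezing
  them at a common time would cost e^2 |g| (e / A) |d|, which is A^(1/6) times what the two
  dissipations absorb. Hence the exact cancellation through a corrector: moving the corrector to the
  next cell compares the old and the new curve at the same time, and these are closer by a further
  factor e / A. The spread of \<open>V\<close> makes the corrector finite. For constant
  \<open>V\<close> the renewal equation would repeat its source periodically, without decay.\<close>

definition window_avg :: "(real \<Rightarrow> real) \<Rightarrow> real \<Rightarrow> real" where
  "window_avg h t = (\<integral>v. indicator {1..2} v * h (t - v) \<partial>lborel)"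

text \<open>Density at \<open>t\<close> of the leftover functional, averaged over \<open>V\<close>:
  \<open>min 1 (2 - t)\<close> is the probability that a cell still runs at time \<open>t\<close>,
  and the second term carries the density of \<open>V\<close>, the end of the cell.\<close>

definition renewal_source :: "real \<Rightarrow> real" where
  "renewal_source t = indicator {0..2} t * (t / 2 * min 1 (2 - t)) - indicator {1..2} t * (t\<^sup>2 / 4)"

primrec renewal_iter :: "nat \<Rightarrow> real \<Rightarrow> real" where
  "renewal_iter 0 t = 0"
| "renewal_iter (Suc j) t = renewal_source t + window_avg (renewal_iter j) t"

text \<open>The window at \<open>t\<close> reaches only up to \<open>t - 1\<close>, so each
  iteration settles one more unit of time and the value at \<open>t\<close> is final after floor(t)
  + 1 rounds. The solution of the renewal equation thus exists without any convergence
  argument.\<close>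

definition renewal_kernel :: "real \<Rightarrow> real" where
  "renewal_kernel t = renewal_iter (nat (\<lfloor>t\<rfloor> + 1)) t"

lemma integrable_bounded_on_Icc:
  fixes h :: "real \<Rightarrow> real"
  assumes [measurable]: "h \<in> borel_measurable borel"
    and "\<And>x. x \<in> {a..b} \<Longrightarrow> \<bar>h x\<bar> \<le> C" "\<And>x. x \<notin> {a..b} \<Longrightarrow> h x = 0"
  shows "integrable lborel h"
proof (rule Bochner_Integration.integrable_bound)
  show "integrable lborel (\<lambda>x. C * indicator {a..b} x :: real)"
    by (intro integrable_mult_right integrable_real_indicator) (auto simp: emeasure_lborel_Icc_eq)
  show "AE x in lborel. norm (h x) \<le> norm (C * indicator {a..b} x :: real)"
    using assms(2,3) by (intro AE_I2) (force simp: indicator_def)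
qed simp

lemma integrable_bounded_on_box:
  fixes h :: "real \<times> real \<Rightarrow> real"
  assumes meas: "h \<in> borel_measurable (lborel \<Otimes>\<^sub>M lborel)"
    and "\<And>x. x \<in> {a..b} \<times> {c..d} \<Longrightarrow> \<bar>h x\<bar> \<le> C" "\<And>x. x \<notin> {a..b} \<times> {c..d} \<Longrightarrow> h x = 0"
  shows "integrable (lborel \<Otimes>\<^sub>M lborel) h"
proof -
  have "integrable lborel (\<lambda>x. C * indicator ({a..b} \<times> {c..d}) x :: real)"
    by (intro integrable_mult_right integrable_real_indicator)
       (auto intro!: emeasure_bounded_finite[simplified] bounded_Times borel_closed closed_Times)
  then have "integrable lborel h"
  proof (rule Bochner_Integration.integrable_bound)
    show "AE x in lborel. norm (h x) \<le> norm (C * indicator ({a..b} \<times> {c..d}) x :: real)"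
      using assms(2,3) by (intro AE_I2) (force simp: indicator_def)
  qed (use meas in \<open>simp add: lborel_prod\<close>)
  then show ?thesis by (simp add: lborel_prod)
qed

lemma window_avg_measurable [measurable]:
  assumes [measurable]: "h \<in> borel_measurable borel"
  shows "window_avg h \<in> borel_measurable borel"
  unfolding window_avg_def by measurable

lemma abs_window_avg_le:
  assumes [measurable]: "h \<in> borel_measurable borel"
    and bound: "\<And>r. r \<in> {t - 2..t - 1} \<Longrightarrow> \<bar>h r\<bar> \<le> C"
  shows "\<bar>window_avg h t\<bar> \<le> C"
proof -
  have "integrable lborel (\<lambda>v. indicator {1..2} v * h (t - v))"
    by (rule integrable_bounded_on_Icc[where a = 1 and b = 2 and C = C]) (auto intro: bound)
  then have "\<bar>window_avg h t\<bar> \<le> (\<integral>v. \<bar>indicator {1..2} v * h (t - v)\<bar> \<partial>lborel)"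
    unfolding window_avg_def by (intro integral_abs_bound)
  also have "\<dots> \<le> (\<integral>v. C * indicator {1..2::real} v \<partial>lborel)"
    using \<open>integrable lborel _\<close>
    by (intro integral_mono integrable_abs integrable_mult_right integrable_real_indicator)
       (auto simp: indicator_def emeasure_lborel_Icc_eq intro: bound)
  finally show ?thesis by simp
qed

lemma window_avg_cong:
  assumes "\<And>r. r \<in> {t - 2..t - 1} \<Longrightarrow> h r = k r"
  shows "window_avg h t = window_avg k t"
  unfolding window_avg_def using assms
  by (intro Bochner_Integration.integral_cong) (auto simp: indicator_def)

lemma renewal_source_measurable [measurable]: "renewal_source \<in> borel_measurable borel"
  unfolding renewal_source_def by measurable

lemma renewal_source_eq_0: "t < 0 \<or> 2 < t \<Longrightarrow> renewal_source t = 0"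
  by (auto simp: renewal_source_def indicator_def)

lemma abs_renewal_source_le: "\<bar>renewal_source t\<bar> \<le> 1"
proof (cases "0 \<le> t \<and> t \<le> 2")
  case False then show ?thesis using renewal_source_eq_0[of t] by auto
next
  case True
  show ?thesis
  proof (cases "t < 1")
    case True then show ?thesis using \<open>0 \<le> t \<and> t \<le> 2\<close> by (auto simp: renewal_source_def)
  next
    case False
    then have "renewal_source t = t - 3/4 * t\<^sup>2"
      using True by (auto simp: renewal_source_def min_def field_simps power2_eq_square)
    moreover have "t - 3/4 * t\<^sup>2 - (-1) = (2 - t) * (3/4 * t + 1/2)"
      by (simp add: field_simps power2_eq_square)
    moreover have "(2 - t) * (3/4 * t + 1/2) \<ge> 0" using True by (intro mult_nonneg_nonneg) auto
    moreover have "1 - (t - 3/4 * t\<^sup>2) = 3/4 * (t - 2/3)\<^sup>2 + 2/3"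
      by (simp add: field_simps power2_eq_square)
    then have "1 - (t - 3/4 * t\<^sup>2) \<ge> 0" by simp
    ultimately show ?thesis by linarith
  qed
qed

lemma renewal_iter_measurable [measurable]: "renewal_iter j \<in> borel_measurable borel"
proof (induction j)
  case 0 then show ?case by (simp add: fun_eq_iff cong: measurable_cong)
next
  case (Suc j)
  have "renewal_iter (Suc j) = (\<lambda>t. renewal_source t + window_avg (renewal_iter j) t)" by auto
  then show ?case using Suc by simp
qed

lemma renewal_iter_neg: "t < 0 \<Longrightarrow> renewal_iter j t = 0"
proof (induction j arbitrary: t)
  case (Suc j)
  have "window_avg (renewal_iter j) t = window_avg (\<lambda>_. 0) t"
    using Suc by (intro window_avg_cong) auto
  then show ?case using Suc.prems by (simp add: renewal_source_eq_0 window_avg_def)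
qed simp

lemma renewal_iter_Suc_eq: "t < real j \<Longrightarrow> renewal_iter (Suc j) t = renewal_iter j t"
proof (induction j arbitrary: t)
  case 0 then show ?case using renewal_iter_neg[of t "Suc 0"] by simp
next
  case (Suc j)
  have "window_avg (renewal_iter (Suc j)) t = window_avg (renewal_iter j) t"
    using Suc by (intro window_avg_cong) auto
  then show ?case by simp
qed

lemma renewal_kernel_eq_iter:
  assumes "t < real j" shows "renewal_kernel t = renewal_iter j t"
proof -
  have "nat (\<lfloor>t\<rfloor> + 1) \<le> j" using assms by linarith
  then show ?thesis
  proof (induction rule: dec_induct)
    case base then show ?case by (simp add: renewal_kernel_def)
  next
    case (step i)
    have "t < real i" using step.hyps(1) by linarith
    then show ?case using step.IH renewal_iter_Suc_eq[of t i] by simp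
  qed
qed

lemma renewal_kernel_measurable [measurable]: "renewal_kernel \<in> borel_measurable borel"
proof (rule borel_measurable_LIMSEQ_real)
  fix t :: real
  obtain k where k: "t < real k" using reals_Archimedean2 by blast
  have "\<forall>\<^sub>F j in sequentially. renewal_iter j t = renewal_kernel t"
    using eventually_ge_at_top[of k]
    by eventually_elim (rule renewal_kernel_eq_iter[symmetric], use k in linarith)
  then show "(\<lambda>j. renewal_iter j t) \<longlonglongrightarrow> renewal_kernel t" by (rule tendsto_eventually)
qed simp

lemma renewal_kernel_neg: "t < 0 \<Longrightarrow> renewal_kernel t = 0"
  using renewal_kernel_eq_iter[of t 0] by simp

lemma renewal_equation: "renewal_kernel t = renewal_source t + window_avg renewal_kernel t"
proof -
  obtain j where j: "t < real j" using reals_Archimedean2 by blast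
  have "renewal_kernel t = renewal_iter (Suc j) t" using j by (intro renewal_kernel_eq_iter) simp
  also have "\<dots> = renewal_source t + window_avg (renewal_iter j) t" by simp
  also have "window_avg (renewal_iter j) t = window_avg renewal_kernel t"
    using j by (intro window_avg_cong renewal_kernel_eq_iter[symmetric]) auto
  finally show ?thesis .
qed

text \<open>Before time 1 the kernel is the source, at most 1. Up to time 2 it is the source plus an
  average of values from before time 1. After time 2 the source is gone and averaging cannot raise
  the bound. The sharper bound before time 1 is carried through the induction.\<close>

lemma abs_renewal_kernel_le_2: "\<bar>renewal_kernel t\<bar> \<le> 2"
proof -
  have "t < real j \<Longrightarrow> \<bar>renewal_kernel t\<bar> \<le> 2 \<and> (t < 1 \<longrightarrow> \<bar>renewal_kernel t\<bar> \<le> 1)" for j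
  proof (induction j arbitrary: t)
    case 0 then show ?case by (simp add: renewal_kernel_neg)
  next
    case (Suc j)
    show ?case
    proof (cases "t \<le> 2")
      case True
      have "\<bar>window_avg renewal_kernel t\<bar> \<le> 1" if "t < 1 \<or> 1 \<le> t"
      proof (rule abs_window_avg_le)
        fix r assume r: "r \<in> {t - 2..t - 1}"
        show "\<bar>renewal_kernel r\<bar> \<le> 1"
        proof (cases "r < 1")
          case True then show ?thesis using Suc.IH[of r] Suc.prems r by auto
        next
          case False
          \<comment> \<open>This endpoint is reached only from \<open>t = 2\<close>. The window of 1
            meets the nonnegative axis in the single point \<open>v = 1\<close>, so the kernel at 1
            is the source there, 1/4.\<close>
          then have r1: "r = 1" using r \<open>t \<le> 2\<close> by auto
          have "window_avg renewal_kernel 1 = window_avg (\<lambda>r. 0) 1"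
            unfolding window_avg_def
          proof (rule integral_cong_AE)
            have "AE v in lborel. v \<noteq> (1::real)" by (rule AE_lborel_singleton)
            then show "AE v in lborel. indicator {1..2} v * renewal_kernel (1 - v) = indicator {1..2} v * (0::real)"
              by eventually_elim (auto simp: indicator_def renewal_kernel_neg)
          qed auto
          then show ?thesis using r1 renewal_equation[of 1]
            by (simp add: renewal_source_def window_avg_def)
        qed
      qed simp
      moreover have "\<bar>window_avg renewal_kernel t\<bar> \<le> 0" if "t < 1"
        by (rule abs_window_avg_le) (use that in \<open>auto simp: renewal_kernel_neg\<close>)
      ultimately show ?thesis
        using renewal_equation[of t] abs_renewal_source_le[of t] by fastforce
    next
      case False
      have "\<bar>window_avg renewal_kernel t\<bar> \<le> 2"
        by (rule abs_window_avg_le) (use Suc in auto)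
      then show ?thesis using False renewal_equation[of t] by (simp add: renewal_source_eq_0)
    qed
  qed
  then show ?thesis using reals_Archimedean2 by blast
qed


section \<open>Exponential decay of the kernel\<close>

definition renewal_primitive :: "real \<Rightarrow> real" where
  "renewal_primitive x = (\<integral>r. indicator {..x} r * renewal_kernel r \<partial>lborel)"

lemma integrable_truncated_kernel:
  "integrable lborel (\<lambda>r. indicator {..x} r * renewal_kernel r)"
  by (rule integrable_bounded_on_Icc[where a = 0 and b = x and C = 2])
     (auto simp: indicator_def abs_renewal_kernel_le_2 renewal_kernel_neg)

lemma renewal_primitive_diff:
  assumes "x \<le> y"
  shows "renewal_primitive y - renewal_primitive x = (\<integral>r. indicator {x<..y} r * renewal_kernel r \<partial>lborel)"
  unfolding renewal_primitive_def
  by (subst Bochner_Integration.integral_diff[symmetric, OF integrable_truncated_kernel integrable_truncated_kernel],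
      rule Bochner_Integration.integral_cong) (use assms in \<open>auto simp: indicator_def\<close>)

lemma renewal_primitive_lipschitz:
  assumes "x \<le> y" "\<And>r. x \<le> r \<Longrightarrow> r \<le> y \<Longrightarrow> \<bar>renewal_kernel r\<bar> \<le> C"
  shows "\<bar>renewal_primitive y - renewal_primitive x\<bar> \<le> C * (y - x)"
proof -
  have int: "integrable lborel (\<lambda>r. indicator {x<..y} r * renewal_kernel r)"
    by (rule integrable_bounded_on_Icc[where a = x and b = y and C = 2])
       (auto simp: indicator_def abs_renewal_kernel_le_2)
  have "\<bar>renewal_primitive y - renewal_primitive x\<bar>
      \<le> (\<integral>r. \<bar>indicator {x<..y} r * renewal_kernel r\<bar> \<partial>lborel)"
    unfolding renewal_primitive_diff[OF assms(1)] by (rule integral_abs_bound)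
  also have "\<dots> \<le> (\<integral>r. C * indicator {x<..y} r \<partial>lborel)"
    using int assms
    by (intro integral_mono integrable_abs integrable_mult_right integrable_real_indicator)
       (auto simp: indicator_def)
  finally show ?thesis using assms(1) by simp
qed

text \<open>The cancellation behind everything that follows: for each cell length v the integral of
  t / 2 over [0, v] is v^2 / 4, so the two halves of the source have the same mass.\<close>

lemma integral_renewal_source: "(\<integral>r. renewal_source r \<partial>lborel) = 0"
proof -
  have 1: "has_bochner_integral lborel (\<lambda>r. r / 2 * indicator {0..1} r) ((1::real)\<^sup>2 / 4 - 0\<^sup>2 / 4)"
    by (rule has_bochner_integral_FTC_Icc_real[where F = "\<lambda>r. r\<^sup>2 / 4"])
       (auto intro!: derivative_eq_intros continuous_intros)
  have 2: "has_bochner_integral lborel (\<lambda>r. (r - 3/4 * r\<^sup>2) * indicator {1..2} r)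
      (((2::real)\<^sup>2 / 2 - 2 ^ 3 / 4) - (1\<^sup>2 / 2 - 1 ^ 3 / 4))"
    by (rule has_bochner_integral_FTC_Icc_real[where F = "\<lambda>r. r\<^sup>2 / 2 - r ^ 3 / 4"])
       (auto intro!: derivative_eq_intros continuous_intros simp: power2_eq_square)
  have "(\<integral>r. renewal_source r \<partial>lborel)
      = (\<integral>r. r / 2 * indicator {0..1} r + (r - 3/4 * r\<^sup>2) * indicator {1..2} r \<partial>lborel)"
  proof (rule integral_cong_AE)
    have "AE r in lborel. r \<noteq> (1::real)" by (rule AE_lborel_singleton)
    then show "AE r in lborel. renewal_source r
        = r / 2 * indicator {0..1} r + (r - 3/4 * r\<^sup>2) * indicator {1..2} r"
      by eventually_elim
         (auto simp: renewal_source_def indicator_def min_def field_simps power2_eq_square)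
  qed auto
  also have "\<dots> = 0"
    using has_bochner_integral_add[OF 1 2] by (simp add: has_bochner_integral_iff)
  finally show ?thesis .
qed

lemma window_avg_bounded_integrable:
  assumes [measurable]: "h \<in> borel_measurable borel" and "\<And>v. v \<in> {1..2} \<Longrightarrow> \<bar>h v\<bar> \<le> C"
  shows "integrable lborel (\<lambda>v. indicator {1..2::real} v * h v :: real)"
  by (rule integrable_bounded_on_Icc[where a = 1 and b = 2 and C = C])
     (use assms in \<open>auto simp: indicator_def\<close>)

lemma renewal_primitive_measurable [measurable]: "renewal_primitive \<in> borel_measurable borel"
proof -
  have eq: "renewal_primitive = (\<lambda>x. \<integral>r. (if r \<le> x then renewal_kernel r else 0) \<partial>lborel)"
    unfolding renewal_primitive_def
    by (intro ext Bochner_Integration.integral_cong) (auto simp: indicator_def)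
  show ?thesis by (subst eq) measurable
qed

lemma abs_renewal_primitive_le: "0 \<le> x \<Longrightarrow> \<bar>renewal_primitive x\<bar> \<le> 2 * x"
proof -
  have "renewal_primitive 0 = (\<integral>r. 0 \<partial>(lborel :: real measure))"
    unfolding renewal_primitive_def
  proof (rule integral_cong_AE)
    have "AE r in lborel. r \<noteq> (0::real)" by (rule AE_lborel_singleton)
    then show "AE r in lborel. indicator {..0::real} r * renewal_kernel r = 0"
      by eventually_elim (auto simp: indicator_def renewal_kernel_neg)
  qed auto
  then show "0 \<le> x \<Longrightarrow> ?thesis"
    using renewal_primitive_lipschitz[of 0 x 2] abs_renewal_kernel_le_2 by simp
qed

text \<open>Integrating the renewal equation; the source drops out because it has mean zero.\<close>

lemma renewal_primitive_equation:
  assumes "2 \<le> t"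
  shows "renewal_primitive t = window_avg renewal_primitive t"
proof -
  let ?h = "\<lambda>r v. indicator {..t} r * (indicator {1..2} v * renewal_kernel (r - v))"
  have supp: "0 \<le> r" if "renewal_kernel r \<noteq> 0" for r
    using that renewal_kernel_neg[of r] by linarith
  have int: "integrable (lborel \<Otimes>\<^sub>M lborel) (case_prod ?h)"
  proof (rule integrable_bounded_on_box[where a = 0 and b = t and c = 1 and d = 2 and C = 2])
    show "case_prod ?h \<in> borel_measurable (lborel \<Otimes>\<^sub>M lborel)" by measurable
  qed (auto simp: indicator_def abs_renewal_kernel_le_2 dest!: supp)
  have src: "integrable lborel renewal_source"
    by (rule integrable_bounded_on_Icc[where a = 0 and b = 2 and C = 1])
       (auto simp: abs_renewal_source_le renewal_source_eq_0)
  have avg: "integrable lborel (\<lambda>r. indicator {..t} r * window_avg renewal_kernel r)"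
  proof (rule integrable_bounded_on_Icc[where a = 0 and b = t and C = 2])
    fix r assume "r \<notin> {0..t}"
    then show "indicator {..t} r * window_avg renewal_kernel r = 0"
      using abs_window_avg_le[of renewal_kernel r 0]
      by (auto simp: indicator_def renewal_kernel_neg)
  qed (auto simp: indicator_def intro!: abs_window_avg_le abs_renewal_kernel_le_2)
  have "renewal_primitive t
      = (\<integral>r. renewal_source r + indicator {..t} r * window_avg renewal_kernel r \<partial>lborel)"
    unfolding renewal_primitive_def
  proof (intro Bochner_Integration.integral_cong refl)
    fix r
    show "indicator {..t} r * renewal_kernel r
        = renewal_source r + indicator {..t} r * window_avg renewal_kernel r"
      using renewal_equation[of r] renewal_source_eq_0[of r] assms
      by (auto simp: indicator_def)
  qed
  also have "\<dots> = (\<integral>r. indicator {..t} r * window_avg renewal_kernel r \<partial>lborel)"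
    by (simp add: Bochner_Integration.integral_add[OF src avg] integral_renewal_source)
  also have "\<dots> = (\<integral>r. \<integral>v. ?h r v \<partial>lborel \<partial>lborel)"
    unfolding window_avg_def by simp
  also have "\<dots> = (\<integral>v. \<integral>r. ?h r v \<partial>lborel \<partial>lborel)"
    by (rule lborel_pair.Fubini_integral[OF int, symmetric])
  also have "\<dots> = window_avg renewal_primitive t"
    unfolding window_avg_def
  proof (intro Bochner_Integration.integral_cong refl)
    fix v
    have "(\<integral>r. ?h r v \<partial>lborel)
        = (\<integral>r. indicator {1..2} v * (indicator {..t} r * renewal_kernel (r - v)) \<partial>lborel)"
      by (intro Bochner_Integration.integral_cong) auto
    also have "\<dots> = indicator {1..2} v * (\<integral>r. indicator {..t} r * renewal_kernel (r - v) \<partial>lborel)"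
      by simp
    also have "(\<integral>r. indicator {..t} r * renewal_kernel (r - v) \<partial>lborel)
        = (\<integral>r. indicator {..t} (v + r) * renewal_kernel r \<partial>lborel)"
      by (subst lborel_integral_real_affine[where c = 1 and t = v]) auto
    also have "\<dots> = renewal_primitive (t - v)"
      unfolding renewal_primitive_def
      by (intro Bochner_Integration.integral_cong) (auto simp: indicator_def)
    finally show "(\<integral>r. ?h r v \<partial>lborel) = indicator {1..2} v * renewal_primitive (t - v)" .
  qed
  finally show ?thesis .
qed

lemma window_avg_kernel:
  "window_avg renewal_kernel t = renewal_primitive (t - 1) - renewal_primitive (t - 2)"
proof -
  have "window_avg renewal_kernel t = (\<integral>r. indicator {1..2} (t - r) * renewal_kernel r \<partial>lborel)"
    unfolding window_avg_def by (subst lborel_integral_real_affine[where c = "-1" and t = t]) auto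
  also have "\<dots> = (\<integral>r. indicator {t - 2<..t - 1} r * renewal_kernel r \<partial>lborel)"
  proof (rule integral_cong_AE)
    have "AE r in lborel. r \<noteq> t - 2" by (rule AE_lborel_singleton)
    then show "AE r in lborel. indicator {1..2} (t - r) * renewal_kernel r
        = indicator {t - 2<..t - 1} r * renewal_kernel r"
      by eventually_elim (auto simp: indicator_def)
  qed auto
  finally show ?thesis by (simp add: renewal_primitive_diff)
qed

text \<open>
  For \<open>t \<ge> 3\<close> the kernel equals \<open>\<integral>\<^sub>1\<^sup>2 (N (t - 1 - v) - N (t - 2)) dv\<close> with \<open>N\<close> the primitive, and the
  integrand is at most \<open>v - 1\<close> times the supremum of the kernel on \<open>[t - 3, t - 2]\<close>.
\<close>

lemma renewal_kernel_halving:
  assumes t: "3 \<le> t" and C: "\<And>r. t - 3 \<le> r \<Longrightarrow> r \<le> t - 2 \<Longrightarrow> \<bar>renewal_kernel r\<bar> \<le> C"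
  shows "\<bar>renewal_kernel t\<bar> \<le> C / 2"
proof -
  let ?N = renewal_primitive
  have bd: "\<bar>?N x\<bar> \<le> 2 * t" if "0 \<le> x" "x \<le> t" for x
    using abs_renewal_primitive_le[of x] that by linarith
  have int1: "integrable lborel (\<lambda>v. indicator {1..2} v * ?N (t - 1 - v))"
    by (rule window_avg_bounded_integrable[where C = "2 * t"]) (use t bd in auto)
  have int2: "integrable lborel (\<lambda>v. indicator {1..2::real} v * ?N (t - 2))"
    by (rule window_avg_bounded_integrable[where C = "2 * t"]) (use t bd in auto)
  have "renewal_kernel t = ?N (t - 1) - ?N (t - 2)"
    using renewal_equation[of t] t by (simp add: window_avg_kernel renewal_source_eq_0)
  also have "?N (t - 1) = (\<integral>v. indicator {1..2} v * ?N (t - 1 - v) \<partial>lborel)"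
    using renewal_primitive_equation[of "t - 1"] t by (simp add: window_avg_def)
  also have "?N (t - 2) = (\<integral>v. indicator {1..2::real} v * ?N (t - 2) \<partial>lborel)" by simp
  finally have eq: "renewal_kernel t
      = (\<integral>v. indicator {1..2} v * ?N (t - 1 - v) - indicator {1..2} v * ?N (t - 2) \<partial>lborel)"
    using Bochner_Integration.integral_diff[OF int1 int2] by simp
  have hb: "has_bochner_integral lborel (\<lambda>v. (C * (v - 1)) * indicator {1..2} v)
      (C * (2 - 1)\<^sup>2 / 2 - C * (1 - 1)\<^sup>2 / 2)"
    by (rule has_bochner_integral_FTC_Icc_real[where F = "\<lambda>v. C * (v - 1)\<^sup>2 / 2"])
       (auto intro!: derivative_eq_intros continuous_intros simp: power2_eq_square)
  have "\<bar>renewal_kernel t\<bar>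
      \<le> (\<integral>v. \<bar>indicator {1..2} v * ?N (t - 1 - v) - indicator {1..2} v * ?N (t - 2)\<bar> \<partial>lborel)"
    unfolding eq by (rule integral_abs_bound)
  also have "\<dots> \<le> (\<integral>v. (C * (v - 1)) * indicator {1..2} v \<partial>lborel)"
  proof (rule integral_mono)
    fix v :: real
    show "\<bar>indicator {1..2} v * ?N (t - 1 - v) - indicator {1..2} v * ?N (t - 2)\<bar>
        \<le> (C * (v - 1)) * indicator {1..2} v"
      using renewal_primitive_lipschitz[of "t - 1 - v" "t - 2" C] C
      by (auto simp: indicator_def abs_minus_commute)
  qed (use hb in \<open>auto intro!: int1 int2 simp: has_bochner_integral_iff\<close>)
  also have "\<dots> = C / 2" using hb by (simp add: has_bochner_integral_iff)
  finally show ?thesis .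
qed

lemma exp_three_fifths_le_2: "exp (3/5::real) \<le> 2"
proof -
  have "exp (3/5::real) ^ 5 = exp 1 ^ 3" by (simp add: exp_of_nat_mult[symmetric])
  also have "\<dots> \<le> 3 ^ 3" by (intro power_mono exp_le) auto
  also have "\<dots> \<le> (2::real) ^ 5" by simp
  finally show ?thesis by (rule power_le_imp_le_base[of _ 4, simplified]) auto
qed

text \<open>The kernel halves over a lookback of at most three units, and exp(3/5) is at most 2,
  hence the rate 1/5. The factor 4 starts the induction: on [0, 3) the uniform bound 2 is below 4
  exp(-t/5).\<close>

lemma abs_renewal_kernel_le_exp:
  assumes "0 \<le> t" shows "\<bar>renewal_kernel t\<bar> \<le> 4 * exp (- t / 5)"
proof -
  have "0 \<le> t \<Longrightarrow> t < real j \<Longrightarrow> \<bar>renewal_kernel t\<bar> \<le> 4 * exp (- t / 5)" for j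
  proof (induction j arbitrary: t)
    case (Suc j)
    show ?case
    proof (cases "t < 3")
      case True
      have "1 = exp (t/5) * exp (- t / 5)" by (simp add: exp_add[symmetric])
      also have "\<dots> \<le> 2 * exp (- t / 5)"
      proof -
        have "exp (t/5) \<le> exp (3/5)" using True by simp
        then have "exp (t/5) \<le> 2" using exp_three_fifths_le_2 by linarith
        then show ?thesis by (intro mult_right_mono) auto
      qed
      finally show ?thesis using abs_renewal_kernel_le_2[of t] by linarith
    next
      case False
      have "\<bar>renewal_kernel t\<bar> \<le> (4 * exp (- (t - 3) / 5)) / 2"
      proof (rule renewal_kernel_halving)
        fix r assume r: "t - 3 \<le> r" "r \<le> t - 2"
        then have "\<bar>renewal_kernel r\<bar> \<le> 4 * exp (- r / 5)" using Suc False by auto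
        also have "\<dots> \<le> 4 * exp (- (t - 3) / 5)" using r by simp
        finally show "\<bar>renewal_kernel r\<bar> \<le> 4 * exp (- (t - 3) / 5)" .
      qed (use False in simp)
      also have "\<dots> = 2 * exp (- t / 5) * exp (3/5)" by (simp add: exp_add[symmetric] field_simps)
      also have "\<dots> \<le> 2 * exp (- t / 5) * 2" using exp_three_fifths_le_2 by (intro mult_left_mono) auto
      finally show ?thesis by simp
    qed
  qed simp
  then show ?thesis using assms reals_Archimedean2 by blast
qed

text \<open>Gradient norms grow at most linearly along the curves, so the kernel acts on functions
  of size (1 + r)^2. The number 1220 = 20 * 61 is the integral of 4 exp(-r/5) (1 + r)^2 over the
  half line.\<close>

lemma renewal_kernel_moment:
  "integrable lborel (\<lambda>r. \<bar>renewal_kernel r\<bar> * (1 + r)\<^sup>2)"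
  "(\<integral>r. \<bar>renewal_kernel r\<bar> * (1 + r)\<^sup>2 \<partial>lborel) \<le> 1220"
proof -
  let ?F = "\<lambda>r::real. - 20 * (r\<^sup>2 + 12 * r + 61) * exp (- r / 5)"
  have "(\<integral>\<^sup>+r. ennreal (4 * exp (- r / 5) * (1 + r)\<^sup>2) * indicator {0..} r \<partial>lborel) = 0 - ?F 0"
  proof (rule nn_integral_FTC_atLeast)
    show "(?F has_real_derivative 4 * exp (- r / 5) * (1 + r)\<^sup>2) (at r)" for r
      by (auto intro!: derivative_eq_intros simp: field_simps power2_eq_square)
    show "(?F \<longlongrightarrow> 0) at_top" by real_asymp
  qed auto
  then have nn: "(\<integral>\<^sup>+r. ennreal (4 * exp (- r / 5) * (1 + r)\<^sup>2) * indicator {0..} r \<partial>lborel) = ennreal 1220"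
    by simp
  have le: "(\<integral>\<^sup>+r. ennreal (\<bar>renewal_kernel r\<bar> * (1 + r)\<^sup>2) \<partial>lborel) \<le> ennreal 1220"
    unfolding nn[symmetric]
    by (intro nn_integral_mono)
       (auto simp: indicator_def not_le renewal_kernel_neg
          intro!: ennreal_leI mult_right_mono abs_renewal_kernel_le_exp[simplified])
  then show int: "integrable lborel (\<lambda>r. \<bar>renewal_kernel r\<bar> * (1 + r)\<^sup>2)"
    by (intro integrableI_bounded) (auto intro: le_less_trans)
  show "(\<integral>r. \<bar>renewal_kernel r\<bar> * (1 + r)\<^sup>2 \<partial>lborel) \<le> 1220"
    using le by (subst (asm) nn_integral_eq_integral[OF int]) (auto simp del: ennreal_numeral)
qed


section \<open>The kernel turns the leftover of a cell into a coboundary\<close>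

lemma integrable_renewal_kernel: "integrable lborel renewal_kernel"
proof (rule Bochner_Integration.integrable_bound[OF renewal_kernel_moment(1)], simp, intro AE_I2)
  fix r :: real
  have "\<bar>renewal_kernel r\<bar> * 1 \<le> \<bar>renewal_kernel r\<bar> * (1 + r)\<^sup>2"
  proof (cases "0 \<le> r")
    case True then show ?thesis by (intro mult_left_mono one_le_power) auto
  qed (simp add: renewal_kernel_neg)
  then show "norm (renewal_kernel r) \<le> norm (\<bar>renewal_kernel r\<bar> * (1 + r)\<^sup>2)" by simp
qed

lemma integrable_renewal_kernel_times:
  assumes [measurable]: "\<phi> \<in> borel_measurable borel" and "\<And>t. \<bar>\<phi> t\<bar> \<le> C"
  shows "integrable lborel (\<lambda>r. renewal_kernel r * \<phi> r)"
proof (rule Bochner_Integration.integrable_bound)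
  show "integrable lborel (\<lambda>r. C * renewal_kernel r)" using integrable_renewal_kernel by simp
  have "0 \<le> C" using assms(2)[of 0] by linarith
  then show "AE r in lborel. norm (renewal_kernel r * \<phi> r) \<le> norm (C * renewal_kernel r)"
    using assms(2) by (intro AE_I2) (simp add: abs_mult mult.commute[of C] mult_left_mono)
qed simp

text \<open>\<open>\<Lambda> v\<close> is the leftover of a cell of length \<open>v\<close> plus the
  corrector seen from its end. After exchanging the integrals, the coefficient of
  \<open>\<phi> t\<close> is the source plus the window average of the kernel, and the renewal
  equation says that this is the kernel again: on average a cell returns the corrector it started
  with.\<close>

lemma renewal_kernel_invariance:
  fixes \<phi> :: "real \<Rightarrow> real"
  assumes [measurable]: "\<phi> \<in> borel_measurable borel" and bound: "\<And>t. \<bar>\<phi> t\<bar> \<le> C"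
  defines "\<Lambda> \<equiv> \<lambda>v. (\<integral>t. indicator {0..v} t * (t / 2 * \<phi> t) \<partial>lborel) - v\<^sup>2 / 4 * \<phi> v
      + (\<integral>r. renewal_kernel r * \<phi> (v + r) \<partial>lborel)"
  shows "integrable lborel (\<lambda>v. indicator {1..2} v * \<Lambda> v)"
    and "(\<integral>v. indicator {1..2} v * \<Lambda> v \<partial>lborel) = (\<integral>r. renewal_kernel r * \<phi> r \<partial>lborel)"
proof -
  have C: "0 \<le> C" using bound[of 0] by linarith
  \<comment> \<open>The three summands of \<open>\<Lambda>\<close> cut off to \<open>v\<close> in
    [1, 2]. In \<open>c\<close> the kernel is shifted so that \<open>t\<close> is measured from the
    start of the cell in all three.\<close>
  define a where "a = (\<lambda>v t. indicator {1..2} v * (indicator {0..v} t * (t / 2 * \<phi> t)) :: real)"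
  define b where "b = (\<lambda>v. indicator {1..2} v * (v\<^sup>2 / 4 * \<phi> v) :: real)"
  define c where "c = (\<lambda>v t. indicator {1..2} v * (renewal_kernel (t - v) * \<phi> t) :: real)"
  have inta: "integrable (lborel \<Otimes>\<^sub>M lborel) (case_prod a)"
  proof (rule integrable_bounded_on_box[where a = 1 and b = 2 and c = 0 and d = 2 and C = C])
    have "a = (\<lambda>v t. indicator {1..2} v * (if 0 \<le> t \<and> t \<le> v then t / 2 * \<phi> t else 0))"
      by (auto simp: a_def indicator_def fun_eq_iff)
    then show "case_prod a \<in> borel_measurable (lborel \<Otimes>\<^sub>M lborel)" by simp
    show "\<bar>case_prod a x\<bar> \<le> C" for x
    proof (cases x)
      case (Pair v t)
      have "\<bar>t / 2 * \<phi> t\<bar> \<le> 1 * C" if "0 \<le> t" "t \<le> 2"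
        unfolding abs_mult using that bound by (intro mult_mono) auto
      then show ?thesis using Pair C by (auto simp: a_def indicator_def)
    qed
  qed (auto simp: a_def indicator_def)
  have intb: "integrable lborel b"
  proof (rule integrable_bounded_on_Icc[where a = 1 and b = 2 and C = C])
    show "\<bar>b v\<bar> \<le> C" if "v \<in> {1..2}" for v
    proof -
      have "v\<^sup>2 \<le> 2\<^sup>2" using that by (intro power_mono) auto
      then have "\<bar>v\<^sup>2 / 4 * \<phi> v\<bar> \<le> 1 * C"
        unfolding abs_mult using bound by (intro mult_mono) auto
      then show ?thesis using that by (auto simp: b_def)
    qed
  qed (auto simp: b_def)
  have shift: "(\<integral>t. renewal_kernel (t - v) * \<psi> t \<partial>lborel) = (\<integral>r. renewal_kernel r * \<psi> (v + r) \<partial>lborel)"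
    if [measurable]: "\<psi> \<in> borel_measurable borel" for v and \<psi> :: "real \<Rightarrow> real"
    by (subst lborel_integral_real_affine[where c = 1 and t = v]) auto
  have intsh: "integrable lborel (\<lambda>t. renewal_kernel (t - v) * \<phi> t)" for v
  proof -
    have "integrable lborel (\<lambda>r. renewal_kernel r * \<phi> (v + r))"
      by (rule integrable_renewal_kernel_times[where C = C]) (auto simp: bound)
    then show ?thesis
      by (subst lborel_integrable_real_affine_iff[where c = 1 and t = v, symmetric]) auto
  qed
  have intc: "integrable (lborel \<Otimes>\<^sub>M lborel) (case_prod c)"
  proof (rule lborel_pair.Fubini_integrable)
    show "case_prod c \<in> borel_measurable (lborel \<Otimes>\<^sub>M lborel)" unfolding c_def by measurable
    show "AE v in lborel. integrable lborel (\<lambda>t. case_prod c (v, t))"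
      using intsh by (auto simp: c_def)
    show "integrable lborel (\<lambda>v. \<integral>t. norm (case_prod c (v, t)) \<partial>lborel)"
    proof (rule integrable_bounded_on_Icc[where a = 1 and b = 2
          and C = "\<integral>r. \<bar>renewal_kernel r * C\<bar> \<partial>lborel"])
      fix v :: real assume v: "v \<in> {1..2}"
      have "(\<integral>t. norm (case_prod c (v, t)) \<partial>lborel) = (\<integral>t. \<bar>renewal_kernel (t - v) * \<phi> t\<bar> \<partial>lborel)"
        using v by (simp add: c_def)
      also have "\<dots> = (\<integral>r. \<bar>renewal_kernel r * \<phi> (v + r)\<bar> \<partial>lborel)"
        by (subst lborel_integral_real_affine[where c = 1 and t = v]) auto
      also have "\<dots> \<le> (\<integral>r. \<bar>renewal_kernel r * C\<bar> \<partial>lborel)"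
      proof (rule integral_mono)
        show "integrable lborel (\<lambda>r. \<bar>renewal_kernel r * \<phi> (v + r)\<bar>)"
          by (intro integrable_abs integrable_renewal_kernel_times[where C = C]) (auto simp: bound)
        show "integrable lborel (\<lambda>r. \<bar>renewal_kernel r * C\<bar>)"
          using integrable_renewal_kernel by (intro integrable_abs) simp
      qed (use bound C in \<open>auto simp: abs_mult intro!: mult_left_mono\<close>)
      finally show "\<bar>\<integral>t. norm (case_prod c (v, t)) \<partial>lborel\<bar> \<le> (\<integral>r. \<bar>renewal_kernel r * C\<bar> \<partial>lborel)"
        by simp
    qed (auto simp: c_def)
  qed
  have split: "(\<lambda>v. indicator {1..2} v * \<Lambda> v)
      = (\<lambda>v. (\<integral>t. a v t \<partial>lborel) - b v + (\<integral>t. c v t \<partial>lborel))"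
  proof
    fix v :: real
    show "indicator {1..2} v * \<Lambda> v = (\<integral>t. a v t \<partial>lborel) - b v + (\<integral>t. c v t \<partial>lborel)"
      by (cases "v \<in> {1..2}") (simp_all add: a_def b_def c_def \<Lambda>_def shift)
  qed
  have inta': "integrable lborel (\<lambda>v. \<integral>t. a v t \<partial>lborel)"
    using lborel_pair.integrable_fst'[OF inta] by simp
  have intc': "integrable lborel (\<lambda>v. \<integral>t. c v t \<partial>lborel)"
    using lborel_pair.integrable_fst'[OF intc] by simp
  show "integrable lborel (\<lambda>v. indicator {1..2} v * \<Lambda> v)"
    unfolding split using inta' intb intc' by simp
  \<comment> \<open>For fixed \<open>t\<close> the variable \<open>v\<close> runs over [max 1 t, 2],
    an interval of length \<open>min 1 (2 - t)\<close>.\<close>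
  have ia: "(\<integral>v. a v t \<partial>lborel) = \<phi> t * (indicator {0..2} t * (t / 2 * min 1 (2 - t)))" for t
  proof -
    have "(\<integral>v. a v t \<partial>lborel) = (\<integral>v. (if 0 \<le> t \<and> t \<le> 2 then t / 2 * \<phi> t else 0) * indicator {max 1 t..2} v \<partial>lborel)"
      by (intro Bochner_Integration.integral_cong) (auto simp: a_def indicator_def)
    then show ?thesis by (auto simp: max_def min_def)
  qed
  have ic: "(\<integral>v. c v t \<partial>lborel) = \<phi> t * window_avg renewal_kernel t" for t
  proof -
    have "(\<integral>v. c v t \<partial>lborel) = (\<integral>v. \<phi> t * (indicator {1..2} v * renewal_kernel (t - v)) \<partial>lborel)"
      by (intro Bochner_Integration.integral_cong) (auto simp: c_def)
    then show ?thesis by (simp add: window_avg_def)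
  qed
  have inta'': "integrable lborel (\<lambda>t. \<integral>v. a v t \<partial>lborel)"
    using lborel_pair.integrable_snd[OF inta] by simp
  have intc'': "integrable lborel (\<lambda>t. \<integral>v. c v t \<partial>lborel)"
    using lborel_pair.integrable_snd[OF intc] by simp
  have "(\<integral>v. indicator {1..2} v * \<Lambda> v \<partial>lborel)
      = (\<integral>v. \<integral>t. a v t \<partial>lborel \<partial>lborel) - (\<integral>v. b v \<partial>lborel) + (\<integral>v. \<integral>t. c v t \<partial>lborel \<partial>lborel)"
    unfolding split using inta' intb intc' by simp
  also have "\<dots> = (\<integral>t. \<integral>v. a v t \<partial>lborel \<partial>lborel) - (\<integral>t. b t \<partial>lborel) + (\<integral>t. \<integral>v. c v t \<partial>lborel \<partial>lborel)"
    using lborel_pair.Fubini_integral[OF inta] lborel_pair.Fubini_integral[OF intc] by simp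
  also have "\<dots> = (\<integral>t. (\<integral>v. a v t \<partial>lborel) - b t + (\<integral>v. c v t \<partial>lborel) \<partial>lborel)"
    using inta'' intb intc'' by simp
  also have "\<dots> = (\<integral>r. renewal_kernel r * \<phi> r \<partial>lborel)"
  proof (intro Bochner_Integration.integral_cong refl)
    fix t
    show "(\<integral>v. a v t \<partial>lborel) - b t + (\<integral>v. c v t \<partial>lborel) = renewal_kernel t * \<phi> t"
      unfolding ia ic b_def renewal_equation[of t] renewal_source_def by (simp add: algebra_simps)
  qed
  finally show "(\<integral>v. indicator {1..2} v * \<Lambda> v \<partial>lborel) = (\<integral>r. renewal_kernel r * \<phi> r \<partial>lborel)" .
qed

section \<open>Smooth convex functions and one step of the energy\<close>

lemma square_ratio_lipschitz:
  fixes A x y :: real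
  assumes "0 < A" "A \<le> x" "A \<le> y"
  shows "\<bar>(A / x)\<^sup>2 - (A / y)\<^sup>2\<bar> \<le> 2 * \<bar>x - y\<bar> / A"
proof -
  have "(A / x)\<^sup>2 - (A / y)\<^sup>2 = (A / x + A / y) * (A / x - A / y)"
    by (simp add: power2_eq_square algebra_simps)
  moreover have "A / x - A / y = (A / x) * (A / y) * ((y - x) / A)"
    using assms by (simp add: field_simps)
  moreover have xy: "0 \<le> A / x" "A / x \<le> 1" "0 \<le> A / y" "A / y \<le> 1"
    using assms by (simp_all add: divide_le_eq_1)
  ultimately have "\<bar>(A / x)\<^sup>2 - (A / y)\<^sup>2\<bar> = (A / x + A / y) * ((A / x) * (A / y) * (\<bar>x - y\<bar> / A))"
    using assms by (simp add: abs_mult abs_minus_commute)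
  also have "\<dots> \<le> 2 * (1 * 1 * (\<bar>x - y\<bar> / A))"
    using xy assms(1) by (intro mult_mono mult_nonneg_nonneg) auto
  finally show ?thesis by simp
qed

text \<open>The parameter counts time in units of the mesh \<open>e\<close> from the start of the
  cell, the scale of \<open>V\<close> and of the kernel. The physical time is
  \<open>A + e * t\<close>.\<close>

definition decay_path :: "real \<Rightarrow> real \<Rightarrow> 'a::real_vector \<Rightarrow> 'a \<Rightarrow> real \<Rightarrow> 'a" where
  "decay_path A e z d t = z - (A / (A + e * t))\<^sup>2 *\<^sub>R d"

lemma decay_path_0 [simp]: "A \<noteq> 0 \<Longrightarrow> decay_path A e z d 0 = z - d"
  by (simp add: decay_path_def)

lemma decay_path_lipschitz:
  fixes d :: "'a::real_normed_vector"
  assumes "0 < A" "0 \<le> e" "0 \<le> t" "0 \<le> t'"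
  shows "norm (decay_path A e z d t - decay_path A e z d t') \<le> 2 * \<bar>t - t'\<bar> * (e / A * norm d)"
proof -
  have "decay_path A e z d t - decay_path A e z d t'
      = - (((A / (A + e * t))\<^sup>2 - (A / (A + e * t'))\<^sup>2) *\<^sub>R d)"
    by (simp add: decay_path_def scaleR_left_diff_distrib)
  then have "norm (decay_path A e z d t - decay_path A e z d t')
      = \<bar>(A / (A + e * t))\<^sup>2 - (A / (A + e * t'))\<^sup>2\<bar> * norm d"
    by (simp only: norm_minus_cancel norm_scaleR)
  also have "\<dots> \<le> (2 * \<bar>(A + e * t) - (A + e * t')\<bar> / A) * norm d"
    using assms by (intro mult_right_mono square_ratio_lipschitz) auto
  also have "(A + e * t) - (A + e * t') = e * (t - t')" by (simp add: algebra_simps)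
  finally show ?thesis using assms by (simp add: abs_mult mult_ac)
qed

locale unit_smooth_convex =
  fixes f :: "'a::euclidean_space \<Rightarrow> real" and g :: "'a \<Rightarrow> 'a" and xs :: 'a
  assumes gradient: "GDERIV f x :> g x"
    and convex: "convex_on UNIV f"
    and lipschitz: "norm (g x - g y) \<le> norm (x - y)"
    and minimum: "f xs = 0"
    and nonneg: "0 \<le> f x"
begin

lemma has_derivative: "(f has_derivative (\<lambda>h. g x \<bullet> h)) (at x within S)"
  using gradient[of x] unfolding gderiv_def
  by (simp add: inner_commute has_derivative_at_withinI)

lemma DERIV_along:
  assumes "(p has_vector_derivative p') (at t)"
  shows "((\<lambda>t. f (p t)) has_real_derivative g (p t) \<bullet> p') (at t)"
proof -
  have "((\<lambda>t. f (p t)) has_derivative (\<lambda>h. g (p t) \<bullet> (h *\<^sub>R p'))) (at t)"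
    using assms has_derivative unfolding has_vector_derivative_def
    by (rule has_derivative_compose)
  moreover have "(\<lambda>h. g (p t) \<bullet> (h *\<^sub>R p')) = (*) (g (p t) \<bullet> p')" by (simp add: fun_eq_iff)
  ultimately show ?thesis by (simp only: has_field_derivative_def)
qed

lemma DERIV_line: "((\<lambda>t. f (x + t *\<^sub>R h)) has_real_derivative g (x + t *\<^sub>R h) \<bullet> h) (at t)"
  by (rule DERIV_along) (auto intro!: derivative_eq_intros)

lemma tangent_below: "f x + g x \<bullet> (y - x) \<le> f y"
proof -
  let ?\<phi> = "\<lambda>t. f (x + t *\<^sub>R (y - x))"
  have "convex_on UNIV ?\<phi>"
  proof (rule convex_onI)
    fix t a b :: real assume t: "0 < t" "t < 1"
    have "x + ((1 - t) *\<^sub>R a + t *\<^sub>R b) *\<^sub>R (y - x)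
        = (1 - t) *\<^sub>R (x + a *\<^sub>R (y - x)) + t *\<^sub>R (x + b *\<^sub>R (y - x))"
      by (simp add: algebra_simps)
    then show "?\<phi> ((1 - t) *\<^sub>R a + t *\<^sub>R b) \<le> (1 - t) * ?\<phi> a + t * ?\<phi> b"
      using convex_onD[OF convex, of t] t by simp
  qed simp
  then have "?\<phi> 1 - ?\<phi> 0 \<ge> (g (x + 0 *\<^sub>R (y - x)) \<bullet> (y - x)) * (1 - 0)"
    by (rule convex_on_imp_above_tangent) (use DERIV_line[of x "y - x" 0] in auto)
  then show ?thesis by simp
qed

lemma descent: "f (x + h) \<le> f x + g x \<bullet> h + (norm h)\<^sup>2 / 2"
proof -
  let ?\<psi> = "\<lambda>t. f (x + t *\<^sub>R h) - t * (g x \<bullet> h) - t\<^sup>2 * ((norm h)\<^sup>2 / 2)"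
  have "?\<psi> 1 \<le> ?\<psi> 0"
  proof (rule DERIV_nonpos_imp_nonincreasing[of 0 1 ?\<psi>])
    fix t :: real assume t: "0 \<le> t" "t \<le> 1"
    have "(g (x + t *\<^sub>R h) - g x) \<bullet> h \<le> norm (g (x + t *\<^sub>R h) - g x) * norm h"
      by (rule norm_cauchy_schwarz)
    also have "\<dots> \<le> (t * norm h) * norm h"
      using lipschitz[of "x + t *\<^sub>R h" x] t by (intro mult_right_mono) auto
    finally have "g (x + t *\<^sub>R h) \<bullet> h - g x \<bullet> h - 2 * t * ((norm h)\<^sup>2 / 2) \<le> 0"
      by (simp add: inner_diff_left power2_eq_square mult_ac)
    moreover have "(?\<psi> has_real_derivative
        g (x + t *\<^sub>R h) \<bullet> h - g x \<bullet> h - 2 * t * ((norm h)\<^sup>2 / 2)) (at t)"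
      by (auto intro!: derivative_eq_intros DERIV_line)
    ultimately show "\<exists>y. (?\<psi> has_real_derivative y) (at t) \<and> y \<le> 0" by blast
  qed simp
  then show ?thesis by simp
qed

lemma gradient_square_le: "(norm (g x))\<^sup>2 \<le> 2 * f x"
  using descent[of x "- g x"] nonneg[of "x - g x"] by (simp add: power2_norm_eq_inner)

lemma gradient_minimizer: "g xs = 0"
  using gradient_square_le[of xs] by (simp add: minimum)

text \<open>Compare the tangent at \<open>x\<close> with the descent bound from the minimizer, both
  at the point \<open>xs + g x\<close>. The gain of half the squared gradient over plain convexity
  is one of the two sources of dissipation.\<close>

lemma inner_gradient_ge: "f x + (norm (g x))\<^sup>2 / 2 \<le> g x \<bullet> (x - xs)"
proof -
  have "f x + g x \<bullet> (xs + g x - x) \<le> f (xs + g x)" by (rule tangent_below)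
  also have "\<dots> \<le> (norm (g x))\<^sup>2 / 2"
    using descent[of xs "g x"] by (simp add: minimum gradient_minimizer)
  finally show ?thesis by (simp add: inner_diff_right inner_add_right power2_norm_eq_inner)
qed

lemma value_le: "f x \<le> (norm (x - xs))\<^sup>2 / 2"
  using descent[of xs "x - xs"] by (simp add: minimum gradient_minimizer)

definition lyapunov :: "real \<Rightarrow> 'a \<Rightarrow> 'a \<Rightarrow> real" where
  "lyapunov A z d = A * f (z - d) + (norm (z - xs))\<^sup>2 + (norm d)\<^sup>2"

text \<open>One cell with nothing averaged yet. The bracket multiplied by \<open>- a\<close>
  averages over \<open>u\<close> to the increase of time * f along the curve. The next line is the
  leftover treated by the kernel. Of the rest, the factor (A / B)^4 and the negative squared
  gradient are dissipation, the other terms are errors.\<close>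

lemma lyapunov_step:
  fixes A a u :: real and z d :: 'a
  assumes A: "0 < A" and a: "0 < a" and u: "0 \<le> u" "u \<le> 1"
  defines "B \<equiv> A + a" and "s \<equiv> A + a * u"
  defines "gs \<equiv> g (z - (A / s)\<^sup>2 *\<^sub>R d)" and "gB \<equiv> g (z - (A / B)\<^sup>2 *\<^sub>R d)"
  shows "lyapunov B (z - (a / 2) *\<^sub>R gs) ((A / B)\<^sup>2 *\<^sub>R d - ((s / B)\<^sup>2 * (a / 2)) *\<^sub>R gs)
    \<le> B * f (z - (A / B)\<^sup>2 *\<^sub>R d) + (norm (z - xs))\<^sup>2 + (A / B) ^ 4 * (norm d)\<^sup>2
      - a * (f (z - (A / s)\<^sup>2 *\<^sub>R d) + 2 * (A / s)\<^sup>2 * (gs \<bullet> d))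
      + a * ((s - A) / 2 * (norm gs)\<^sup>2 - (B - s) / 2 * (norm gB)\<^sup>2)
      + a * (- (norm gs)\<^sup>2 / 2 + 4 * a / A * (norm gs * norm d)
             + a\<^sup>2 / (4 * A) * ((norm gB)\<^sup>2 + (norm gs)\<^sup>2) + a / 2 * (norm (gB - gs))\<^sup>2
             + a ^ 3 / (2 * A) * (norm gs)\<^sup>2)"
proof -
  define Ps PB where "Ps = z - (A / s)\<^sup>2 *\<^sub>R d" and "PB = z - (A / B)\<^sup>2 *\<^sub>R d"
  define \<sigma> \<omega> G where "\<sigma> = s / B" and "\<omega> = (B\<^sup>2 - s\<^sup>2) / (2 * B)" and "G = (norm gs)\<^sup>2"
  define \<theta> where "\<theta> = a / 2 * (1 - \<sigma>\<^sup>2)"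
  have ord: "A \<le> s" "s \<le> B" "0 < s" "0 < B" "A \<le> B"
    using A a u mult_left_le[of u a] by (auto simp: s_def B_def intro: add_pos_nonneg)
  \<comment> \<open>The jump lowers \<open>B * f\<close> with coefficient
    \<open>B * \<theta>\<close>, and \<open>\<omega>\<close> agrees with the remaining cell time
    \<open>B - s\<close> up to a^2 / (2 A).\<close>
  have \<theta>\<omega>: "B * \<theta> = a * \<omega>"
  proof -
    have "B * (1 - \<sigma>\<^sup>2) = (B\<^sup>2 - s\<^sup>2) / B"
      using ord by (simp add: \<sigma>_def power_divide right_diff_distrib diff_divide_distrib power2_eq_square)
    moreover have "B * \<theta> = a / 2 * (B * (1 - \<sigma>\<^sup>2))" by (simp add: \<theta>_def)
    ultimately show ?thesis by (simp add: \<omega>_def)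
  qed
  have \<omega>eq: "\<omega> = (B - s) - (B - s)\<^sup>2 / (2 * B)"
    using ord by (simp add: \<omega>_def power2_eq_square field_simps)
  have Bs: "0 \<le> B - s" "B - s \<le> a" using ord by (auto simp: B_def)
  have \<omega>le: "\<omega> \<le> a"
  proof -
    have "0 \<le> (B - s)\<^sup>2 / (2 * B)" using ord by simp
    then show ?thesis unfolding \<omega>eq using Bs by linarith
  qed
  have \<omega>0: "0 \<le> \<omega>" unfolding \<omega>_def using ord by (simp add: power_mono)
  have \<omega>ge: "(B - s) - a\<^sup>2 / (2 * A) \<le> \<omega>"
  proof -
    have "(B - s)\<^sup>2 / (2 * B) \<le> a\<^sup>2 / (2 * A)"
      using Bs ord A by (intro frac_le power_mono) auto
    then show ?thesis unfolding \<omega>eq by simp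
  qed
  have \<sigma>: "0 \<le> \<sigma>" "\<sigma> \<le> 1" using ord by (simp_all add: \<sigma>_def)
  \<comment> \<open>The start of the next curve is the end of the old one, displaced along
    \<open>gs\<close> only.\<close>
  have q: "(z - (a / 2) *\<^sub>R gs) - ((A / B)\<^sup>2 *\<^sub>R d - ((s / B)\<^sup>2 * (a / 2)) *\<^sub>R gs)
      = PB + (- \<theta>) *\<^sub>R gs"
    by (simp add: PB_def \<theta>_def \<sigma>_def algebra_simps scaleR_diff_left)
  have nrm: "(norm ((- \<theta>) *\<^sub>R gs))\<^sup>2 = \<theta>\<^sup>2 * G"
    by (simp add: G_def power_mult_distrib)
  have 1: "B * f (PB + (- \<theta>) *\<^sub>R gs) \<le> B * f PB - a * \<omega> * (gB \<bullet> gs) + a * (a ^ 3 / (2 * A) * G)"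
  proof -
    have "B * f (PB + (- \<theta>) *\<^sub>R gs) \<le> B * (f PB + gB \<bullet> ((- \<theta>) *\<^sub>R gs) + (norm ((- \<theta>) *\<^sub>R gs))\<^sup>2 / 2)"
      using descent[of PB "(- \<theta>) *\<^sub>R gs"] ord by (intro mult_left_mono) (auto simp: gB_def PB_def)
    also have "\<dots> = B * f PB - (B * \<theta>) * (gB \<bullet> gs) + (B * \<theta>)\<^sup>2 / (2 * B) * G"
      using ord by (simp only: nrm inner_scaleR_right) (simp add: algebra_simps power2_eq_square)
    also have "(B * \<theta>)\<^sup>2 / (2 * B) * G \<le> (a * a)\<^sup>2 / (2 * A) * G"
      unfolding \<theta>\<omega> G_def using ord A a \<omega>0 \<omega>le
      by (intro mult_right_mono frac_le power_mono mult_left_mono) auto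
    finally show ?thesis by (simp add: \<theta>\<omega> power2_eq_square power3_eq_cube mult_ac)
  qed
  have 2: "(norm (z - (a / 2) *\<^sub>R gs - xs))\<^sup>2
      = (norm (z - xs))\<^sup>2 - a * (gs \<bullet> (z - xs)) + a\<^sup>2 / 4 * G"
  proof -
    have "z - (a / 2) *\<^sub>R gs - xs = (z - xs) - (a / 2) *\<^sub>R gs" by simp
    then show ?thesis unfolding G_def
      by (simp only: power2_norm_eq_inner)
         (simp add: inner_diff_left inner_diff_right inner_commute algebra_simps power2_eq_square)
  qed
  have 3: "(norm ((A / B)\<^sup>2 *\<^sub>R d - ((s / B)\<^sup>2 * (a / 2)) *\<^sub>R gs))\<^sup>2
      = (A / B) ^ 4 * (norm d)\<^sup>2 - a * ((A / B)\<^sup>2 * \<sigma>\<^sup>2) * (gs \<bullet> d) + \<sigma> ^ 4 * (a\<^sup>2 / 4) * G"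
  proof -
    define \<alpha> \<beta> where "\<alpha> = (A / B)\<^sup>2" and "\<beta> = \<sigma>\<^sup>2 * (a / 2)"
    have "(norm (\<alpha> *\<^sub>R d - \<beta> *\<^sub>R gs))\<^sup>2 = \<alpha>\<^sup>2 * (norm d)\<^sup>2 - 2 * \<alpha> * \<beta> * (gs \<bullet> d) + \<beta>\<^sup>2 * G"
      unfolding G_def
      by (simp only: power2_norm_eq_inner)
         (simp add: inner_diff_left inner_diff_right inner_commute algebra_simps power2_eq_square)
    moreover have "\<alpha>\<^sup>2 = (A / B) ^ 4" "\<beta>\<^sup>2 = \<sigma> ^ 4 * (a\<^sup>2 / 4)" "2 * \<alpha> * \<beta> = a * ((A / B)\<^sup>2 * \<sigma>\<^sup>2)"
      by (simp_all add: \<alpha>_def \<beta>_def power_mult_distrib power_divide flip: power_mult)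
    ultimately show ?thesis by (simp add: \<alpha>_def \<beta>_def \<sigma>_def)
  qed
  have 4: "f Ps + G / 2 + (A / s)\<^sup>2 * (gs \<bullet> d) \<le> gs \<bullet> (z - xs)"
  proof -
    have "z - xs = (Ps - xs) + (A / s)\<^sup>2 *\<^sub>R d" by (simp add: Ps_def)
    then have "gs \<bullet> (z - xs) = gs \<bullet> (Ps - xs) + (A / s)\<^sup>2 * (gs \<bullet> d)"
      by (simp only: inner_add_right inner_scaleR_right)
    then show ?thesis using inner_gradient_ge[of Ps] by (simp add: G_def gs_def Ps_def)
  qed
  \<comment> \<open>Two copies of (A / s)^2 (gs . d) are wanted. Rewriting z - xs around the query
    point supplies one; expanding the square of the new d supplies the other, but multiplied by
    \<sigma>^4. This bounds the discrepancy.\<close>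
  have 5: "((A / s)\<^sup>2 - (A / B)\<^sup>2 * \<sigma>\<^sup>2) * (gs \<bullet> d) \<le> 4 * a / A * (norm gs * norm d)"
  proof -
    have "A / B = A / s * \<sigma>" using ord by (simp add: \<sigma>_def)
    then have eq: "(A / s)\<^sup>2 - (A / B)\<^sup>2 * \<sigma>\<^sup>2 = (A / s)\<^sup>2 * ((1 + \<sigma>\<^sup>2) * ((1 + \<sigma>) * (1 - \<sigma>)))"
      by (simp add: algebra_simps power2_eq_square)
    have "1 - \<sigma> = (B - s) / B" using ord by (simp add: \<sigma>_def field_simps)
    also have "\<dots> \<le> a / A" using Bs ord A by (intro frac_le) auto
    finally have \<sigma>1: "1 - \<sigma> \<le> a / A" .
    have \<sigma>2: "\<sigma>\<^sup>2 \<le> 1" using \<sigma> by (simp add: power_le_one)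
    have "(A / s)\<^sup>2 * ((1 + \<sigma>\<^sup>2) * ((1 + \<sigma>) * (1 - \<sigma>))) \<le> 1 * (2 * (2 * (a / A)))"
      using ord A a \<sigma> \<sigma>1 \<sigma>2 by (intro mult_mono power_le_one) auto
    moreover have "0 \<le> (A / s)\<^sup>2 * ((1 + \<sigma>\<^sup>2) * ((1 + \<sigma>) * (1 - \<sigma>)))"
      using \<sigma> by auto
    ultimately have "0 \<le> (A / s)\<^sup>2 - (A / B)\<^sup>2 * \<sigma>\<^sup>2" "(A / s)\<^sup>2 - (A / B)\<^sup>2 * \<sigma>\<^sup>2 \<le> 4 * a / A"
      unfolding eq by auto
    moreover have "gs \<bullet> d \<le> norm gs * norm d" by (rule norm_cauchy_schwarz)
    ultimately show ?thesis
      by (meson mult_left_mono mult_right_mono norm_ge_zero mult_nonneg_nonneg order_trans)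
  qed
  \<comment> \<open>Polarization: the product of the gradients at the query and at the end of the
    cell becomes their squares, at the cost of the squared difference.\<close>
  have 6: "- \<omega> * (gB \<bullet> gs) \<le> - (B - s) / 2 * ((norm gB)\<^sup>2 + G)
      + a\<^sup>2 / (4 * A) * ((norm gB)\<^sup>2 + G) + a / 2 * (norm (gB - gs))\<^sup>2"
  proof -
    have n: "(norm (gB - gs))\<^sup>2 = (norm gB)\<^sup>2 + G - 2 * (gB \<bullet> gs)"
      unfolding G_def
      by (simp only: power2_norm_eq_inner)
         (simp add: inner_diff_left inner_diff_right inner_commute)
    have "- \<omega> * (gB \<bullet> gs) = \<omega> / 2 * (norm (gB - gs))\<^sup>2 - \<omega> / 2 * ((norm gB)\<^sup>2 + G)"
      unfolding n by (simp add: algebra_simps add_divide_distrib)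
    moreover have "\<omega> / 2 * (norm (gB - gs))\<^sup>2 \<le> a / 2 * (norm (gB - gs))\<^sup>2"
      using \<omega>le by (intro mult_right_mono) auto
    moreover have "((B - s) / 2 - a\<^sup>2 / (4 * A)) * ((norm gB)\<^sup>2 + G) \<le> \<omega> / 2 * ((norm gB)\<^sup>2 + G)"
    proof (rule mult_right_mono)
      define K where "K = a\<^sup>2 / (4 * A)"
      have "B - s - 2 * K \<le> \<omega>" using \<omega>ge by (simp add: K_def)
      then have "(B - s - 2 * K) / 2 \<le> \<omega> / 2" by (rule divide_right_mono) simp
      then show "(B - s) / 2 - a\<^sup>2 / (4 * A) \<le> \<omega> / 2"
        unfolding K_def[symmetric] by (simp add: diff_divide_distrib)
    qed (simp add: G_def)
    then have "(B - s) / 2 * ((norm gB)\<^sup>2 + G) - a\<^sup>2 / (4 * A) * ((norm gB)\<^sup>2 + G)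
        \<le> \<omega> / 2 * ((norm gB)\<^sup>2 + G)"
      by (simp only: left_diff_distrib)
    moreover have "- (B - s) / 2 * ((norm gB)\<^sup>2 + G) = - ((B - s) / 2 * ((norm gB)\<^sup>2 + G))"
      by (simp only: mult_minus_left flip: minus_divide_left)
    ultimately show ?thesis by linarith
  qed
  have 7: "\<sigma> ^ 4 * (a\<^sup>2 / 4) * G \<le> a\<^sup>2 / 4 * G"
  proof -
    have "\<sigma> ^ 4 * (a\<^sup>2 / 4 * G) \<le> 1 * (a\<^sup>2 / 4 * G)"
      using \<sigma> by (intro mult_right_mono power_le_one) (auto simp: G_def)
    then show ?thesis by (simp add: mult.assoc)
  qed
  have 8: "a * (\<omega> * - (gB \<bullet> gs)) \<le> a * (- (B - s) / 2 * ((norm gB)\<^sup>2 + G)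
      + a\<^sup>2 / (4 * A) * ((norm gB)\<^sup>2 + G) + a / 2 * (norm (gB - gs))\<^sup>2)"
    using 6 a by (intro mult_left_mono) auto
  have 9: "a * (((A / s)\<^sup>2 - (A / B)\<^sup>2 * \<sigma>\<^sup>2) * (gs \<bullet> d)) \<le> a * (4 * a / A * (norm gs * norm d))"
    using 5 a by (intro mult_left_mono) auto
  have 10: "a * (f Ps + G / 2 + (A / s)\<^sup>2 * (gs \<bullet> d)) \<le> a * (gs \<bullet> (z - xs))"
    using 4 a by (intro mult_left_mono) auto
  \<comment> \<open>The jumps of z and d cost at most a^2 / 4 G each. Splitting a into s - A and B -
    s, the second part cancels against the G produced by polarization.\<close>
  have 11: "a * ((s - A) / 2 * G) = a\<^sup>2 / 2 * G - a * ((B - s) / 2 * G)"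
    by (simp add: B_def algebra_simps power2_eq_square add_divide_distrib diff_divide_distrib)
  show ?thesis
    unfolding lyapunov_def q 2 3
    unfolding Ps_def[symmetric] PB_def[symmetric] G_def[symmetric]
    using 1 7 8 9 10 11 by (simp add: algebra_simps add_divide_distrib diff_divide_distrib)
qed

end

section \<open>The mesh and the error budgets of one cell\<close>

definition mesh :: "real \<Rightarrow> real" where
  "mesh A = A powr (1/3) / 512"

lemma mesh_pos: "0 < A \<Longrightarrow> 0 < mesh A"
  by (simp add: mesh_def)

text \<open>The scaling identity of the method: errors smaller than a dissipation term by the factor
  e^3 / A are smaller by the fixed number 2^(-27).\<close>

lemma mesh_cube: "0 < A \<Longrightarrow> mesh A ^ 3 = A / 2 ^ 27"
  by (simp add: mesh_def power_divide powr_power)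

lemma mesh_square_le:
  assumes "1 \<le> A" shows "(mesh A)\<^sup>2 \<le> A / 2 ^ 18"
proof -
  have "A powr (2/3) \<le> A powr 1" using assms by (intro powr_mono) auto
  then show ?thesis using assms by (simp add: mesh_def power_divide powr_power)
qed

lemma mesh_ge: "1 \<le> A \<Longrightarrow> 1 / 512 \<le> mesh A"
  by (simp add: mesh_def ge_one_powr_ge_zero)

lemma mesh_le:
  assumes "1 \<le> A" shows "mesh A \<le> A / 512"
proof -
  have "A powr (1/3) \<le> A powr 1" using assms by (intro powr_mono) auto
  then show ?thesis using assms by (simp add: mesh_def)
qed

lemma mesh_growth:
  assumes "1 \<le> A" "A \<le> B"
  shows "mesh A \<le> mesh B" "mesh B \<le> mesh A * (B / A)" "(mesh B)\<^sup>2 \<le> (mesh A)\<^sup>2 * (B / A)"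
proof -
  have eq: "mesh B = mesh A * (B / A) powr (1/3)"
    using assms by (simp add: mesh_def powr_divide)
  have r: "1 \<le> B / A" using assms by simp
  have p1: "(B / A) powr (1/3) \<le> (B / A) powr 1" "(B / A) powr (2/3) \<le> (B / A) powr 1"
    using r by (intro powr_mono; simp)+
  show "mesh A \<le> mesh B" using assms by (simp add: mesh_def powr_mono2)
  show "mesh B \<le> mesh A * (B / A)"
    unfolding eq using p1(1) r mesh_pos[of A] assms by (intro mult_left_mono) auto
  have "(mesh B)\<^sup>2 = (mesh A)\<^sup>2 * (B / A) powr (2/3)"
    unfolding eq using assms by (simp add: power_mult_distrib powr_power)
  also have "\<dots> \<le> (mesh A)\<^sup>2 * (B / A)"
    using p1(2) r by (intro mult_left_mono) auto
  finally show "(mesh B)\<^sup>2 \<le> (mesh A)\<^sup>2 * (B / A)" .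
qed

text \<open>Here \<open>x\<close>, \<open>y\<close>, \<open>w\<close> stand for the gradient norms
  at the query and at the end of the cell and for the norm of their difference; \<gamma> and
  \<delta> are the norms of the gradient at the start of the curve and of d. A cell lasts at most 2
  mesh units and the curve moves by at most 2 \<eta> per unit, hence 4 \<eta>. The eighths left on
  the right are reserved for the corrector.\<close>

lemma cell_error_budget:
  fixes A e v \<gamma> \<delta> x y w :: real
  assumes A: "1 \<le> A" and v: "1 \<le> v" "v \<le> 2" and e: "e = mesh A"
    and nn: "0 \<le> \<gamma>" "0 \<le> \<delta>" "0 \<le> x" "0 \<le> y" "0 \<le> w"
  defines "a \<equiv> e * v" and "\<eta> \<equiv> e / A * \<delta>"
  assumes x: "x \<le> \<gamma> + 4 * \<eta>" "\<gamma> \<le> x + 4 * \<eta>" and y: "y \<le> \<gamma> + 4 * \<eta>" and w: "w \<le> 4 * \<eta>"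
  shows "(A / (A + a)) ^ 4 * \<delta>\<^sup>2 + a * (- x\<^sup>2 / 2 + 4 * a / A * (x * \<delta>)
      + a\<^sup>2 / (4 * A) * (y\<^sup>2 + x\<^sup>2) + a / 2 * w\<^sup>2 + a ^ 3 / (2 * A) * x\<^sup>2)
    \<le> \<delta>\<^sup>2 - e * \<gamma>\<^sup>2 / 8 - e / A * \<delta>\<^sup>2 / 8"
proof -
  have e0: "0 < e" and e2: "e\<^sup>2 \<le> A / 262144" and e3: "e ^ 3 = A / 134217728" and e1: "e \<le> A / 512"
    using A mesh_pos[of A] mesh_square_le[of A] mesh_cube[of A] mesh_le[of A] by (auto simp: e)
  have \<eta>0: "0 \<le> \<eta>" using A e0 nn by (simp add: \<eta>_def)
  have a: "e \<le> a" "a \<le> 2 * e" "0 < a" using e0 v by (auto simp: a_def)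
  define D T where "D = e / A * \<delta>\<^sup>2" and "T = (\<gamma> + 4 * \<eta>)\<^sup>2"
  have D0: "0 \<le> D" and T0: "0 \<le> T" using A e0 by (auto simp: D_def T_def)
  have T: "e * T \<le> 2 * (e * \<gamma>\<^sup>2) + 32 * (e * \<eta>\<^sup>2)"
  proof -
    have "T \<le> 2 * \<gamma>\<^sup>2 + 32 * \<eta>\<^sup>2"
      using zero_le_power2[of "\<gamma> - 4 * \<eta>"] by (simp add: T_def power2_eq_square algebra_simps)
    then have "e * T \<le> e * (2 * \<gamma>\<^sup>2 + 32 * \<eta>\<^sup>2)" using e0 by (intro mult_left_mono) auto
    then show ?thesis by (simp add: algebra_simps)
  qed
  have xT: "x\<^sup>2 \<le> T" and yT: "y\<^sup>2 \<le> T" using x y nn by (auto simp: T_def intro: power_mono)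
  have e\<eta>: "e * \<eta>\<^sup>2 \<le> D / 262144"
  proof -
    have "e * \<eta>\<^sup>2 = (e\<^sup>2 / A) * D" using A by (simp add: \<eta>_def D_def power2_eq_square)
    also have "\<dots> \<le> (1 / 262144) * D"
      using e2 A D0 by (intro mult_right_mono) (auto simp: field_simps)
    finally show ?thesis by simp
  qed
  have 1: "a * (- x\<^sup>2 / 2) \<le> - (e * \<gamma>\<^sup>2) / 4 + 8 * (e * \<eta>\<^sup>2)"
  proof -
    have "\<gamma>\<^sup>2 \<le> (x + 4 * \<eta>)\<^sup>2" using x nn by (intro power_mono) auto
    then have "\<gamma>\<^sup>2 \<le> 2 * x\<^sup>2 + 32 * \<eta>\<^sup>2"
      using zero_le_power2[of "x - 4 * \<eta>"] by (simp add: power2_eq_square algebra_simps)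
    then have "e * (\<gamma>\<^sup>2 / 4 - 8 * \<eta>\<^sup>2) \<le> e * (x\<^sup>2 / 2)" using e0 by (intro mult_left_mono) auto
    also have "\<dots> \<le> a * (x\<^sup>2 / 2)" using a by (intro mult_right_mono) auto
    finally show ?thesis by (simp add: algebra_simps)
  qed
  have 2: "a * (4 * a / A * (x * \<delta>)) \<le> e * \<gamma>\<^sup>2 / 16 + 1088 * (e * \<eta>\<^sup>2)"
  proof -
    have "a * (4 * a / A * (x * \<delta>)) = 4 * (a * a) / A * (x * \<delta>)" by simp
    also have "\<dots> \<le> 4 * ((2 * e) * (2 * e)) / A * ((\<gamma> + 4 * \<eta>) * \<delta>)"
      using a e0 A nn x by (intro mult_mono divide_right_mono mult_left_mono) auto
    also have "\<dots> = e * (16 * (\<gamma> + 4 * \<eta>) * \<eta>)" by (simp add: \<eta>_def)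
    \<comment> \<open>Young's inequality: 16 \<gamma> \<eta> costs \<gamma>^2 / 16 and 1024
      \<eta>^2, to which 64 \<eta>^2 is added.\<close>
    also have "\<dots> \<le> e * (\<gamma>\<^sup>2 / 16 + 1088 * \<eta>\<^sup>2)"
    proof (rule mult_left_mono)
      show "16 * (\<gamma> + 4 * \<eta>) * \<eta> \<le> \<gamma>\<^sup>2 / 16 + 1088 * \<eta>\<^sup>2"
        using zero_le_power2[of "\<gamma> / 4 - 32 * \<eta>"] by (simp add: power2_eq_square algebra_simps)
    qed (use e0 in simp)
    finally show ?thesis by (simp add: algebra_simps)
  qed
  have 3: "a * (a\<^sup>2 / (4 * A) * (y\<^sup>2 + x\<^sup>2)) \<le> e * T / 65536"
  proof -
    have "a * (a\<^sup>2 / (4 * A) * (y\<^sup>2 + x\<^sup>2)) \<le> (2 * e) * ((2 * e)\<^sup>2 / (4 * A) * (T + T))"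
      using a e0 A xT yT T0 by (intro mult_mono divide_right_mono power_mono add_mono) auto
    also have "\<dots> = 4 * (e\<^sup>2 / A) * (e * T)" by (simp add: power2_eq_square)
    also have "\<dots> \<le> 4 * (1 / 262144) * (e * T)"
      using e2 A T0 e0 by (intro mult_right_mono mult_left_mono) (auto simp: field_simps)
    finally show ?thesis by simp
  qed
  \<comment> \<open>This is e^3 / A times the dissipation \<open>D\<close>, and item 5 is e^3 / A
    times the gradient dissipation: these two items admit no mesh exponent above 1/3.\<close>
  have 4: "a * (a / 2 * w\<^sup>2) \<le> D / 4194304"
  proof -
    have "a * (a / 2 * w\<^sup>2) \<le> (2 * e) * ((2 * e) / 2 * (4 * \<eta>)\<^sup>2)"
      using a e0 w nn \<eta>0 by (intro mult_mono divide_right_mono power_mono) auto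
    also have "\<dots> = 32 * (e ^ 3 / A) * D" using A
      by (simp add: \<eta>_def D_def power2_eq_square power3_eq_cube field_simps)
    also have "\<dots> = D / 4194304" using A by (simp add: e3)
    finally show ?thesis .
  qed
  have 5: "a * (a ^ 3 / (2 * A) * x\<^sup>2) \<le> e * T / 16777216"
  proof -
    have "a * (a ^ 3 / (2 * A) * x\<^sup>2) \<le> (2 * e) * ((2 * e) ^ 3 / (2 * A) * T)"
      using a e0 A xT T0 by (intro mult_mono divide_right_mono power_mono) auto
    also have "\<dots> = 8 * (e ^ 3 / A) * (e * T)" by (simp add: power3_eq_cube)
    finally show ?thesis using A by (simp add: e3)
  qed
  \<comment> \<open>The other source of dissipation: d contracts over the cell, and a is at least e
    while A + a is at most 2 A.\<close>
  have 6: "(A / (A + a)) ^ 4 * \<delta>\<^sup>2 \<le> \<delta>\<^sup>2 - D / 2"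
  proof -
    have "(A / (A + a)) ^ 4 \<le> (A / (A + a)) ^ 1"
      using A a by (intro power_decreasing) auto
    also have "(A / (A + a)) ^ 1 = 1 - a / (A + a)" using A a by (simp add: field_simps)
    also have "\<dots> \<le> 1 - e / (2 * A)"
    proof -
      have "e / (2 * A) \<le> a / (A + a)" using a A e1 e0 by (intro frac_le) auto
      then show ?thesis by simp
    qed
    finally have "(A / (A + a)) ^ 4 * \<delta>\<^sup>2 \<le> (1 - e / (2 * A)) * \<delta>\<^sup>2" by (intro mult_right_mono) auto
    then show ?thesis by (simp add: D_def algebra_simps)
  qed
  have nn': "0 \<le> e * \<gamma>\<^sup>2" "0 \<le> e * \<eta>\<^sup>2" using e0 by auto
  define E1 E2 ET where "E1 = e * \<gamma>\<^sup>2" and "E2 = e * \<eta>\<^sup>2" and "ET = e * T"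
  have "- (e * \<gamma>\<^sup>2) / 4 = - (E1 / 4)" by (simp add: E1_def)
  note 1 = 1[unfolded this]
  have "(A / (A + a)) ^ 4 * \<delta>\<^sup>2 + (a * (- x\<^sup>2 / 2) + a * (4 * a / A * (x * \<delta>))
      + a * (a\<^sup>2 / (4 * A) * (y\<^sup>2 + x\<^sup>2)) + a * (a / 2 * w\<^sup>2) + a * (a ^ 3 / (2 * A) * x\<^sup>2))
    \<le> \<delta>\<^sup>2 - e * \<gamma>\<^sup>2 / 8 - D / 8"
    using nn' 1 2 3 4 5 6 T e\<eta> D0
    unfolding E1_def[symmetric] E2_def[symmetric] ET_def[symmetric] by linarith
  then show ?thesis by (simp only: D_def distrib_left)
qed

text \<open>Spends the reserved eighths. The first term is the effect on the kernel integral of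
  replacing the old curve by the new one, the second the change of the prefactor e^2.\<close>

lemma corrector_error_budget:
  fixes A e \<gamma> \<delta> :: real
  assumes A: "1 \<le> A" and e: "e = mesh A" and nn: "0 \<le> \<gamma>" "0 \<le> \<delta>"
  defines "\<eta> \<equiv> e / A * \<delta>"
  shows "2 * e\<^sup>2 * (1220 * (3 * (\<gamma> + 4 * \<eta>) * (4 * e\<^sup>2 / A * (\<gamma> + 4 * \<eta>) + 4 * e / A * \<eta>)))
      + 2 * e ^ 3 / A * (1220 * (\<gamma> + 4 * \<eta>)\<^sup>2)
    \<le> e * \<gamma>\<^sup>2 / 8 + e / A * \<delta>\<^sup>2 / 8"
proof -
  have e0: "0 < e" and e2: "e\<^sup>2 \<le> A / 262144" and e3: "e ^ 3 = A / 134217728" and e1: "1 \<le> 512 * e"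
    using A mesh_pos[of A] mesh_square_le[of A] mesh_cube[of A] mesh_ge[of A] by (auto simp: e)
  have \<eta>0: "0 \<le> \<eta>" using A e0 nn by (simp add: \<eta>_def)
  define D T S where "D = e / A * \<delta>\<^sup>2" and "T = (\<gamma> + 4 * \<eta>)\<^sup>2" and "S = \<eta> * (\<gamma> + 4 * \<eta>)"
  have D0: "0 \<le> D" and T0: "0 \<le> T" and S0: "0 \<le> S"
    using A e0 nn \<eta>0 by (auto simp: D_def T_def S_def)
  have T: "e * T \<le> 2 * (e * \<gamma>\<^sup>2) + 32 * (e * \<eta>\<^sup>2)"
  proof -
    have "T \<le> 2 * \<gamma>\<^sup>2 + 32 * \<eta>\<^sup>2"
      using zero_le_power2[of "\<gamma> - 4 * \<eta>"] by (simp add: T_def power2_eq_square algebra_simps)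
    then have "e * T \<le> e * (2 * \<gamma>\<^sup>2 + 32 * \<eta>\<^sup>2)" using e0 by (intro mult_left_mono) auto
    then show ?thesis by (simp add: algebra_simps)
  qed
  \<comment> \<open>\<open>S\<close> has no factor e, so one is inserted through 1 \<le> 512 e. This
    is where the lower bound A \<ge> 1 enters through the mesh.\<close>
  have S: "S \<le> 256 * (e * \<gamma>\<^sup>2) + 2304 * (e * \<eta>\<^sup>2)"
  proof -
    have "S \<le> (512 * e) * S" using mult_right_mono[OF e1 S0] by simp
    also have "S \<le> \<gamma>\<^sup>2 / 2 + 9 / 2 * \<eta>\<^sup>2"
      using zero_le_power2[of "\<gamma> - \<eta>"] by (simp add: S_def power2_eq_square algebra_simps)
    then have "(512 * e) * S \<le> (512 * e) * (\<gamma>\<^sup>2 / 2 + 9 / 2 * \<eta>\<^sup>2)"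
      using e0 by (intro mult_left_mono) auto
    finally show ?thesis by (simp add: algebra_simps)
  qed
  have e\<eta>: "e * \<eta>\<^sup>2 \<le> D / 262144"
  proof -
    have "e * \<eta>\<^sup>2 = (e\<^sup>2 / A) * D" using A by (simp add: \<eta>_def D_def power2_eq_square)
    also have "\<dots> \<le> (1 / 262144) * D"
      using e2 A D0 by (intro mult_right_mono) (auto simp: field_simps)
    finally show ?thesis by simp
  qed
  have 1: "2 * e\<^sup>2 * (1220 * (3 * (\<gamma> + 4 * \<eta>) * (4 * e\<^sup>2 / A * (\<gamma> + 4 * \<eta>) + 4 * e / A * \<eta>)))
      = 29280 * ((e ^ 3 / A) * (e * T)) + 29280 * ((e ^ 3 / A) * S)"
    using A by (simp add: T_def S_def power2_eq_square power3_eq_cube field_simps)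
  have 2: "2 * e ^ 3 / A * (1220 * (\<gamma> + 4 * \<eta>)\<^sup>2) = 2440 * ((e\<^sup>2 / A) * (e * T))"
    by (simp add: T_def power2_eq_square power3_eq_cube)
  have 3: "(e\<^sup>2 / A) * (e * T) \<le> (1 / 262144) * (e * T)"
    using e2 A T0 e0 by (intro mult_right_mono) (auto simp: field_simps)
  have 4: "e ^ 3 / A = 1 / 134217728" using A by (simp add: e3)
  have nn': "0 \<le> e * \<gamma>\<^sup>2" "0 \<le> e * \<eta>\<^sup>2" using e0 by auto
  define E1 E2 ET R where "E1 = e * \<gamma>\<^sup>2" and "E2 = e * \<eta>\<^sup>2" and "ET = e * T"
    and "R = e\<^sup>2 / A * ET"
  have "29280 * ((1 / 134217728) * (e * T)) + 29280 * ((1 / 134217728) * S) + 2440 * ((e\<^sup>2 / A) * (e * T))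
      \<le> e * \<gamma>\<^sup>2 / 8 + D / 8"
    using nn' 3 T S e\<eta> D0
    unfolding E1_def[symmetric] E2_def[symmetric] ET_def[symmetric] R_def[symmetric] by linarith
  then show ?thesis unfolding 1 2 4 by (simp add: D_def)
qed

section \<open>The corrected potential\<close>

lemma renewal_kernel_weighted:
  fixes \<psi> :: "real \<Rightarrow> real"
  assumes [measurable]: "\<psi> \<in> borel_measurable borel"
    and bound: "\<And>r. 0 \<le> r \<Longrightarrow> \<bar>\<psi> r\<bar> \<le> K * (1 + r)\<^sup>2"
  shows "integrable lborel (\<lambda>r. renewal_kernel r * \<psi> r)"
    and "\<bar>\<integral>r. renewal_kernel r * \<psi> r \<partial>lborel\<bar> \<le> 1220 * K"
proof -
  have K: "0 \<le> K" using bound[of 0] by simp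
  have le: "\<bar>renewal_kernel r * \<psi> r\<bar> \<le> K * (\<bar>renewal_kernel r\<bar> * (1 + r)\<^sup>2)" for r
  proof (cases "0 \<le> r")
    case True
    then have "\<bar>renewal_kernel r\<bar> * \<bar>\<psi> r\<bar> \<le> \<bar>renewal_kernel r\<bar> * (K * (1 + r)\<^sup>2)"
      by (intro mult_left_mono bound) auto
    then show ?thesis by (simp add: abs_mult mult_ac)
  qed (simp add: renewal_kernel_neg)
  have intK: "integrable lborel (\<lambda>r. K * (\<bar>renewal_kernel r\<bar> * (1 + r)\<^sup>2))"
    using renewal_kernel_moment(1) by simp
  show int: "integrable lborel (\<lambda>r. renewal_kernel r * \<psi> r)"
  proof (rule Bochner_Integration.integrable_bound[OF intK])
    show "AE r in lborel. norm (renewal_kernel r * \<psi> r) \<le> norm (K * (\<bar>renewal_kernel r\<bar> * (1 + r)\<^sup>2))"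
      using le K by (intro AE_I2) simp
  qed simp
  have "\<bar>\<integral>r. renewal_kernel r * \<psi> r \<partial>lborel\<bar> \<le> (\<integral>r. \<bar>renewal_kernel r * \<psi> r\<bar> \<partial>lborel)"
    by (rule integral_abs_bound)
  also have "\<dots> \<le> (\<integral>r. K * (\<bar>renewal_kernel r\<bar> * (1 + r)\<^sup>2) \<partial>lborel)"
    using int intK le by (intro integral_mono integrable_abs) auto
  also have "\<dots> = K * (\<integral>r. \<bar>renewal_kernel r\<bar> * (1 + r)\<^sup>2 \<partial>lborel)" by simp
  also have "\<dots> \<le> K * 1220" using renewal_kernel_moment(2) K by (intro mult_left_mono)
  finally show "\<bar>\<integral>r. renewal_kernel r * \<psi> r \<partial>lborel\<bar> \<le> 1220 * K" by simp
qed

context unit_smooth_convex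
begin

lemma continuous_gradient: "continuous_on S g"
proof -
  have "1-lipschitz_on S g"
    using lipschitz by (intro lipschitz_onI) (auto simp: dist_norm)
  then show ?thesis by (rule lipschitz_on_continuous_on)
qed

lemma continuous_value: "continuous_on S f"
  using has_derivative by (meson continuous_at_imp_continuous_on has_derivative_continuous)

lemma measurable_gradient [measurable]: "g \<in> borel_measurable borel"
  by (rule borel_measurable_continuous_onI[OF continuous_gradient])

lemma measurable_value [measurable]: "f \<in> borel_measurable borel"
  by (rule borel_measurable_continuous_onI[OF continuous_value])

definition query :: "real \<Rightarrow> 'a \<Rightarrow> 'a \<Rightarrow> real \<Rightarrow> real \<Rightarrow> 'a" where
  "query A z d v u = decay_path A (mesh A) z d (v * u)"

definition next_z :: "real \<Rightarrow> 'a \<Rightarrow> 'a \<Rightarrow> real \<Rightarrow> real \<Rightarrow> 'a" where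
  "next_z A z d v u = z - (mesh A * v / 2) *\<^sub>R g (query A z d v u)"

text \<open>Solves for the d that keeps the position continuous at the query time: with B the end of
  the cell, the new curve \<open>z' - (B / \<tau>)^2 d'\<close> passes through the query point at
  \<tau> = s although z has jumped.\<close>

definition next_d :: "real \<Rightarrow> 'a \<Rightarrow> 'a \<Rightarrow> real \<Rightarrow> real \<Rightarrow> 'a" where
  "next_d A z d v u = (A / (A + mesh A * v))\<^sup>2 *\<^sub>R d
     - (((A + mesh A * (v * u)) / (A + mesh A * v))\<^sup>2 * (mesh A * v / 2)) *\<^sub>R g (query A z d v u)"

definition gradient_energy :: "real \<Rightarrow> 'a \<Rightarrow> 'a \<Rightarrow> real \<Rightarrow> real" where
  "gradient_energy A z d t = (norm (g (decay_path A (mesh A) z d t)))\<^sup>2"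

definition corrector :: "real \<Rightarrow> 'a \<Rightarrow> 'a \<Rightarrow> real" where
  "corrector A z d = (mesh A)\<^sup>2 * (\<integral>r. renewal_kernel r * gradient_energy A z d r \<partial>lborel)"

definition potential :: "real \<Rightarrow> 'a \<Rightarrow> 'a \<Rightarrow> real" where
  "potential A z d = lyapunov A z d + corrector A z d"

lemma gradient_energy_measurable [measurable]: "gradient_energy A z d \<in> borel_measurable borel"
  unfolding gradient_energy_def decay_path_def by measurable

lemma gradient_on_path:
  fixes z d :: 'a
  assumes A: "1 \<le> A" and t: "0 \<le> t"
  defines "P \<equiv> decay_path A (mesh A) z d" and "\<eta> \<equiv> mesh A / A * norm d"
  shows "norm (g (P t)) \<le> norm (g (z - d)) + 2 * t * \<eta>"
    and "norm (g (z - d)) \<le> norm (g (P t)) + 2 * t * \<eta>"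
    and "0 \<le> t' \<Longrightarrow> norm (g (P t') - g (P t)) \<le> 2 * \<bar>t' - t\<bar> * \<eta>"
proof -
  have *: "norm (g (P t') - g (P t)) \<le> 2 * \<bar>t' - t\<bar> * \<eta>" if "0 \<le> t'" for t'
    using order_trans[OF lipschitz decay_path_lipschitz] A t that mesh_pos[of A]
    unfolding P_def \<eta>_def by simp
  show "0 \<le> t' \<Longrightarrow> norm (g (P t') - g (P t)) \<le> 2 * \<bar>t' - t\<bar> * \<eta>" by (rule *)
  have P0: "P 0 = z - d" using A by (simp add: P_def)
  have "norm (g (z - d) - g (P t)) \<le> 2 * t * \<eta>" using *[of 0] t P0 by simp
  then show "norm (g (P t)) \<le> norm (g (z - d)) + 2 * t * \<eta>"
    "norm (g (z - d)) \<le> norm (g (P t)) + 2 * t * \<eta>"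
    using norm_triangle_ineq3[of "g (z - d)" "g (P t)"] by linarith+
qed

text \<open>The one-step inequality in mesh units with its errors absorbed. What remains either
  averages exactly over \<open>u\<close> or is of order e^2 and goes to the kernel.\<close>

lemma lyapunov_cell:
  fixes z d :: 'a
  assumes A: "1 \<le> A" and v: "1 \<le> v" "v \<le> 2" and u: "0 \<le> u" "u \<le> 1"
  defines "e \<equiv> mesh A" and "P \<equiv> decay_path A (mesh A) z d" and "\<phi> \<equiv> gradient_energy A z d"
  shows "lyapunov (A + e * v) (next_z A z d v u) (next_d A z d v u)
    \<le> (A + e * v) * f (P v) + (norm (z - xs))\<^sup>2 + (norm d)\<^sup>2
      - e * v * (f (P (v * u)) + 2 * (A / (A + e * (v * u)))\<^sup>2 * (g (P (v * u)) \<bullet> d))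
      + e\<^sup>2 * (v * (v * u / 2 * \<phi> (v * u)) - v\<^sup>2 * (1 - u) / 2 * \<phi> v)
      - e * (norm (g (z - d)))\<^sup>2 / 8 - e / A * (norm d)\<^sup>2 / 8"
proof -
  define \<gamma> \<delta> \<eta> where "\<gamma> = norm (g (z - d))" and "\<delta> = norm d" and "\<eta> = e / A * \<delta>"
  have e: "0 < e" using A mesh_pos by (simp add: e_def)
  define a where "a = e * v"
  have a: "0 < a" using e v by (simp add: a_def)
  have vu: "0 \<le> v * u" "v * u \<le> 2" "\<bar>v - v * u\<bar> \<le> 2"
  proof -
    show "0 \<le> v * u" using u v by simp
    have "v * u \<le> v * 1" using u v by (intro mult_left_mono) auto
    then show "v * u \<le> 2" "\<bar>v - v * u\<bar> \<le> 2" using v \<open>0 \<le> v * u\<close> by linarith+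
  qed
  have \<eta>0: "0 \<le> \<eta>" using e A by (simp add: \<eta>_def \<delta>_def)
  define x y w where "x = norm (g (P (v * u)))" and "y = norm (g (P v))"
    and "w = norm (g (P v) - g (P (v * u)))"
  have scale: "2 * t * \<eta> \<le> 4 * \<eta>" if "t \<le> 2" for t
    using mult_right_mono[OF that, of "2 * \<eta>"] \<eta>0 by simp
  have x: "x \<le> \<gamma> + 4 * \<eta>" "\<gamma> \<le> x + 4 * \<eta>"
    using gradient_on_path(1,2)[OF A vu(1), of z d] scale[OF vu(2)]
    unfolding x_def P_def \<gamma>_def \<eta>_def \<delta>_def e_def by linarith+
  have y: "y \<le> \<gamma> + 4 * \<eta>"
    using gradient_on_path(1)[OF A, of v z d] scale[OF v(2)] v
    unfolding y_def P_def \<gamma>_def \<eta>_def \<delta>_def e_def by linarith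
  have w: "w \<le> 4 * \<eta>"
    using gradient_on_path(3)[OF A vu(1), of v z d] scale[OF vu(3)] v
    unfolding w_def P_def \<gamma>_def \<eta>_def \<delta>_def e_def by linarith
  have budget: "(A / (A + a)) ^ 4 * \<delta>\<^sup>2 + a * (- x\<^sup>2 / 2 + 4 * a / A * (x * \<delta>)
      + a\<^sup>2 / (4 * A) * (y\<^sup>2 + x\<^sup>2) + a / 2 * w\<^sup>2 + a ^ 3 / (2 * A) * x\<^sup>2)
    \<le> \<delta>\<^sup>2 - e * \<gamma>\<^sup>2 / 8 - e / A * \<delta>\<^sup>2 / 8"
    unfolding a_def
    by (rule cell_error_budget)
       (use A v x y w in \<open>auto simp: e_def \<gamma>_def \<delta>_def x_def y_def w_def \<eta>_def\<close>)
  have s: "A + a * u = A + e * (v * u)" by (simp add: a_def)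
  have P: "z - (A / (A + a * u))\<^sup>2 *\<^sub>R d = P (v * u)" "z - (A / (A + a))\<^sup>2 *\<^sub>R d = P v"
    unfolding s by (simp_all add: P_def decay_path_def a_def e_def)
  have nz: "next_z A z d v u = z - (a / 2) *\<^sub>R g (P (v * u))"
    by (simp add: next_z_def query_def a_def e_def P_def)
  have nd: "next_d A z d v u = (A / (A + a))\<^sup>2 *\<^sub>R d
      - (((A + a * u) / (A + a))\<^sup>2 * (a / 2)) *\<^sub>R g (P (v * u))"
    by (simp only: next_d_def query_def s) (simp add: a_def e_def P_def)
  have main: "a * ((A + a * u - A) / 2 * x\<^sup>2 - (A + a - (A + a * u)) / 2 * y\<^sup>2)
      = e\<^sup>2 * (v * (v * u / 2 * \<phi> (v * u)) - v\<^sup>2 * (1 - u) / 2 * \<phi> v)"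
    by (simp add: x_def y_def \<phi>_def gradient_energy_def P_def a_def power2_eq_square
        algebra_simps diff_divide_distrib)
  show ?thesis
    using lyapunov_step[of A a u z d] A a u budget
    unfolding P nz[symmetric] nd[symmetric] x_def[symmetric] y_def[symmetric] w_def[symmetric]
      \<delta>_def[symmetric] \<gamma>_def[symmetric] main
    unfolding s unfolding a_def by simp
qed

text \<open>The corrector of the next state is compared with the old curve continued past
  \<open>v\<close>. The two curves drift apart at most linearly in \<open>r\<close>, so their
  squared gradients differ by O((1 + r)^2), which the kernel integrates.\<close>

lemma corrector_cell:
  fixes z d :: 'a
  assumes A: "1 \<le> A" and v: "1 \<le> v" "v \<le> 2" and u: "0 \<le> u" "u \<le> 1"
  defines "e \<equiv> mesh A" and "\<phi> \<equiv> gradient_energy A z d"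
  shows "corrector (A + e * v) (next_z A z d v u) (next_d A z d v u)
    \<le> e\<^sup>2 * (\<integral>r. renewal_kernel r * \<phi> (v + r) \<partial>lborel)
      + e * (norm (g (z - d)))\<^sup>2 / 8 + e / A * (norm d)\<^sup>2 / 8"
proof -
  define \<gamma> \<delta> \<eta> where "\<gamma> = norm (g (z - d))" and "\<delta> = norm d" and "\<eta> = e / A * \<delta>"
  define P where "P = decay_path A e z d"
  have e: "0 < e" and e2: "e\<^sup>2 \<le> A / 2 ^ 18" and eA: "e \<le> A / 512"
    using A mesh_pos mesh_square_le mesh_le by (auto simp: e_def)
  define a B e' s where "a = e * v" and "B = A + a" and "e' = mesh B" and "s = A + e * (v * u)"
  have a: "e \<le> a" "a \<le> 2 * e" "0 < a" using e v by (auto simp: a_def)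
  have vu: "0 \<le> v * u" "v * u \<le> v" using u v by (auto intro: mult_left_le)
  have B: "A \<le> B" "1 \<le> B" using A a by (auto simp: B_def)
  have s: "A \<le> s" "s \<le> B" using vu e by (auto simp: s_def B_def a_def)
  have BA: "B / A = 1 + a / A" "a / A \<le> 2 * e / A" using A a by (auto simp: B_def field_simps)
  have eA1: "2 * e / A \<le> 1" "4 * e / A \<le> 1" using eA A by (simp_all add: field_simps)
  have e': "e \<le> e'" "e' - e \<le> 2 * e\<^sup>2 / A" "e'\<^sup>2 - e\<^sup>2 \<le> 2 * e ^ 3 / A" "e' \<le> 2 * e" "e'\<^sup>2 \<le> 2 * e\<^sup>2"
  proof -
    show "e \<le> e'" using mesh_growth(1)[OF A B(1)] by (simp add: e_def e'_def)
    have "e' \<le> e * (1 + 2 * e / A)"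
    proof -
      have "e * (B / A) \<le> e * (1 + 2 * e / A)" using BA e by (intro mult_left_mono) auto
      then show ?thesis using mesh_growth(2)[OF A B(1)] unfolding e_def e'_def by linarith
    qed
    then show "e' - e \<le> 2 * e\<^sup>2 / A" by (simp add: algebra_simps power2_eq_square)
    have "e * (1 + 2 * e / A) \<le> e * 2" using eA1 e by (intro mult_left_mono) auto
    then show "e' \<le> 2 * e" using \<open>e' \<le> e * (1 + 2 * e / A)\<close> by simp
    have "e'\<^sup>2 \<le> e\<^sup>2 * (1 + 2 * e / A)"
    proof -
      have "e\<^sup>2 * (B / A) \<le> e\<^sup>2 * (1 + 2 * e / A)" using BA e by (intro mult_left_mono) auto
      then show ?thesis using mesh_growth(3)[OF A B(1)] unfolding e_def e'_def by linarith
    qed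
    then show "e'\<^sup>2 - e\<^sup>2 \<le> 2 * e ^ 3 / A" by (simp add: algebra_simps power2_eq_square power3_eq_cube)
    have "e\<^sup>2 * (1 + 2 * e / A) \<le> e\<^sup>2 * 2" using eA1 by (intro mult_left_mono) auto
    then show "e'\<^sup>2 \<le> 2 * e\<^sup>2" using \<open>e'\<^sup>2 \<le> e\<^sup>2 * (1 + 2 * e / A)\<close> by simp
  qed
  define gs where "gs = g (query A z d v u)"
  define X where "X = (\<lambda>r. P (v + r))"
  define X' where "X' = decay_path B e' (next_z A z d v u) (next_d A z d v u)"
  define c T where "c = 4 * e\<^sup>2 / A * (\<gamma> + 4 * \<eta>) + 4 * e / A * \<eta>" and "T = (\<gamma> + 4 * \<eta>)\<^sup>2"
  have nn: "0 \<le> \<gamma>" "0 \<le> \<delta>" "0 \<le> \<eta>" using e A by (auto simp: \<gamma>_def \<delta>_def \<eta>_def)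
  have c0: "0 \<le> c" using nn e A by (simp add: c_def)
  have gs: "norm gs \<le> \<gamma> + 4 * \<eta>"
  proof -
    have "norm gs \<le> \<gamma> + 2 * (v * u) * \<eta>"
      using gradient_on_path(1)[OF A vu(1), of z d]
      by (simp add: gs_def query_def \<gamma>_def \<eta>_def \<delta>_def e_def)
    moreover have "2 * (v * u) \<le> 2 * 2" using vu v by linarith
    then have "2 * (v * u) * \<eta> \<le> 2 * 2 * \<eta>" using nn by (intro mult_right_mono)
    ultimately show ?thesis by linarith
  qed
  have gX: "norm (g (X r)) \<le> (1 + r) * (\<gamma> + 4 * \<eta>)" if r: "0 \<le> r" for r
  proof -
    have "norm (g (X r)) \<le> \<gamma> + 2 * (v + r) * \<eta>"
      using gradient_on_path(1)[OF A, of "v + r" z d] v r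
      by (simp add: X_def P_def \<gamma>_def \<eta>_def \<delta>_def e_def)
    also have "\<dots> \<le> \<gamma> + 4 * (1 + r) * \<eta>" using v r nn by (intro add_left_mono mult_right_mono) auto
    also have "\<dots> \<le> (1 + r) * (\<gamma> + 4 * \<eta>)" using r nn by (simp add: algebra_simps)
    finally show ?thesis .
  qed
  have XX: "norm (X' r - X r) \<le> (1 + r) * c" if r: "0 \<le> r" for r
  proof -
    define \<tau> \<tau>' where "\<tau> = A + e * (v + r)" and "\<tau>' = B + e' * r"
    have \<tau>: "A \<le> \<tau>" using e v r A by (simp add: \<tau>_def)
    have \<tau>': "B \<le> \<tau>'" using e e' r by (simp add: \<tau>'_def)
    \<comment> \<open>The decay factors compose: without the jump, restarting the curve at
      \<open>B\<close> would change only its clock.\<close>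
    have q: "(B / \<tau>') * (A / B) = A / \<tau>'" "(B / \<tau>') * (s / B) = s / \<tau>'" using B by auto
    have "X' r - X r = ((A / \<tau>)\<^sup>2 - (A / \<tau>')\<^sup>2) *\<^sub>R d - (a / 2 * (1 - (s / \<tau>')\<^sup>2)) *\<^sub>R gs"
    proof -
      have "X' r = z - (a / 2) *\<^sub>R gs
          - (B / \<tau>')\<^sup>2 *\<^sub>R ((A / B)\<^sup>2 *\<^sub>R d - ((s / B)\<^sup>2 * (a / 2)) *\<^sub>R gs)"
        by (simp add: X'_def decay_path_def next_z_def next_d_def gs_def \<tau>'_def s_def B_def a_def e_def)
      also have "\<dots> = z - (a / 2) *\<^sub>R gs - ((B / \<tau>') * (A / B))\<^sup>2 *\<^sub>R d
          + (((B / \<tau>') * (s / B))\<^sup>2 * (a / 2)) *\<^sub>R gs"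
        by (simp only: scaleR_diff_right scaleR_scaleR power_mult_distrib mult.assoc) simp
      finally have "X' r = z - (a / 2) *\<^sub>R gs - (A / \<tau>')\<^sup>2 *\<^sub>R d + ((s / \<tau>')\<^sup>2 * (a / 2)) *\<^sub>R gs"
        unfolding q .
      moreover have "X r = z - (A / \<tau>)\<^sup>2 *\<^sub>R d"
        by (simp add: X_def P_def decay_path_def \<tau>_def)
      ultimately show ?thesis by (simp add: algebra_simps scaleR_diff_left)
    qed
    \<comment> \<open>Two sources of drift. The clocks disagree by (e' - e) r, since the next mesh
      is larger. The jump leaves the position at time s fixed and has moved it at \<tau>' by the
      fraction 1 - (s / \<tau>')^2 of its full size.\<close>
    then have "norm (X' r - X r) \<le> \<bar>(A / \<tau>)\<^sup>2 - (A / \<tau>')\<^sup>2\<bar> * \<delta> + \<bar>a / 2 * (1 - (s / \<tau>')\<^sup>2)\<bar> * norm gs"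
      by (metis \<delta>_def norm_scaleR norm_triangle_ineq4)
    also have "\<dots> \<le> (4 * e\<^sup>2 / A\<^sup>2 * r) * \<delta> + (4 * e\<^sup>2 / A * (1 + r)) * (\<gamma> + 4 * \<eta>)"
    proof (intro add_mono mult_mono)
      have "\<bar>(A / \<tau>)\<^sup>2 - (A / \<tau>')\<^sup>2\<bar> \<le> 2 * \<bar>\<tau> - \<tau>'\<bar> / A"
        using A B \<tau> \<tau>' by (intro square_ratio_lipschitz) auto
      also have "\<tau> - \<tau>' = - ((e' - e) * r)" by (simp add: \<tau>_def \<tau>'_def B_def a_def algebra_simps)
      also have "2 * \<bar>- ((e' - e) * r)\<bar> / A = 2 * ((e' - e) * r) / A" using e' r by simp
      also have "\<dots> \<le> 2 * ((2 * e\<^sup>2 / A) * r) / A"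
        using e' r A by (intro divide_right_mono mult_left_mono mult_right_mono) auto
      finally show "\<bar>(A / \<tau>)\<^sup>2 - (A / \<tau>')\<^sup>2\<bar> \<le> 4 * e\<^sup>2 / A\<^sup>2 * r" by (simp add: power2_eq_square)
      have s\<tau>: "0 \<le> s / \<tau>'" "s / \<tau>' \<le> 1" using A s \<tau>' B by auto
      have "1 - (s / \<tau>')\<^sup>2 = (1 + s / \<tau>') * ((\<tau>' - s) / \<tau>')"
        using A \<tau>' B by (simp add: field_simps power2_eq_square)
      also have "\<dots> \<le> 2 * ((2 * e * (1 + r)) / A)"
      proof (intro mult_mono frac_le)
        have "\<tau>' - s \<le> a + e' * r" using s by (simp add: \<tau>'_def B_def)
        also have "\<dots> \<le> 2 * e + 2 * e * r" using a e' r by (intro add_mono mult_right_mono) auto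
        finally show "\<tau>' - s \<le> 2 * e * (1 + r)" by (simp add: algebra_simps)
      qed (use s\<tau> A B s \<tau>' e r in auto)
      finally have le: "1 - (s / \<tau>')\<^sup>2 \<le> 4 * e * (1 + r) / A" by simp
      have "0 \<le> 1 - (s / \<tau>')\<^sup>2" using s\<tau> by (simp add: power_le_one)
      then have "\<bar>a / 2 * (1 - (s / \<tau>')\<^sup>2)\<bar> = a / 2 * (1 - (s / \<tau>')\<^sup>2)"
        using a by simp
      also have "\<dots> \<le> e * (4 * e * (1 + r) / A)"
        using le a e \<open>0 \<le> 1 - _\<close> by (intro mult_mono) auto
      finally show "\<bar>a / 2 * (1 - (s / \<tau>')\<^sup>2)\<bar> \<le> 4 * e\<^sup>2 / A * (1 + r)"
        by (simp add: power2_eq_square)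
    qed (use gs nn e r A in auto)
    also have "(4 * e\<^sup>2 / A\<^sup>2 * r) * \<delta> = r * (4 * e / A * \<eta>)"
      by (simp add: \<eta>_def power2_eq_square)
    also have "\<dots> \<le> (1 + r) * (4 * e / A * \<eta>)" using nn e A by (intro mult_right_mono) auto
    finally show ?thesis by (simp add: c_def algebra_simps)
  qed
  \<comment> \<open>So the new gradient is at most twice the bound for the old one, and the sum of
    the two at most three times: the origin of the factor 3.\<close>
  have cle: "c \<le> \<gamma> + 4 * \<eta>"
  proof -
    have "4 * e\<^sup>2 / A \<le> 1 / 2" using e2 A by (simp add: field_simps)
    then have "4 * e\<^sup>2 / A * (\<gamma> + 4 * \<eta>) \<le> 1 / 2 * (\<gamma> + 4 * \<eta>)" using nn by (intro mult_right_mono) auto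
    moreover have "4 * e / A * \<eta> \<le> 1 * \<eta>" using eA1 nn by (intro mult_right_mono) auto
    ultimately show ?thesis unfolding c_def using nn by simp
  qed
  have dG: "\<bar>(norm (g (X' r)))\<^sup>2 - (norm (g (X r)))\<^sup>2\<bar> \<le> (3 * (\<gamma> + 4 * \<eta>) * c) * (1 + r)\<^sup>2"
    if r: "0 \<le> r" for r
  proof -
    have "\<bar>norm (g (X' r)) - norm (g (X r))\<bar> \<le> norm (X' r - X r)"
      using norm_triangle_ineq3 lipschitz order_trans by blast
    then have d1: "\<bar>norm (g (X' r)) - norm (g (X r))\<bar> \<le> (1 + r) * c" using XX[OF r] by simp
    have "(1 + r) * c \<le> (1 + r) * (\<gamma> + 4 * \<eta>)" using cle r by (intro mult_left_mono) auto
    then have d2: "\<bar>norm (g (X' r)) + norm (g (X r))\<bar> \<le> (1 + r) * (3 * (\<gamma> + 4 * \<eta>))"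
      using d1 gX[OF r] by (simp add: algebra_simps)
    have "\<bar>(norm (g (X' r)))\<^sup>2 - (norm (g (X r)))\<^sup>2\<bar>
        = \<bar>norm (g (X' r)) - norm (g (X r))\<bar> * \<bar>norm (g (X' r)) + norm (g (X r))\<bar>"
      unfolding abs_mult[symmetric] by (rule arg_cong[where f = abs]) (simp add: power2_eq_square algebra_simps)
    also have "\<dots> \<le> ((1 + r) * c) * ((1 + r) * (3 * (\<gamma> + 4 * \<eta>)))"
      using d1 d2 c0 r by (intro mult_mono) auto
    finally show ?thesis by (simp add: power2_eq_square mult_ac)
  qed
  have GX: "\<bar>(norm (g (X r)))\<^sup>2\<bar> \<le> T * (1 + r)\<^sup>2" if r: "0 \<le> r" for r
    using power_mono[OF gX[OF r], of 2] by (simp add: T_def power_mult_distrib mult.commute)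
  have [measurable]: "X \<in> borel_measurable borel" "X' \<in> borel_measurable borel"
    unfolding X_def X'_def P_def decay_path_def by measurable
  note intX = renewal_kernel_weighted[of "\<lambda>r. (norm (g (X r)))\<^sup>2" T, OF _ GX]
  note intD = renewal_kernel_weighted[of "\<lambda>r. (norm (g (X' r)))\<^sup>2 - (norm (g (X r)))\<^sup>2", OF _ dG]
  define I J where "I = (\<integral>r. renewal_kernel r * (norm (g (X r)))\<^sup>2 \<partial>lborel)"
    and "J = (\<integral>r. renewal_kernel r * ((norm (g (X' r)))\<^sup>2 - (norm (g (X r)))\<^sup>2) \<partial>lborel)"
  have "corrector B (next_z A z d v u) (next_d A z d v u)
      = e'\<^sup>2 * (\<integral>r. renewal_kernel r * (norm (g (X' r)))\<^sup>2 \<partial>lborel)"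
    by (simp add: corrector_def gradient_energy_def X'_def e'_def)
  also have "(\<integral>r. renewal_kernel r * (norm (g (X' r)))\<^sup>2 \<partial>lborel)
      = (\<integral>r. renewal_kernel r * (norm (g (X r)))\<^sup>2
           + renewal_kernel r * ((norm (g (X' r)))\<^sup>2 - (norm (g (X r)))\<^sup>2) \<partial>lborel)"
    by (simp add: algebra_simps)
  also have "\<dots> = I + J"
    unfolding I_def J_def by (rule Bochner_Integration.integral_add) (use intX(1) intD(1) in auto)
  also have "e'\<^sup>2 * (I + J) = e\<^sup>2 * I + ((e'\<^sup>2 - e\<^sup>2) * I + e'\<^sup>2 * J)" by (simp add: algebra_simps)
  also have "(e'\<^sup>2 - e\<^sup>2) * I \<le> (2 * e ^ 3 / A) * (1220 * T)"
  proof -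
    have I: "I \<le> 1220 * T" using intX(2) by (simp add: I_def)
    have "0 \<le> e'\<^sup>2 - e\<^sup>2" using e' e by (simp add: power_mono)
    then have "(e'\<^sup>2 - e\<^sup>2) * I \<le> (e'\<^sup>2 - e\<^sup>2) * (1220 * T)" by (intro mult_left_mono I)
    also have "\<dots> \<le> (2 * e ^ 3 / A) * (1220 * T)"
      using e' by (intro mult_right_mono) (auto simp: T_def)
    finally show ?thesis .
  qed
  also have "e'\<^sup>2 * J \<le> (2 * e\<^sup>2) * (1220 * (3 * (\<gamma> + 4 * \<eta>) * c))"
  proof -
    have J: "J \<le> 1220 * (3 * (\<gamma> + 4 * \<eta>) * c)" using intD(2) by (simp add: J_def)
    have "e'\<^sup>2 * J \<le> e'\<^sup>2 * (1220 * (3 * (\<gamma> + 4 * \<eta>) * c))"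
      using J by (intro mult_left_mono) auto
    also have "\<dots> \<le> (2 * e\<^sup>2) * (1220 * (3 * (\<gamma> + 4 * \<eta>) * c))"
      using e' nn c0 by (intro mult_right_mono) auto
    finally show ?thesis .
  qed
  also have "2 * e ^ 3 / A * (1220 * T) + 2 * e\<^sup>2 * (1220 * (3 * (\<gamma> + 4 * \<eta>) * c))
      \<le> e * \<gamma>\<^sup>2 / 8 + e / A * \<delta>\<^sup>2 / 8"
    using corrector_error_budget[OF A refl nn(1,2)]
    unfolding c_def T_def \<eta>_def e_def by linarith
  finally have "corrector B (next_z A z d v u) (next_d A z d v u)
      \<le> e\<^sup>2 * I + (e * \<gamma>\<^sup>2 / 8 + e / A * \<delta>\<^sup>2 / 8)" by simp
  moreover have "I = (\<integral>r. renewal_kernel r * \<phi> (v + r) \<partial>lborel)"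
    by (simp add: I_def \<phi>_def gradient_energy_def X_def P_def e_def)
  ultimately show ?thesis by (simp add: B_def a_def \<gamma>_def \<delta>_def)
qed

end

section \<open>The averaged decrease\<close>

context unit_smooth_convex
begin

text \<open>The kernel takes both signs, so positivity of the potential rests on this smallness. The
  leading constant is 4 * 1220 / 2^18, just below 1/50.\<close>

lemma abs_corrector_le:
  assumes A: "1 \<le> A"
  shows "\<bar>corrector A z d\<bar> \<le> (A * f (z - d) + (norm d)\<^sup>2) / 50"
proof -
  define e \<gamma> \<delta> \<eta> where "e = mesh A" and "\<gamma> = norm (g (z - d))" and "\<delta> = norm d" and "\<eta> = e / A * \<delta>"
  have e: "0 < e" "e\<^sup>2 \<le> A / 262144" "e ^ 3 = A / 134217728" "e \<le> A / 512"
    using A mesh_pos mesh_square_le mesh_cube mesh_le by (auto simp: e_def)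
  have nn: "0 \<le> \<gamma>" "0 \<le> \<eta>" using e A by (auto simp: \<gamma>_def \<eta>_def \<delta>_def)
  have "\<bar>gradient_energy A z d r\<bar> \<le> (\<gamma> + 2 * \<eta>)\<^sup>2 * (1 + r)\<^sup>2" if r: "0 \<le> r" for r
  proof -
    have "norm (g (decay_path A (mesh A) z d r)) \<le> \<gamma> + 2 * r * \<eta>"
      using gradient_on_path(1)[OF A r, of z d] by (simp add: \<gamma>_def \<eta>_def \<delta>_def e_def)
    also have "\<dots> \<le> (\<gamma> + 2 * \<eta>) * (1 + r)" using r nn by (simp add: algebra_simps)
    finally have "(norm (g (decay_path A (mesh A) z d r)))\<^sup>2 \<le> ((\<gamma> + 2 * \<eta>) * (1 + r))\<^sup>2"
      by (intro power_mono) auto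
    then show ?thesis by (simp add: gradient_energy_def power_mult_distrib)
  qed
  then have I: "\<bar>\<integral>r. renewal_kernel r * gradient_energy A z d r \<partial>lborel\<bar> \<le> 1220 * (\<gamma> + 2 * \<eta>)\<^sup>2"
    by (intro renewal_kernel_weighted) auto
  have "\<bar>corrector A z d\<bar> = e\<^sup>2 * \<bar>\<integral>r. renewal_kernel r * gradient_energy A z d r \<partial>lborel\<bar>"
    by (simp add: corrector_def abs_mult e_def)
  also have "\<dots> \<le> e\<^sup>2 * (1220 * (\<gamma> + 2 * \<eta>)\<^sup>2)" using I by (intro mult_left_mono) auto
  also have "\<dots> \<le> e\<^sup>2 * (1220 * (4 * f (z - d) + 8 * \<eta>\<^sup>2))"
  proof -
    have "(\<gamma> + 2 * \<eta>)\<^sup>2 \<le> 2 * \<gamma>\<^sup>2 + 8 * \<eta>\<^sup>2"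
      using zero_le_power2[of "\<gamma> - 2 * \<eta>"] by (simp add: power2_eq_square algebra_simps)
    also have "\<gamma>\<^sup>2 \<le> 2 * f (z - d)" unfolding \<gamma>_def by (rule gradient_square_le)
    finally show ?thesis by (intro mult_left_mono) auto
  qed
  also have "\<dots> = 4880 * (e\<^sup>2 * f (z - d)) + 9760 * (e\<^sup>2 * \<eta>\<^sup>2)" by (simp add: algebra_simps)
  also have "e\<^sup>2 * f (z - d) \<le> A / 262144 * f (z - d)" using e nonneg by (intro mult_right_mono)
  also have "e\<^sup>2 * \<eta>\<^sup>2 \<le> \<delta>\<^sup>2 / 134217728"
  proof -
    have "e\<^sup>2 * \<eta>\<^sup>2 = (e ^ 3 / A) * (e / A) * \<delta>\<^sup>2"
      by (simp add: \<eta>_def power2_eq_square power3_eq_cube)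
    also have "\<dots> = 1 / 134217728 * (e / A) * \<delta>\<^sup>2" using A by (simp add: e(3))
    also have "\<dots> \<le> 1 / 134217728 * 1 * \<delta>\<^sup>2"
      using e A by (intro mult_right_mono mult_left_mono) (auto simp: field_simps)
    finally show ?thesis by simp
  qed
  finally have *: "\<bar>corrector A z d\<bar> \<le> 4880 * (A / 262144 * f (z - d)) + 9760 * (\<delta>\<^sup>2 / 134217728)" by simp
  define X where "X = A * f (z - d)"
  have "0 \<le> X" "0 \<le> \<delta>\<^sup>2" using A nonneg by (auto simp: X_def)
  moreover have "A / 262144 * f (z - d) = X / 262144" by (simp add: X_def)
  ultimately show ?thesis
    using * unfolding \<delta>_def[symmetric] X_def[symmetric] add_divide_distrib by linarith
qed

lemma lyapunov_nonneg: "1 \<le> A \<Longrightarrow> 0 \<le> lyapunov A z d"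
  using nonneg[of "z - d"] by (simp add: lyapunov_def)

lemma potential_bounds:
  assumes A: "1 \<le> A"
  shows "49 / 50 * lyapunov A z d \<le> potential A z d" "potential A z d \<le> 51 / 50 * lyapunov A z d"
proof -
  have "\<bar>corrector A z d\<bar> \<le> lyapunov A z d / 50"
    using order_trans[OF abs_corrector_le[OF A, of z d], of "lyapunov A z d / 50"]
    by (simp add: lyapunov_def divide_right_mono)
  then show "49 / 50 * lyapunov A z d \<le> potential A z d" "potential A z d \<le> 51 / 50 * lyapunov A z d"
    unfolding potential_def by linarith+
qed

lemma potential_nonneg: "1 \<le> A \<Longrightarrow> 0 \<le> potential A z d"
  using potential_bounds(1)[of A z d] lyapunov_nonneg[of A z d] by linarith

text \<open>The energy controls f at the start of the curve, whereas the iterate is the query point.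
  The two are within 4 \<eta>, and A \<gamma> \<eta> = e \<gamma> \<delta> is absorbed by A f and
  the square of d because e^2 is small against A.\<close>

lemma query_value_le:
  assumes A: "1 \<le> A" and vu: "0 \<le> v * u" "v * u \<le> 2"
  shows "A * f (query A z d v u) \<le> 2 * potential A z d"
proof -
  define e \<gamma> \<delta> \<eta> where "e = mesh A" and "\<gamma> = norm (g (z - d))" and "\<delta> = norm d" and "\<eta> = e / A * \<delta>"
  have e: "0 < e" "e\<^sup>2 \<le> A / 262144" using A mesh_pos mesh_square_le by (auto simp: e_def)
  have \<eta>0: "0 \<le> \<eta>" using e A by (simp add: \<eta>_def \<delta>_def)
  define h where "h = query A z d v u - (z - d)"
  have h: "norm h \<le> 4 * \<eta>"
  proof -
    have "norm h \<le> 2 * (v * u) * \<eta>"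
      using decay_path_lipschitz[of A "mesh A" "v * u" 0 z d] A e vu
      by (simp add: h_def query_def \<eta>_def \<delta>_def e_def)
    also have "\<dots> \<le> 2 * 2 * \<eta>" using vu \<eta>0 by (intro mult_right_mono mult_left_mono) auto
    finally show ?thesis by simp
  qed
  have "f (query A z d v u) \<le> f (z - d) + g (z - d) \<bullet> h + (norm h)\<^sup>2 / 2"
    using descent[of "z - d" h] by (simp add: h_def)
  also have "g (z - d) \<bullet> h \<le> \<gamma> * (4 * \<eta>)"
    using norm_cauchy_schwarz[of "g (z - d)" h] mult_left_mono[OF h, of \<gamma>] by (simp add: \<gamma>_def)
  also have "(norm h)\<^sup>2 / 2 \<le> (4 * \<eta>)\<^sup>2 / 2" using h by (intro divide_right_mono power_mono) auto
  finally have "A * f (query A z d v u) \<le> A * (f (z - d) + \<gamma> * (4 * \<eta>) + (4 * \<eta>)\<^sup>2 / 2)"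
    using A by (intro mult_left_mono) auto
  also have "\<dots> = A * f (z - d) + 4 * (e * \<gamma>) * \<delta> + 8 * (e\<^sup>2 / A * \<delta>\<^sup>2)"
    using A by (simp add: \<eta>_def power2_eq_square algebra_simps)
  also have "4 * (e * \<gamma>) * \<delta> \<le> 8 * (e\<^sup>2 * \<gamma>\<^sup>2) + \<delta>\<^sup>2 / 2"
    using zero_le_power2[of "4 * (e * \<gamma>) - \<delta>"] by (simp add: power2_eq_square algebra_simps)
  also have "e\<^sup>2 * \<gamma>\<^sup>2 \<le> A / 262144 * (2 * f (z - d))"
    using e gradient_square_le[of "z - d"] A by (intro mult_mono) (auto simp: \<gamma>_def)
  also have "e\<^sup>2 / A * \<delta>\<^sup>2 \<le> 1 / 262144 * \<delta>\<^sup>2"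
    using e A by (intro mult_right_mono) (auto simp: field_simps)
  finally have *: "A * f (query A z d v u)
      \<le> A * f (z - d) + (8 * (A / 262144 * (2 * f (z - d))) + \<delta>\<^sup>2 / 2) + 8 * (1 / 262144 * \<delta>\<^sup>2)" by simp
  define Y where "Y = A * f (z - d)"
  have "0 \<le> Y" "0 \<le> \<delta>\<^sup>2" "0 \<le> (norm (z - xs))\<^sup>2" using A nonneg by (auto simp: Y_def)
  moreover have "A / 262144 * (2 * f (z - d)) = Y / 131072" by (simp add: Y_def)
  note * = *[unfolded this]
  ultimately show ?thesis
    using * potential_bounds(1)[OF A, of z d]
    unfolding lyapunov_def distrib_left \<delta>_def[symmetric] Y_def[symmetric] by linarith
qed

text \<open>Along the curve, time * velocity is 2 (A / time)^2 d, so the integrand is the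
  u-derivative of time * f. Drawing the query time uniformly therefore reproduces the increase of A
  f over the cell without error.\<close>

lemma query_flow_integral:
  fixes z d :: 'a
  assumes A: "1 \<le> A" and v: "1 \<le> v"
  defines "e \<equiv> mesh A" and "P \<equiv> decay_path A (mesh A) z d"
  shows "has_bochner_integral lborel
    (\<lambda>u. e * v * (f (P (v * u)) + 2 * (A / (A + e * (v * u)))\<^sup>2 * (g (P (v * u)) \<bullet> d)) * indicator {0..1} u)
    ((A + e * v) * f (P v) - A * f (z - d))"
proof -
  have e: "0 < e" using A mesh_pos by (simp add: e_def)
  have pos: "0 < A + e * (v * u)" if "0 \<le> u" for u
    using A e v that by (intro add_pos_nonneg mult_nonneg_nonneg) auto
  have Pd: "((\<lambda>u. P (v * u)) has_vector_derivative (2 * A\<^sup>2 * (e * v) / (A + e * (v * u)) ^ 3) *\<^sub>R d) (at u)"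
    if "0 \<le> u" for u
  proof -
    have "((\<lambda>u. - ((A / (A + e * (v * u)))\<^sup>2)) has_real_derivative 2 * A\<^sup>2 * (e * v) / (A + e * (v * u)) ^ 3) (at u)"
    proof -
      have "((\<lambda>\<tau>. - ((A / \<tau>)\<^sup>2)) has_real_derivative 2 * A\<^sup>2 / \<tau> ^ 3) (at \<tau>)" if "0 < \<tau>" for \<tau>
        using that
        by (auto intro!: derivative_eq_intros simp: field_simps power2_eq_square power3_eq_cube)
      moreover have "((\<lambda>u. A + e * (v * u)) has_real_derivative e * v) (at u)"
        by (auto intro!: derivative_eq_intros)
      ultimately have "((\<lambda>u. - ((A / (A + e * (v * u)))\<^sup>2)) has_real_derivative
          2 * A\<^sup>2 / (A + e * (v * u)) ^ 3 * (e * v)) (at u)"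
        using pos[OF that] by (intro DERIV_chain2[where f = "\<lambda>\<tau>. - ((A / \<tau>)\<^sup>2)"]) auto
      then show ?thesis by simp
    qed
    from has_vector_derivative_add[OF has_vector_derivative_const[of z]
        has_vector_derivative_scaleR[OF this has_vector_derivative_const[of d]]]
    have "((\<lambda>u. z + - ((A / (A + e * (v * u)))\<^sup>2) *\<^sub>R d) has_vector_derivative
        (2 * A\<^sup>2 * (e * v) / (A + e * (v * u)) ^ 3) *\<^sub>R d) (at u)"
      by simp
    then show ?thesis by (simp add: P_def decay_path_def e_def)
  qed
  let ?F = "\<lambda>u. (A + e * (v * u)) * f (P (v * u))"
  have "has_bochner_integral lborel
    (\<lambda>u. e * v * (f (P (v * u)) + 2 * (A / (A + e * (v * u)))\<^sup>2 * (g (P (v * u)) \<bullet> d)) * indicator {0..1} u)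
    (?F 1 - ?F 0)"
  proof (rule has_bochner_integral_FTC_Icc_real)
    fix u :: real assume u: "0 \<le> u" "u \<le> 1"
    have "(?F has_real_derivative e * v * f (P (v * u))
        + g (P (v * u)) \<bullet> ((2 * A\<^sup>2 * (e * v) / (A + e * (v * u)) ^ 3) *\<^sub>R d) * (A + e * (v * u))) (at u)"
      by (rule DERIV_mult[OF _ DERIV_along[OF Pd[OF u(1)]]]) (auto intro!: derivative_eq_intros)
    moreover have "g (P (v * u)) \<bullet> ((2 * A\<^sup>2 * (e * v) / (A + e * (v * u)) ^ 3) *\<^sub>R d) * (A + e * (v * u))
        = e * v * (2 * (A / (A + e * (v * u)))\<^sup>2 * (g (P (v * u)) \<bullet> d))"
    proof -
      have "a \<bullet> ((2 * A\<^sup>2 * (e * v) / \<tau> ^ 3) *\<^sub>R d) * \<tau> = e * v * (2 * (A / \<tau>)\<^sup>2 * (a \<bullet> d))"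
        if "0 < \<tau>" for \<tau> a
        using that by (simp add: power2_eq_square power3_eq_cube)
      then show ?thesis using pos[OF u(1)] .
    qed
    ultimately show "(?F has_real_derivative
        e * v * (f (P (v * u)) + 2 * (A / (A + e * (v * u)))\<^sup>2 * (g (P (v * u)) \<bullet> d))) (at u)"
      by (simp add: distrib_left)
    have Pc: "isCont (\<lambda>u. P (v * u)) u" by (rule has_vector_derivative_continuous[OF Pd[OF u(1)]])
    have fc: "isCont f x" and gc: "isCont g x" for x
      using continuous_value[of UNIV] continuous_gradient[of UNIV]
      by (auto simp: continuous_on_eq_continuous_at)
    show "isCont (\<lambda>u. e * v * (f (P (v * u)) + 2 * (A / (A + e * (v * u)))\<^sup>2 * (g (P (v * u)) \<bullet> d))) u"
      using pos[OF u(1)]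
      by (intro continuous_intros isCont_o2[OF Pc fc] isCont_o2[OF Pc gc]) auto
  qed simp
  then show ?thesis using A by (simp add: P_def)
qed

text \<open>Averaging over \<open>u\<close> leaves \<open>W + e\<^sup>2 * \<Lambda> v\<close>, where
  the first-order terms have cancelled. Averaging this over \<open>v\<close> is where the renewal
  kernel acts: the mean of \<open>\<Lambda>\<close> is the old corrector integral.\<close>

lemma potential_step:
  assumes A: "1 \<le> A"
  shows "(\<integral>\<^sup>+v. \<integral>\<^sup>+u. ennreal (potential (A + mesh A * v) (next_z A z d v u) (next_d A z d v u))
      * indicator {0..1} u \<partial>lborel * indicator {1..2} v \<partial>lborel) \<le> ennreal (potential A z d)"
proof -
  define e P where "e = mesh A" and "P = decay_path A e z d"
  \<comment> \<open>Cut off at negative times, where the formula of the curve may be singular. The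
    kernel vanishes there, and the truncated function is bounded as the invariance lemma
    demands.\<close>
  define \<phi> where "\<phi> = (\<lambda>t. if 0 \<le> t then gradient_energy A z d t else 0)"
  define \<Lambda> where "\<Lambda> = (\<lambda>v. (\<integral>t. indicator {0..v} t * (t / 2 * \<phi> t) \<partial>lborel) - v\<^sup>2 / 4 * \<phi> v
      + (\<integral>r. renewal_kernel r * \<phi> (v + r) \<partial>lborel))"
  define W where "W = lyapunov A z d"
  have e: "0 < e" using A mesh_pos by (simp add: e_def)
  have [measurable]: "\<phi> \<in> borel_measurable borel" unfolding \<phi>_def by measurable
  define C where "C = (norm (g (z - d)) + 2 * norm d)\<^sup>2"
  have \<phi>C: "\<bar>\<phi> t\<bar> \<le> C" for t
  proof (cases "0 \<le> t")
    case True
    have r: "0 \<le> A / (A + e * t)" "A / (A + e * t) \<le> 1"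
      using A e True by (auto intro!: divide_nonneg_nonneg add_nonneg_nonneg simp: divide_le_eq_1 not_less add_pos_nonneg)
    have "norm (P t - (z - d)) = norm ((1 - (A / (A + e * t))\<^sup>2) *\<^sub>R d)"
      by (simp add: P_def decay_path_def e_def algebra_simps)
    also have "\<dots> \<le> 1 * norm d"
      using r unfolding norm_scaleR by (intro mult_right_mono) (auto simp: abs_le_iff power_le_one intro: order_trans[of _ 1])
    finally have "norm (g (P t) - g (z - d)) \<le> norm d" using lipschitz[of "P t" "z - d"] by simp
    then have "norm (g (P t)) \<le> norm (g (z - d)) + 2 * norm d"
      using norm_triangle_ineq2[of "g (P t)" "g (z - d)"] norm_ge_zero[of d] by linarith
    then show ?thesis using True by (auto simp: \<phi>_def C_def gradient_energy_def P_def e_def intro!: power_mono)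
  qed (simp add: \<phi>_def C_def)
  have kernel: "(\<integral>r. renewal_kernel r * \<phi> r \<partial>lborel) = (\<integral>r. renewal_kernel r * gradient_energy A z d r \<partial>lborel)"
    by (intro Bochner_Integration.integral_cong) (auto simp: \<phi>_def renewal_kernel_neg)
  have inner: "(\<integral>\<^sup>+u. ennreal (potential (A + mesh A * v) (next_z A z d v u) (next_d A z d v u))
      * indicator {0..1} u \<partial>lborel) \<le> ennreal (W + e\<^sup>2 * \<Lambda> v)" and R0: "0 \<le> W + e\<^sup>2 * \<Lambda> v"
    if v: "1 \<le> v" "v \<le> 2" for v
  proof -
    define k where "k = (A + e * v) * f (P v) + (norm (z - xs))\<^sup>2 + (norm d)\<^sup>2
        + e\<^sup>2 * (\<integral>r. renewal_kernel r * \<phi> (v + r) \<partial>lborel)"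
    define H where "H = (\<lambda>u. e * v * (f (P (v * u)) + 2 * (A / (A + e * (v * u)))\<^sup>2 * (g (P (v * u)) \<bullet> d)))"
    \<comment> \<open>Pointwise majorant of the next potential whose \<open>u\<close>-integral is
      explicit; its four constituents are integrated in \<open>h1\<close> to \<open>h4\<close>.
      Being above the potential it is nonnegative, which links its Bochner integral to the
      nonnegative one.\<close>
    define Q where "Q = (\<lambda>u. k - H u + e\<^sup>2 * (v * (v * u / 2 * \<phi> (v * u)) - v\<^sup>2 * (1 - u) / 2 * \<phi> v))"
    have vu: "0 \<le> v * u" if "0 \<le> u" for u using v that by simp
    have le: "potential (A + mesh A * v) (next_z A z d v u) (next_d A z d v u) \<le> Q u"
      if u: "0 \<le> u" "u \<le> 1" for u
    proof -
      have "(\<integral>r. renewal_kernel r * gradient_energy A z d (v + r) \<partial>lborel)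
          = (\<integral>r. renewal_kernel r * \<phi> (v + r) \<partial>lborel)"
      proof (intro Bochner_Integration.integral_cong refl)
        fix r show "renewal_kernel r * gradient_energy A z d (v + r) = renewal_kernel r * \<phi> (v + r)"
          using v by (cases "0 \<le> r") (auto simp: \<phi>_def renewal_kernel_neg)
      qed
      moreover have "gradient_energy A z d (v * u) = \<phi> (v * u)" "gradient_energy A z d v = \<phi> v"
        using vu[OF u(1)] v by (auto simp: \<phi>_def)
      ultimately show ?thesis
        using lyapunov_cell[OF A v u, of z d] corrector_cell[OF A v u, of z d]
        unfolding potential_def Q_def k_def H_def e_def[symmetric] P_def[symmetric] by simp
    qed
    have Q0: "0 \<le> Q u" if u: "0 \<le> u" "u \<le> 1" for u
      using le[OF u] potential_nonneg[of "A + mesh A * v" "next_z A z d v u" "next_d A z d v u"] A v e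
      by (simp add: e_def add_increasing2)
    have h1: "has_bochner_integral lborel (\<lambda>u. k * indicator {0..1::real} u) k"
      using has_bochner_integral_mult_right[OF has_bochner_integral_real_indicator[of "{0..1::real}" lborel], of k]
      by simp
    have h2: "has_bochner_integral lborel (\<lambda>u. H u * indicator {0..1} u) ((A + e * v) * f (P v) - A * f (z - d))"
      unfolding H_def P_def e_def by (rule query_flow_integral[OF A v(1)])
    \<comment> \<open>Substitution t = v u; the factor \<open>v\<close> in the integrand is the
      Jacobian.\<close>
    have h3: "has_bochner_integral lborel (\<lambda>u. v * (v * u / 2 * \<phi> (v * u)) * indicator {0..1} u)
        (\<integral>t. indicator {0..v} t * (t / 2 * \<phi> t) \<partial>lborel)"
    proof -
      have "integrable lborel (\<lambda>u. v * (v * u / 2 * \<phi> (v * u)) * indicator {0..1} u)"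
      proof (rule integrable_bounded_on_Icc[where a = 0 and b = 1 and C = "2 * C"])
        fix u :: real assume u: "u \<in> {0..1}"
        have "v * u \<le> 2 * 1" using v u by (intro mult_mono) auto
        then have "\<bar>v * u / 2\<bar> \<le> 1" using vu[of u] u by simp
        then have "\<bar>v\<bar> * (\<bar>v * u / 2\<bar> * \<bar>\<phi> (v * u)\<bar>) \<le> 2 * (1 * C)"
          using v \<phi>C by (intro mult_mono) auto
        then show "\<bar>v * (v * u / 2 * \<phi> (v * u)) * indicator {0..1} u\<bar> \<le> 2 * C"
          using u by (simp only: abs_mult) simp
      qed auto
      moreover have "(\<integral>t. indicator {0..v} t * (t / 2 * \<phi> t) \<partial>lborel)
          = (\<integral>u. v * (v * u / 2 * \<phi> (v * u)) * indicator {0..1} u \<partial>lborel)"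
      proof -
        have "(\<integral>t. indicator {0..v} t * (t / 2 * \<phi> t) \<partial>lborel)
            = v * (\<integral>u. indicator {0..v} (v * u) * (v * u / 2 * \<phi> (v * u)) \<partial>lborel)"
          using v by (subst lborel_integral_real_affine[where c = v and t = 0]) auto
        also have "\<dots> = (\<integral>u. v * (indicator {0..v} (v * u) * (v * u / 2 * \<phi> (v * u))) \<partial>lborel)"
          by simp
        also have "\<dots> = (\<integral>u. v * (v * u / 2 * \<phi> (v * u)) * indicator {0..1} u \<partial>lborel)"
          using v by (intro Bochner_Integration.integral_cong)
            (auto simp: indicator_def zero_le_mult_iff mult_le_cancel_left1)
        finally show ?thesis .
      qed
      ultimately show ?thesis by (simp add: has_bochner_integral_iff)
    qed
    have h4: "has_bochner_integral lborel (\<lambda>u. v\<^sup>2 * (1 - u) / 2 * \<phi> v * indicator {0..1} u)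
        (- (v\<^sup>2 * (1 - 1)\<^sup>2 / 4 * \<phi> v) - - (v\<^sup>2 * (1 - 0)\<^sup>2 / 4 * \<phi> v))"
      by (rule has_bochner_integral_FTC_Icc_real[where F = "\<lambda>u. - (v\<^sup>2 * (1 - u)\<^sup>2 / 4 * \<phi> v)"])
         (auto intro!: derivative_eq_intros continuous_intros simp: power2_eq_square field_simps)
    have "has_bochner_integral lborel
        (\<lambda>u. k * indicator {0..1} u - H u * indicator {0..1} u
          + e\<^sup>2 * (v * (v * u / 2 * \<phi> (v * u)) * indicator {0..1} u - v\<^sup>2 * (1 - u) / 2 * \<phi> v * indicator {0..1} u))
        (k - ((A + e * v) * f (P v) - A * f (z - d))
          + e\<^sup>2 * ((\<integral>t. indicator {0..v} t * (t / 2 * \<phi> t) \<partial>lborel)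
            - (- (v\<^sup>2 * (1 - 1)\<^sup>2 / 4 * \<phi> v) - - (v\<^sup>2 * (1 - 0)\<^sup>2 / 4 * \<phi> v))))"
      by (intro has_bochner_integral_add has_bochner_integral_diff has_bochner_integral_mult_right h1 h2 h3 h4)
    moreover have "(\<lambda>u. k * indicator {0..1} u - H u * indicator {0..1} u
          + e\<^sup>2 * (v * (v * u / 2 * \<phi> (v * u)) * indicator {0..1} u - v\<^sup>2 * (1 - u) / 2 * \<phi> v * indicator {0..1} u))
        = (\<lambda>u. Q u * indicator {0..1} u)"
      by (auto simp: Q_def indicator_def)
    moreover have "k - ((A + e * v) * f (P v) - A * f (z - d))
          + e\<^sup>2 * ((\<integral>t. indicator {0..v} t * (t / 2 * \<phi> t) \<partial>lborel)
            - (- (v\<^sup>2 * (1 - 1)\<^sup>2 / 4 * \<phi> v) - - (v\<^sup>2 * (1 - 0)\<^sup>2 / 4 * \<phi> v))) = W + e\<^sup>2 * \<Lambda> v"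
      by (simp add: k_def W_def \<Lambda>_def lyapunov_def algebra_simps)
    ultimately have Qint: "has_bochner_integral lborel (\<lambda>u. Q u * indicator {0..1} u) (W + e\<^sup>2 * \<Lambda> v)"
      by simp
    have Qnn: "0 \<le> Q u * indicator {0..1} u" for u using Q0[of u] by (auto simp: indicator_def)
    have "(\<integral>\<^sup>+u. ennreal (potential (A + mesh A * v) (next_z A z d v u) (next_d A z d v u))
        * indicator {0..1} u \<partial>lborel) \<le> (\<integral>\<^sup>+u. ennreal (Q u * indicator {0..1} u) \<partial>lborel)"
      using le by (intro nn_integral_mono) (auto simp: indicator_def intro!: ennreal_leI)
    also have "\<dots> = ennreal (W + e\<^sup>2 * \<Lambda> v)"
      using Qint Qnn by (subst nn_integral_eq_integral) (auto simp: has_bochner_integral_iff)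
    finally show "(\<integral>\<^sup>+u. ennreal (potential (A + mesh A * v) (next_z A z d v u) (next_d A z d v u))
        * indicator {0..1} u \<partial>lborel) \<le> ennreal (W + e\<^sup>2 * \<Lambda> v)" .
    show "0 \<le> W + e\<^sup>2 * \<Lambda> v"
      using has_bochner_integral_integral_eq[OF Qint] Qnn
      by (metis (no_types, lifting) Bochner_Integration.integral_nonneg)
  qed
  have int\<Lambda>: "has_bochner_integral lborel (\<lambda>v. indicator {1..2} v * \<Lambda> v)
      (\<integral>r. renewal_kernel r * \<phi> r \<partial>lborel)"
    using renewal_kernel_invariance[of \<phi> C, OF _ \<phi>C] unfolding \<Lambda>_def
    by (simp add: has_bochner_integral_iff)
  have "has_bochner_integral lborel (\<lambda>v. W * indicator {1..2::real} v) W"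
    using has_bochner_integral_mult_right[OF has_bochner_integral_real_indicator[of "{1..2::real}" lborel], of W]
    by simp
  then have "has_bochner_integral lborel (\<lambda>v. W * indicator {1..2} v + e\<^sup>2 * (indicator {1..2} v * \<Lambda> v))
      (W + e\<^sup>2 * (\<integral>r. renewal_kernel r * \<phi> r \<partial>lborel))"
    by (intro has_bochner_integral_add has_bochner_integral_mult_right int\<Lambda>)
  moreover have "(\<lambda>v. W * indicator {1..2} v + e\<^sup>2 * (indicator {1..2} v * \<Lambda> v))
      = (\<lambda>v. (W + e\<^sup>2 * \<Lambda> v) * indicator {1..2} v)"
    by (auto simp: indicator_def)
  ultimately have outer: "has_bochner_integral lborel (\<lambda>v. (W + e\<^sup>2 * \<Lambda> v) * indicator {1..2} v) (potential A z d)"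
    by (simp add: potential_def corrector_def kernel W_def e_def)
  have "(\<integral>\<^sup>+v. \<integral>\<^sup>+u. ennreal (potential (A + mesh A * v) (next_z A z d v u) (next_d A z d v u))
      * indicator {0..1} u \<partial>lborel * indicator {1..2} v \<partial>lborel)
      \<le> (\<integral>\<^sup>+v. ennreal ((W + e\<^sup>2 * \<Lambda> v) * indicator {1..2} v) \<partial>lborel)"
    using inner by (intro nn_integral_mono) (auto simp: indicator_def)
  also have "\<dots> = ennreal (potential A z d)"
    using outer R0 by (subst nn_integral_eq_integral) (auto simp: has_bochner_integral_iff indicator_def)
  finally show ?thesis .
qed

end

section \<open>Supermartingales of chains driven by independent noise\<close>

text \<open>A function of one noise path, so that the state after \<open>k\<close> steps visibly
  depends only on the first \<open>k\<close> coordinates. Independence is used through this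
  fact.\<close>

primrec driven_chain :: "('s \<Rightarrow> 'b \<Rightarrow> 's) \<Rightarrow> 's \<Rightarrow> (nat \<Rightarrow> 'b) \<Rightarrow> nat \<Rightarrow> 's" where
  "driven_chain step s0 w 0 = s0"
| "driven_chain step s0 w (Suc k) = step (driven_chain step s0 w k) (w k)"

lemma driven_chain_cong:
  "(\<And>j. j < k \<Longrightarrow> w j = w' j) \<Longrightarrow> driven_chain step s0 w k = driven_chain step s0 w' k"
  by (induction k) auto

lemma driven_chain_measurable:
  assumes step: "case_prod step \<in> S \<Otimes>\<^sub>M N \<rightarrow>\<^sub>M S" and s0: "s0 \<in> space S" and J: "{..<k} \<subseteq> J"
  shows "(\<lambda>w. driven_chain step s0 w k) \<in> PiM J (\<lambda>_. N) \<rightarrow>\<^sub>M S"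
  using J
proof (induction k)
  case 0 then show ?case using s0 by simp
next
  case (Suc k)
  have IH: "(\<lambda>w. driven_chain step s0 w k) \<in> PiM J (\<lambda>_. N) \<rightarrow>\<^sub>M S"
    using Suc by (simp add: lessThan_Suc)
  have "(\<lambda>w. w k) \<in> PiM J (\<lambda>_. N) \<rightarrow>\<^sub>M N"
    using Suc.prems by (intro measurable_component_singleton) auto
  from measurable_compose[OF measurable_Pair[OF IH this] step] show ?case by simp
qed

locale iid_noise = prob_space M for M :: "'w measure" +
  fixes W :: "nat \<Rightarrow> 'w \<Rightarrow> 'b" and N \<nu> :: "'b measure"
  assumes indep: "indep_vars (\<lambda>_. N) W UNIV"
    and distribution: "\<And>k. distr M N (W k) = \<nu>"
begin

lemma noise_measurable [measurable]: "W k \<in> M \<rightarrow>\<^sub>M N"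
  using indep by (auto simp: indep_vars_def2)

context
  fixes S :: "'s measure" and step :: "'s \<Rightarrow> 'b \<Rightarrow> 's" and s0 :: 's
  assumes step [measurable]: "case_prod step \<in> S \<Otimes>\<^sub>M N \<rightarrow>\<^sub>M S" and s0: "s0 \<in> space S"
begin

abbreviation trajectory :: "nat \<Rightarrow> 'w \<Rightarrow> 's" where
  "trajectory k \<omega> \<equiv> driven_chain step s0 (\<lambda>j. W j \<omega>) k"

lemma trajectory_measurable: "trajectory k \<in> M \<rightarrow>\<^sub>M S"
proof (induction k)
  case 0 then show ?case using s0 by simp
next
  case (Suc k)
  from measurable_compose[OF measurable_Pair[OF Suc noise_measurable[of k]] step] show ?case by simp
qed

text \<open>The state at time k is a function of the noise before k, which is independent of the
  noise at k. The joint law is a product, and Tonelli lets the one-step inequality act inside, with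
  the past frozen.\<close>

lemma supermartingale_expectation:
  assumes \<Phi> [measurable]: "\<Phi> \<in> borel_measurable S"
    and super: "\<And>s. s \<in> space S \<Longrightarrow> (\<integral>\<^sup>+w. \<Phi> (step s w) \<partial>\<nu>) \<le> \<Phi> s"
  shows "(\<integral>\<^sup>+\<omega>. \<Phi> (trajectory k \<omega>) \<partial>M) \<le> \<Phi> s0"
proof (induction k)
  case 0 then show ?case by (simp add: emeasure_space_1)
next
  case (Suc k)
  let ?R = "\<lambda>A \<omega>. restrict (\<lambda>j. W j \<omega>) A"
  let ?past = "distr M (PiM {..<k} (\<lambda>_. N)) (?R {..<k})" and ?now = "distr M (PiM {k} (\<lambda>_. N)) (?R {k})"
  note [measurable] = driven_chain_measurable[OF step s0 order_refl, of k]
  have R [measurable]: "?R A \<in> M \<rightarrow>\<^sub>M PiM A (\<lambda>_. N)" for A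
    by (intro measurable_restrict noise_measurable)
  interpret now: prob_space ?now by (rule prob_space_distr) measurable
  have now [measurable]: "(\<lambda>b. b k) \<in> PiM {k} (\<lambda>_. N) \<rightarrow>\<^sub>M N"
    by (rule measurable_component_singleton) simp
  define F where "F = (\<lambda>a b. \<Phi> (step (driven_chain step s0 a k) (b k)))"
  have F [measurable]: "case_prod F \<in> borel_measurable (PiM {..<k} (\<lambda>_. N) \<Otimes>\<^sub>M PiM {k} (\<lambda>_. N))"
  proof -
    have "(\<lambda>x. (driven_chain step s0 (fst x) k, snd x k))
        \<in> PiM {..<k} (\<lambda>_. N) \<Otimes>\<^sub>M PiM {k} (\<lambda>_. N) \<rightarrow>\<^sub>M S \<Otimes>\<^sub>M N"
      by measurable
    from measurable_compose[OF measurable_compose[OF this step] \<Phi>]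
    show ?thesis by (simp add: F_def case_prod_beta')
  qed
  have joint: "?past \<Otimes>\<^sub>M ?now
      = distr M (PiM {..<k} (\<lambda>_. N) \<Otimes>\<^sub>M PiM {k} (\<lambda>_. N)) (\<lambda>\<omega>. (?R {..<k} \<omega>, ?R {k} \<omega>))"
    using indep_var_restrict[OF indep, of "{..<k}" "{k}"] by (simp add: indep_var_distribution_eq)
  have past_eq: "driven_chain step s0 (?R {..<k} \<omega>) k = trajectory k \<omega>" for \<omega>
    by (rule driven_chain_cong) simp
  have "(\<integral>\<^sup>+\<omega>. \<Phi> (trajectory (Suc k) \<omega>) \<partial>M) = (\<integral>\<^sup>+\<omega>. F (?R {..<k} \<omega>) (?R {k} \<omega>) \<partial>M)"
    by (simp add: F_def past_eq)
  also have "\<dots> = (\<integral>\<^sup>+x. case_prod F x \<partial>(?past \<Otimes>\<^sub>M ?now))"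
    unfolding joint by (subst nn_integral_distr) auto
  also have "\<dots> = (\<integral>\<^sup>+a. \<integral>\<^sup>+b. F a b \<partial>?now \<partial>?past)"
    by (subst now.nn_integral_fst[symmetric]) (auto cong: measurable_cong_sets simp: F)
  also have "\<dots> = (\<integral>\<^sup>+\<omega>. \<integral>\<^sup>+b. F (?R {..<k} \<omega>) b \<partial>?now \<partial>M)"
    by (subst nn_integral_distr) auto
  also have "\<dots> \<le> (\<integral>\<^sup>+\<omega>. \<Phi> (trajectory k \<omega>) \<partial>M)"
  proof (rule nn_integral_mono)
    fix \<omega> assume \<omega>: "\<omega> \<in> space M"
    have s: "trajectory k \<omega> \<in> space S" using measurable_space[OF trajectory_measurable \<omega>] .
    have Fs [measurable]: "(\<lambda>w. \<Phi> (step (trajectory k \<omega>) w)) \<in> borel_measurable N"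
      using measurable_compose[OF measurable_Pair1'[OF s] measurable_compose[OF step \<Phi>]] by simp
    have "(\<integral>\<^sup>+b. F (?R {..<k} \<omega>) b \<partial>?now) = (\<integral>\<^sup>+b. \<Phi> (step (trajectory k \<omega>) (b k)) \<partial>?now)"
      by (simp add: F_def past_eq)
    also have "\<dots> = (\<integral>\<^sup>+\<omega>'. \<Phi> (step (trajectory k \<omega>) (W k \<omega>')) \<partial>M)"
      by (subst nn_integral_distr) auto
    also have "\<dots> = (\<integral>\<^sup>+w. \<Phi> (step (trajectory k \<omega>) w) \<partial>\<nu>)"
      unfolding distribution[of k, symmetric] by (subst nn_integral_distr) auto
    also have "\<dots> \<le> \<Phi> (trajectory k \<omega>)" by (rule super[OF s])
    finally show "(\<integral>\<^sup>+b. F (?R {..<k} \<omega>) b \<partial>?now) \<le> \<Phi> (trajectory k \<omega>)" .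
  qed
  finally show ?case using Suc by simp
qed

end

text \<open>The chain stopped on entering \<open>{\<Phi> \<ge> c}\<close> is again driven by the same noise.\<close>

lemma supermartingale_maximal:
  fixes S :: "'s measure" and step :: "'s \<Rightarrow> 'b \<Rightarrow> 's" and s0 :: 's and c :: ennreal
  assumes step [measurable]: "case_prod step \<in> S \<Otimes>\<^sub>M N \<rightarrow>\<^sub>M S" and s0: "s0 \<in> space S"
    and \<Phi> [measurable]: "\<Phi> \<in> borel_measurable S"
    and super: "\<And>s. s \<in> space S \<Longrightarrow> (\<integral>\<^sup>+w. \<Phi> (step s w) \<partial>\<nu>) \<le> \<Phi> s"
  shows "c * emeasure M {\<omega> \<in> space M. \<exists>j. c \<le> \<Phi> (trajectory step s0 j \<omega>)} \<le> \<Phi> s0"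
proof -
  define stop where "stop = (\<lambda>s w. if c \<le> \<Phi> s then s else step s w)"
  have stop [measurable]: "case_prod stop \<in> S \<Otimes>\<^sub>M N \<rightarrow>\<^sub>M S"
  proof -
    have "case_prod stop = (\<lambda>x. if c \<le> \<Phi> (fst x) then fst x else case_prod step x)"
      by (auto simp: stop_def fun_eq_iff)
    then show ?thesis by simp
  qed
  note [measurable] = trajectory_measurable[OF step s0] trajectory_measurable[OF stop s0]
  interpret \<nu>: prob_space \<nu> using prob_space_distr[OF noise_measurable[of 0]] by (simp add: distribution)
  have super_stop: "(\<integral>\<^sup>+w. \<Phi> (stop s w) \<partial>\<nu>) \<le> \<Phi> s" if "s \<in> space S" for s
    using super[OF that] by (cases "c \<le> \<Phi> s") (simp_all add: stop_def \<nu>.emeasure_space_1)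
  \<comment> \<open>Either both chains still agree or the stopped one already lies in {\<Phi> \<ge>
    c}, where it stays frozen.\<close>
  have hit: "c \<le> \<Phi> (driven_chain stop s0 w k)" if "j \<le> k" "c \<le> \<Phi> (driven_chain step s0 w j)" for w j k
  proof -
    have "driven_chain stop s0 w k = driven_chain step s0 w k
        \<or> c \<le> \<Phi> (driven_chain stop s0 w k)" for k
      by (induction k) (auto simp: stop_def)
    then have "c \<le> \<Phi> (driven_chain stop s0 w j)" using that(2) by metis
    with that(1) show ?thesis by (induction rule: dec_induct) (auto simp: stop_def)
  qed
  define E where "E = (\<lambda>k. {\<omega> \<in> space M. \<exists>j\<le>k. c \<le> \<Phi> (trajectory step s0 j \<omega>)})"
  have E [measurable]: "E k \<in> sets M" for k unfolding E_def by measurable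
  have "c * emeasure M (E k) \<le> \<Phi> s0" for k
  proof -
    have "c * emeasure M (E k) = (\<integral>\<^sup>+\<omega>. c * indicator (E k) \<omega> \<partial>M)"
      by (simp add: nn_integral_cmult_indicator)
    also have "\<dots> \<le> (\<integral>\<^sup>+\<omega>. \<Phi> (trajectory stop s0 k \<omega>) \<partial>M)"
      using hit by (intro nn_integral_mono) (auto simp: E_def indicator_def)
    also have "\<dots> \<le> \<Phi> s0"
      by (rule supermartingale_expectation[OF stop s0 \<Phi> super_stop])
    finally show ?thesis .
  qed
  moreover have "incseq E" by (auto simp: E_def incseq_def intro: order_trans)
  then have "(SUP k. emeasure M (E k)) = emeasure M (\<Union>k. E k)"
    by (intro SUP_emeasure_incseq) auto
  moreover have "(\<Union>k. E k) = {\<omega> \<in> space M. \<exists>j. c \<le> \<Phi> (trajectory step s0 j \<omega>)}"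
    by (auto simp: E_def)
  ultimately show ?thesis
    by (metis (mono_tags, lifting) SUP_least SUP_mult_left_ennreal)
qed

text \<open>By the maximal inequality the probability of unboundedness, times any n, stays below the
  initial value, so it is zero.\<close>

lemma supermartingale_bounded:
  fixes S :: "'s measure" and step :: "'s \<Rightarrow> 'b \<Rightarrow> 's" and s0 :: 's
  assumes step [measurable]: "case_prod step \<in> S \<Otimes>\<^sub>M N \<rightarrow>\<^sub>M S" and s0: "s0 \<in> space S"
    and \<Phi> [measurable]: "\<Phi> \<in> borel_measurable S" and fin: "\<Phi> s0 < \<infinity>"
    and super: "\<And>s. s \<in> space S \<Longrightarrow> (\<integral>\<^sup>+w. \<Phi> (step s w) \<partial>\<nu>) \<le> \<Phi> s"
  shows "AE \<omega> in M. \<exists>n::nat. \<forall>j. \<Phi> (trajectory step s0 j \<omega>) < of_nat n"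
proof -
  note [measurable] = trajectory_measurable[OF step s0]
  define B where "B = {\<omega> \<in> space M. \<forall>n::nat. \<exists>j. of_nat n \<le> \<Phi> (trajectory step s0 j \<omega>)}"
  have B [measurable]: "B \<in> sets M" unfolding B_def by measurable
  have le: "of_nat n * emeasure M B \<le> \<Phi> s0" for n
  proof -
    have "of_nat n * emeasure M B
        \<le> of_nat n * emeasure M {\<omega> \<in> space M. \<exists>j. of_nat n \<le> \<Phi> (trajectory step s0 j \<omega>)}"
      by (intro mult_left_mono emeasure_mono) (auto simp: B_def)
    also have "\<dots> \<le> \<Phi> s0" by (rule supermartingale_maximal[OF step s0 \<Phi> super])
    finally show ?thesis .
  qed
  obtain r where r: "0 \<le> r" "\<Phi> s0 = ennreal r" using fin by (cases "\<Phi> s0") auto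
  have "measure M B = 0"
  proof (rule ccontr)
    assume "measure M B \<noteq> 0"
    then have pos: "0 < measure M B" using measure_nonneg[of M B] by linarith
    obtain n where "r < real n * measure M B" using reals_Archimedean3[OF pos] by blast
    moreover have "ennreal (real n * measure M B) \<le> ennreal r"
      using le[of n] r by (simp add: emeasure_eq_measure ennreal_mult ennreal_of_nat_eq_real_of_nat)
    ultimately show False using r by simp
  qed
  then have "AE \<omega> in M. \<omega> \<notin> B"
    by (intro AE_not_in) (auto simp: null_sets_def emeasure_eq_measure)
  then show ?thesis
    by (rule AE_mp) (auto simp: B_def not_le intro!: AE_I2)
qed

end

section \<open>The heavy-ball iterates\<close>

text \<open>\<open>grad\<close> is a definite description: existence comes from representing the
  derivative in the basis, uniqueness from testing with the difference of two candidates.\<close>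

lemma GDERIV_grad:
  fixes f :: "'a::euclidean_space \<Rightarrow> real"
  assumes "f differentiable (at x)"
  shows "GDERIV f x :> grad f x"
proof -
  from assms obtain f' where f': "(f has_derivative f') (at x)" by (auto simp: differentiable_def)
  interpret bounded_linear f' using f' by (rule has_derivative_bounded_linear)
  define D where "D = (\<Sum>b\<in>Basis. f' b *\<^sub>R b)"
  have "f' h = h \<bullet> D" for h
  proof -
    have "f' h = f' (\<Sum>b\<in>Basis. (h \<bullet> b) *\<^sub>R b)" by (simp add: euclidean_representation)
    also have "\<dots> = h \<bullet> D" by (simp add: sum scaleR D_def inner_sum_right mult.commute)
    finally show ?thesis .
  qed
  then have D: "GDERIV f x :> D" using f' by (simp add: gderiv_def flip: fun_eq_iff) (metis ext)
  have "D' = D" if "GDERIV f x :> D'" for D'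
  proof -
    have "(\<lambda>h. h \<bullet> D') = (\<lambda>h. h \<bullet> D)"
      using that D unfolding gderiv_def by (rule has_derivative_unique)
    then have "(D' - D) \<bullet> D' = (D' - D) \<bullet> D" by (rule fun_cong)
    then have "(D' - D) \<bullet> (D' - D) = 0" by (simp add: inner_diff_right)
    then show ?thesis by simp
  qed
  with D show ?thesis unfolding grad_def by (rule theI)
qed

lemma power_int_minus_two: "(x::real) powi (-2) = 1 / x\<^sup>2"
  by (simp add: power_int_minus inverse_eq_divide)

lemma A_seq_Suc_mesh: "A_seq v (Suc k) = A_seq v k + mesh (A_seq v k) * v k"
  by (simp add: mesh_def)

lemma u_seq_mesh: "u_seq v w k = A_seq v k + mesh (A_seq v k) * (v k * w k)"
  by (simp add: u_seq_def mesh_def)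

lemma A_seq_ge_1:
  assumes "\<And>j. 1 \<le> v j" shows "1 \<le> A_seq v k"
proof (induction k)
  case (Suc k)
  have "0 \<le> mesh (A_seq v k) * v k" using Suc mesh_pos[of "A_seq v k"] assms[of k] by simp
  then show ?case using Suc unfolding A_seq_Suc_mesh by linarith
qed simp

text \<open>Fractional powers are avoided by comparing c^3 with A^2, where c = 1 + k / 1024. With b
  = A^(1/3) and V \<ge> 1, A^2 gains at least b^4 / 256, while c^3 gains about 3 c^2 / 1024 and c
  \<le> b^2. The slack between 3/1024 and 4/1024 pays for the lower-order terms.\<close>

lemma A_seq_growth:
  assumes v: "\<And>j. 1 \<le> v j"
  shows "(1 + real k / 1024) powr (3/2) \<le> A_seq v k"
proof -
  have cube: "(1 + real k / 1024) ^ 3 \<le> (A_seq v k)\<^sup>2"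
  proof (induction k)
    case (Suc k)
    define c A b where "c = 1 + real k / 1024" and "A = A_seq v k" and "b = A powr (1/3)"
    have A: "1 \<le> A" unfolding A_def by (rule A_seq_ge_1[OF v])
    have b: "1 \<le> b" "b ^ 3 = A" using A by (auto simp: b_def ge_one_powr_ge_zero powr_power)
    have c: "1 \<le> c" by (simp add: c_def)
    have cb: "c \<le> b\<^sup>2"
    proof (rule power_le_imp_le_base[of c 2])
      have "(b\<^sup>2) ^ 3 = (b ^ 3)\<^sup>2" by (simp flip: power_mult)
      then show "c ^ Suc 2 \<le> (b\<^sup>2) ^ Suc 2" using Suc b by (simp add: c_def A_def numeral_3_eq_3)
    qed simp
    have "(1 + real (Suc k) / 1024) ^ 3 = (c + 1 / 1024) ^ 3" by (simp add: c_def add_divide_distrib)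
    also have "\<dots> = c ^ 3 + (3 / 1024 * c\<^sup>2 + (3 / 1048576 * c + 1 / 1073741824))"
    proof -
      have "(c + h) ^ 3 = c ^ 3 + (3 * h * c\<^sup>2 + (3 * h\<^sup>2 * c + h ^ 3))" for h
        by (simp add: power3_eq_cube power2_eq_square algebra_simps)
      from this[of "1 / 1024"] show ?thesis by (simp add: power_divide)
    qed
    also have "\<dots> \<le> c ^ 3 + (c\<^sup>2 / 256 + c / 262144)"
    proof -
      have "c * 1 \<le> c * c" using c by (intro mult_left_mono) auto
      then have "1 \<le> c\<^sup>2" "c \<le> c\<^sup>2" using c unfolding power2_eq_square by linarith+
      then show ?thesis using c by linarith
    qed
    also have "\<dots> \<le> A\<^sup>2 + ((b\<^sup>2)\<^sup>2 / 256 + b\<^sup>2 / 262144)"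
      using Suc cb c by (intro add_mono divide_right_mono power_mono) (auto simp: c_def A_def)
    also have "\<dots> = (A + b / 512)\<^sup>2"
      unfolding b(2)[symmetric] by (simp add: power2_eq_square power3_eq_cube algebra_simps)
    also have "\<dots> \<le> (A_seq v (Suc k))\<^sup>2"
    proof (rule power_mono)
      have "b / 512 * 1 \<le> b / 512 * v k" using b v by (intro mult_left_mono) auto
      then show "A + b / 512 \<le> A_seq v (Suc k)" by (simp add: A_def b_def)
    qed (use A b in auto)
    finally show ?case .
  qed simp
  have "((1 + real k / 1024) powr (3/2))\<^sup>2 = (1 + real k / 1024) ^ 3"
    by (simp add: powr_power)
  then have "((1 + real k / 1024) powr (3/2))\<^sup>2 \<le> (A_seq v k)\<^sup>2" using cube by (simp only:)
  moreover have "0 \<le> A_seq v k" using A_seq_ge_1[of v k, OF v] by linarith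
  ultimately show ?thesis by (rule power2_le_imp_le)
qed

text \<open>Strictness of 0 < w < 1 puts each query time in the interior of its cell, so consecutive
  query times are strictly ordered and the momentum denominators are positive.\<close>

lemma u_seq_positions:
  assumes v: "\<And>j. 1 \<le> v j" and w: "\<And>j. 0 < w j \<and> w j < 1"
  shows "0 < u_seq v w k" "u_seq v w k < u_seq v w (Suc k)"
proof -
  have A: "1 \<le> A_seq v k" for k by (rule A_seq_ge_1[OF v])
  have step: "0 < mesh (A_seq v k) * v k" for k
    using mesh_pos[of "A_seq v k"] A[of k] v[of k] by (intro mult_pos_pos) auto
  have *: "A_seq v k < u_seq v w k \<and> u_seq v w k < A_seq v (Suc k)" for k
    using step[of k] w[of k] mult_strict_left_mono[of "w k" 1 "mesh (A_seq v k) * v k"]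
    unfolding u_seq_mesh A_seq_Suc_mesh mult.assoc[symmetric] by simp
  show "0 < u_seq v w k" using *[of k] A[of k] by linarith
  show "u_seq v w k < u_seq v w (Suc k)" using *[of k] *[of "Suc k"] by linarith
qed

context unit_smooth_convex
begin

text \<open>Truncating the first component at 1 makes the supermartingale inequality valid for every
  state of the product space. On the actual trajectory that component is at least 1 and the
  truncation is invisible.\<close>

definition chain_step :: "real \<times> 'a \<times> 'a \<Rightarrow> real \<times> real \<Rightarrow> real \<times> 'a \<times> 'a" where
  "chain_step s w = (max 1 (fst s) + mesh (max 1 (fst s)) * fst w,
     next_z (max 1 (fst s)) (fst (snd s)) (snd (snd s)) (fst w) (snd w),
     next_d (max 1 (fst s)) (fst (snd s)) (snd (snd s)) (fst w) (snd w))"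

definition chain_potential :: "real \<times> 'a \<times> 'a \<Rightarrow> ennreal" where
  "chain_potential s = ennreal (potential (max 1 (fst s)) (fst (snd s)) (snd (snd s)))"

lemma mesh_measurable [measurable]: "mesh \<in> borel_measurable borel"
  unfolding mesh_def by measurable

lemma chain_step_measurable:
  "case_prod chain_step \<in> (borel \<Otimes>\<^sub>M borel \<Otimes>\<^sub>M borel) \<Otimes>\<^sub>M (borel \<Otimes>\<^sub>M borel)
     \<rightarrow>\<^sub>M borel \<Otimes>\<^sub>M borel \<Otimes>\<^sub>M borel"
  unfolding chain_step_def next_z_def next_d_def query_def decay_path_def case_prod_beta
  by measurable

lemma chain_potential_measurable: "chain_potential \<in> borel_measurable (borel \<Otimes>\<^sub>M borel \<Otimes>\<^sub>M borel)"
  unfolding chain_potential_def potential_def lyapunov_def corrector_def gradient_energy_def decay_path_def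
  by measurable

lemma chain_supermartingale:
  "(\<integral>\<^sup>+w. chain_potential (chain_step s w)
     \<partial>(uniform_measure lborel {1..2} \<Otimes>\<^sub>M uniform_measure lborel {0..1})) \<le> chain_potential s"
proof -
  interpret V: prob_space "uniform_measure lborel {1..2::real}" by (rule prob_space_uniform_measure) auto
  interpret U: prob_space "uniform_measure lborel {0..1::real}" by (rule prob_space_uniform_measure) auto
  define A z d where "A = max 1 (fst s)" and "z = fst (snd s)" and "d = snd (snd s)"
  have A: "1 \<le> A" by (simp add: A_def)
  define F where "F = (\<lambda>v u. chain_potential (chain_step s (v, u)))"
  have F: "case_prod F \<in> borel_measurable (borel \<Otimes>\<^sub>M borel)"
    using measurable_compose[OF measurable_compose[OF measurable_Pair1'[of s "borel \<Otimes>\<^sub>M borel \<Otimes>\<^sub>M borel" "borel \<Otimes>\<^sub>M borel"]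
        chain_step_measurable] chain_potential_measurable]
    by (simp add: F_def case_prod_beta' space_pair_measure)
  have Fv [measurable]: "F v \<in> borel_measurable borel" for v
    using measurable_compose[OF measurable_Pair1'[of v borel borel] F] by simp
  have F' [measurable]: "case_prod F \<in> borel_measurable (borel \<Otimes>\<^sub>M lborel)"
    using F by (simp cong: measurable_cong_sets sets_pair_measure_cong)
  have Feq: "F v u = ennreal (potential (A + mesh A * v) (next_z A z d v u) (next_d A z d v u))"
    if "1 \<le> v" for v u
  proof -
    have "1 \<le> A + mesh A * v" using A mesh_pos[of A] that by (simp add: add_increasing2)
    then show ?thesis by (simp add: F_def chain_potential_def chain_step_def A_def z_def d_def)
  qed
  have "(\<integral>\<^sup>+w. chain_potential (chain_step s w)
     \<partial>(uniform_measure lborel {1..2} \<Otimes>\<^sub>M uniform_measure lborel {0..1}))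
    = (\<integral>\<^sup>+v. \<integral>\<^sup>+u. F v u \<partial>uniform_measure lborel {0..1} \<partial>uniform_measure lborel {1..2})"
    using F by (subst U.nn_integral_fst[symmetric])
      (auto simp: F_def case_prod_beta' cong: measurable_cong_sets sets_pair_measure_cong)
  also have "\<dots> = (\<integral>\<^sup>+v. \<integral>\<^sup>+u. F v u * indicator {0..1} u \<partial>lborel \<partial>uniform_measure lborel {1..2})"
    by (subst nn_integral_uniform_measure) (auto simp: divide_ennreal_def)
  also have "\<dots> = (\<integral>\<^sup>+v. (\<integral>\<^sup>+u. F v u * indicator {0..1} u \<partial>lborel) * indicator {1..2} v \<partial>lborel)"
    by (subst nn_integral_uniform_measure) (auto simp: divide_ennreal_def)
  also have "\<dots> = (\<integral>\<^sup>+v. \<integral>\<^sup>+u. ennreal (potential (A + mesh A * v) (next_z A z d v u) (next_d A z d v u))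
      * indicator {0..1} u \<partial>lborel * indicator {1..2} v \<partial>lborel)"
    by (intro nn_integral_cong) (auto simp: indicator_def Feq)
  also have "\<dots> \<le> ennreal (potential A z d)" by (rule potential_step[OF A])
  finally show ?thesis by (simp add: chain_potential_def A_def z_def d_def)
qed

text \<open>
  With \<open>y\<^sub>k = A\<^sub>k\<^sup>2 d\<^sub>k\<close> the query points satisfy \<open>x\<^sub>k = z\<^sub>k - u\<^sub>k\<^sup>-\<^sup>2 y\<^sub>k\<close> and
  \<open>x\<^sub>k\<^sub>+\<^sub>1 - x\<^sub>k = (u\<^sub>k\<^sup>-\<^sup>2 - u\<^sub>k\<^sub>+\<^sub>1\<^sup>-\<^sup>2) y\<^sub>k\<^sub>+\<^sub>1\<close>, which is where the momentum coefficients come from.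
\<close>

lemma heavy_ball_eq_query:
  fixes F :: "'a \<Rightarrow> real" and L :: real and v w :: "nat \<Rightarrow> real" and x0 :: 'a
  assumes L: "0 < L" and grad: "\<And>x. grad F x = L *\<^sub>R g x"
    and v: "\<And>j. 1 \<le> v j" and w: "\<And>j. 0 < w j \<and> w j < 1"
  defines "s \<equiv> driven_chain chain_step (1, x0, 0) (\<lambda>j. (v j, w j))"
  shows "fst (s k) = A_seq v k"
    and "heavy_ball L F x0 v w k = query (A_seq v k) (fst (snd (s k))) (snd (snd (s k))) (v k) (w k)"
proof -
  define A u where "A = A_seq v" and "u = u_seq v w"
  define z d where "z = (\<lambda>k. fst (snd (s k)))" and "d = (\<lambda>k. snd (snd (s k)))"
  define a where "a = (\<lambda>k. mesh (A k) * v k)"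
  have A: "1 \<le> A k" for k unfolding A_def by (rule A_seq_ge_1[OF v])
  have AS: "A (Suc k) = A k + a k" for k by (simp only: A_def A_seq_Suc_mesh a_def)
  have fst_s: "fst (s k) = A k" for k
  proof (induction k)
    case (Suc k)
    then show ?case using A[of k] AS[of k] by (simp add: s_def chain_step_def a_def max_def)
  qed (simp add: s_def A_def)
  then show "fst (s k) = A_seq v k" by (simp add: A_def)
  have u_eq: "u k = A k + mesh (A k) * (v k * w k)" for k by (simp add: u_def A_def u_seq_mesh)
  have u0: "0 < u k" and uS: "u k < u (Suc k)" for k
    unfolding u_def by (intro u_seq_positions v w)+
  define q where "q = (\<lambda>k. query (A k) (z k) (d k) (v k) (w k))"
  have zS: "z (Suc k) = z k - (a k / 2) *\<^sub>R g (q k)" for k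
    using A[of k] fst_s[of k]
    by (simp add: z_def d_def q_def s_def chain_step_def next_z_def a_def max_def)
  have dS: "d (Suc k) = (A k / A (Suc k))\<^sup>2 *\<^sub>R d k - ((u k / A (Suc k))\<^sup>2 * (a k / 2)) *\<^sub>R g (q k)" for k
    using A[of k] fst_s[of k]
    by (simp add: z_def d_def q_def s_def chain_step_def next_d_def a_def max_def AS u_eq)
  define y where "y = (\<lambda>k. (A k)\<^sup>2 *\<^sub>R d k)"
  have yS: "y (Suc k) = y k - ((u k)\<^sup>2 * (a k / 2)) *\<^sub>R g (q k)" for k
    using A[of "Suc k"] by (simp add: y_def dS scaleR_diff_right power_divide)
  have q_eq: "q k = z k - (1 / (u k)\<^sup>2) *\<^sub>R y k" for k
    by (simp add: q_def query_def decay_path_def y_def u_eq power_divide)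
  define \<delta> where "\<delta> = (\<lambda>k. 1 / (u k)\<^sup>2 - 1 / (u (Suc k))\<^sup>2)"
  have \<delta>0: "0 < \<delta> k" for k
  proof -
    have "(u k)\<^sup>2 < (u (Suc k))\<^sup>2" using u0[of k] uS[of k] by (intro power_strict_mono) auto
    then have "1 / (u (Suc k))\<^sup>2 < 1 / (u k)\<^sup>2" using u0[of k] by (intro frac_less2) auto
    then show ?thesis by (simp add: \<delta>_def)
  qed
  have u\<delta>: "(u k)\<^sup>2 * \<delta> k = 1 - (u k)\<^sup>2 / (u (Suc k))\<^sup>2" for k
    using u0[of k] by (simp add: \<delta>_def right_diff_distrib)
  \<comment> \<open>The jumps of z and of y / u_k^2 cancel in their difference: q_k lies on the new
    curve too, and the next iterate is reached along that curve.\<close>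
  have qS: "q (Suc k) - q k = \<delta> k *\<^sub>R y (Suc k)" for k
  proof -
    define G where "G = g (q k)"
    have "y k = y (Suc k) + ((u k)\<^sup>2 * (a k / 2)) *\<^sub>R G" by (simp add: yS G_def)
    then have "(1 / (u k)\<^sup>2) *\<^sub>R y k = (1 / (u k)\<^sup>2) *\<^sub>R y (Suc k) + (a k / 2) *\<^sub>R G"
      using u0[of k] by (simp add: scaleR_add_right)
    moreover have "z (Suc k) = z k - (a k / 2) *\<^sub>R G" by (simp add: zS G_def)
    ultimately show ?thesis
      by (simp add: q_eq[of k] q_eq[of "Suc k"] \<delta>_def scaleR_diff_left)
  qed
  have step: "step_size L v w k *\<^sub>R grad F x = (\<delta> k * ((u k)\<^sup>2 * (a k / 2))) *\<^sub>R g x" for k x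
  proof -
    have "step_size L v w k = a k / (2 * L) * ((u k)\<^sup>2 * \<delta> k)"
      unfolding step_size_def u_def[symmetric] u\<delta> by (simp add: A_seq_Suc_mesh a_def A_def del: A_seq.simps)
    then show ?thesis using L by (simp add: grad mult_ac)
  qed
  have momentum: "momentum v w (Suc k) = \<delta> (Suc k) / \<delta> k" for k
    by (simp add: momentum_def power_int_minus_two \<delta>_def u_def)
  have "heavy_ball L F x0 v w k = q k" for k
  proof (induction k rule: less_induct)
    case (less k)
    show ?case
    proof (cases k)
      case 0
      then show ?thesis by (simp add: q_def query_def decay_path_def z_def d_def s_def)
    next
      case (Suc j)
      have "heavy_ball L F x0 v w j = q j" "heavy_ball L F x0 v w (j - 1) = q (j - 1)"
        using less Suc by auto
      then have hb: "heavy_ball L F x0 v w k = q j - (\<delta> j * ((u j)\<^sup>2 * (a j / 2))) *\<^sub>R g (q j)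
          + momentum v w j *\<^sub>R (q j - q (j - 1))"
        unfolding Suc by (simp only: heavy_ball.simps step)
      \<comment> \<open>For positive j the last displacement is \<delta> (j - 1) y_j and the
        momentum replaces \<delta> (j - 1) by \<delta> j. For j = 0 both sides are zero, since the
        chain starts with d = 0.\<close>
      have "momentum v w j *\<^sub>R (q j - q (j - 1)) = \<delta> j *\<^sub>R y j"
      proof (cases j)
        case 0 then show ?thesis by (simp add: momentum_def y_def d_def s_def)
      next
        case (Suc i)
        then show ?thesis using \<delta>0[of i] by (simp add: momentum qS)
      qed
      then have "heavy_ball L F x0 v w k = q j + \<delta> j *\<^sub>R y (Suc j)"
        unfolding hb yS by (simp add: scaleR_diff_right)
      also have "\<dots> = q k" unfolding qS[of j, symmetric] Suc by simp
      finally show ?thesis .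
    qed
  qed
  then show "heavy_ball L F x0 v w k = query (A_seq v k) (fst (snd (s k))) (snd (snd (s k))) (v k) (w k)"
    by (simp add: q_def A_def z_def d_def)
qed

text \<open>51/50 * 3/2 is below 2; together with the factor 2 between query value and potential
  this yields the constant 4 of the mean bound.\<close>

lemma chain_potential_initial: "chain_potential (1, x0, 0) \<le> ennreal (2 * (norm (x0 - xs))\<^sup>2)"
proof -
  have "potential 1 x0 0 \<le> 51 / 50 * lyapunov 1 x0 0" by (rule potential_bounds) simp
  also have "lyapunov 1 x0 0 \<le> 3 / 2 * (norm (x0 - xs))\<^sup>2"
    using value_le[of x0] by (simp add: lyapunov_def)
  finally have "potential 1 x0 0 \<le> 2 * (norm (x0 - xs))\<^sup>2" using zero_le_power2[of "norm (x0 - xs)"] by linarith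
  then show ?thesis by (simp add: chain_potential_def ennreal_leI)
qed

end

section \<open>From the given random variables to the chain, and the final bounds\<close>

lemma AE_distr_uniform_Icc:
  fixes X :: "'w \<Rightarrow> real"
  assumes X: "X \<in> borel_measurable M" and d: "distr M borel X = uniform_measure lborel {a..b}" and "a < b"
  shows "AE \<omega> in M. a < X \<omega> \<and> X \<omega> < b"
proof -
  have "AE x in lborel. x \<noteq> a" "AE x in lborel. x \<noteq> b" by (rule AE_lborel_singleton)+
  then have "AE x in lborel. x \<in> {a..b} \<longrightarrow> a < x \<and> x < b" by eventually_elim auto
  then have "AE x in distr M borel X. a < x \<and> x < b"
    unfolding d by (intro AE_uniform_measureI) auto
  then show ?thesis using X by (simp add: AE_distr_iff)
qed

text \<open>Grouping the independent family into the disjoint blocks {Inl k, Inr k} gives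
  independence over k; splitting a block gives the product law of one pair.\<close>

lemma (in prob_space) iid_noise_pairs:
  assumes indep: "indep_vars (\<lambda>_. borel) (case_sum V U) UNIV"
    and V: "\<And>k. distr M borel (V k) = \<nu>" and U: "\<And>k. distr M borel (U k) = \<mu>"
  shows "iid_noise M (\<lambda>k \<omega>. (V k \<omega>, U k \<omega>)) (borel \<Otimes>\<^sub>M borel) (\<nu> \<Otimes>\<^sub>M \<mu>)"
proof
  let ?K = "\<lambda>k::nat. {Inl k, Inr k} :: (nat + nat) set"
  have "indep_vars (\<lambda>k. PiM (?K k) (\<lambda>_. borel)) (\<lambda>k \<omega>. restrict (\<lambda>i. case_sum V U i \<omega>) (?K k)) UNIV"
    by (rule indep_vars_restrict[OF indep]) (auto simp: disjoint_family_on_def)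
  then have "indep_vars (\<lambda>_. borel \<Otimes>\<^sub>M borel)
      (\<lambda>k \<omega>. (\<lambda>h. (h (Inl k), h (Inr k))) (restrict (\<lambda>i. case_sum V U i \<omega>) (?K k))) UNIV"
    by (rule indep_vars_compose2) (intro measurable_Pair measurable_component_singleton; simp)
  then show "indep_vars (\<lambda>_. borel \<Otimes>\<^sub>M borel) (\<lambda>k \<omega>. (V k \<omega>, U k \<omega>)) UNIV" by simp
  fix k
  have "indep_var (PiM {Inl k} (\<lambda>_. borel)) (\<lambda>\<omega>. restrict (\<lambda>i. case_sum V U i \<omega>) {Inl k})
      (PiM {Inr k} (\<lambda>_. borel)) (\<lambda>\<omega>. restrict (\<lambda>i. case_sum V U i \<omega>) {Inr k})"
    by (rule indep_var_restrict[OF indep]) auto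
  then have "indep_var borel ((\<lambda>h. h (Inl k)) \<circ> (\<lambda>\<omega>. restrict (\<lambda>i. case_sum V U i \<omega>) {Inl k}))
      borel ((\<lambda>h. h (Inr k)) \<circ> (\<lambda>\<omega>. restrict (\<lambda>i. case_sum V U i \<omega>) {Inr k}))"
    by (rule indep_var_compose) (intro measurable_component_singleton; simp)+
  then have "indep_var borel (V k) borel (U k)" by (simp add: comp_def)
  then show "distr M (borel \<Otimes>\<^sub>M borel) (\<lambda>\<omega>. (V k \<omega>, U k \<omega>)) = \<nu> \<Otimes>\<^sub>M \<mu>"
    by (simp add: indep_var_distribution_eq V U)
qed

lemma unit_smooth_convex_normalized:
  fixes f :: "'a::euclidean_space \<Rightarrow> real"
  assumes L: "0 < L" and convex: "convex_on UNIV f" and smooth: "L_smooth L f" and min: "\<forall>y. f xs \<le> f y"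
  shows "unit_smooth_convex (\<lambda>x. (f x - f xs) / L) (\<lambda>x. (1 / L) *\<^sub>R grad f x) xs"
proof
  fix x y :: 'a
  have "GDERIV f x :> grad f x" using smooth by (intro GDERIV_grad) (simp add: L_smooth_def)
  then have "((\<lambda>x. (f x - f xs) / L) has_derivative (\<lambda>h. h \<bullet> grad f x / L)) (at x)"
    unfolding gderiv_def using L by (auto intro!: derivative_eq_intros)
  then show "GDERIV (\<lambda>x. (f x - f xs) / L) x :> (1 / L) *\<^sub>R grad f x" by (simp add: gderiv_def)
  have "norm (grad f x - grad f y) \<le> L * norm (x - y)" using smooth by (simp add: L_smooth_def)
  then show "norm ((1 / L) *\<^sub>R grad f x - (1 / L) *\<^sub>R grad f y) \<le> norm (x - y)"
    unfolding scaleR_diff_right[symmetric] norm_scaleR using L by (simp add: divide_le_eq mult.commute)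
  show "0 \<le> (f x - f xs) / L" using L min by simp
next
  show "convex_on UNIV (\<lambda>x. (f x - f xs) / L)"
  proof (rule convex_onI)
    fix t :: real and x y :: 'a assume t: "0 < t" "t < 1"
    have "f ((1 - t) *\<^sub>R x + t *\<^sub>R y) - f xs \<le> (1 - t) * f x + t * f y - f xs"
      using convex_onD[OF convex, of t x y] t by simp
    then have "(f ((1 - t) *\<^sub>R x + t *\<^sub>R y) - f xs) / L \<le> ((1 - t) * f x + t * f y - f xs) / L"
      using L by (intro divide_right_mono) auto
    then show "(f ((1 - t) *\<^sub>R x + t *\<^sub>R y) - f xs) / L \<le> (1 - t) * ((f x - f xs) / L) + t * ((f y - f xs) / L)"
      by (simp add: diff_divide_distrib add_divide_distrib algebra_simps)
  qed simp
qed simp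

text \<open>The iterates agree with the query points only almost surely, so their measurability is
  read off the recursion itself.\<close>

lemma heavy_ball_measurable:
  fixes V U :: "nat \<Rightarrow> 'w \<Rightarrow> real" and f :: "'a::euclidean_space \<Rightarrow> real"
  assumes [measurable]: "grad f \<in> borel_measurable borel"
    "\<And>k. V k \<in> borel_measurable M" "\<And>k. U k \<in> borel_measurable M"
  shows "(\<lambda>\<omega>. heavy_ball L f x0 (\<lambda>j. V j \<omega>) (\<lambda>j. U j \<omega>) k) \<in> borel_measurable M"
proof -
  have A [measurable]: "(\<lambda>\<omega>. A_seq (\<lambda>j. V j \<omega>) k) \<in> borel_measurable M" for k
    by (induction k) auto
  have u [measurable]: "(\<lambda>\<omega>. u_seq (\<lambda>j. V j \<omega>) (\<lambda>j. U j \<omega>) k) \<in> borel_measurable M" for k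
    unfolding u_seq_def by measurable
  have eta [measurable]: "(\<lambda>\<omega>. step_size L (\<lambda>j. V j \<omega>) (\<lambda>j. U j \<omega>) k) \<in> borel_measurable M" for k
    unfolding step_size_def by measurable
  have beta [measurable]: "(\<lambda>\<omega>. momentum (\<lambda>j. V j \<omega>) (\<lambda>j. U j \<omega>) k) \<in> borel_measurable M" for k
    unfolding momentum_def power_int_minus_two by measurable
  show ?thesis
  proof (induction k rule: less_induct)
    case (less k)
    show ?case
    proof (cases k)
      case (Suc j)
      then have "j < k" "j - 1 < k" by auto
      note [measurable] = less[OF this(1)] less[OF this(2)]
      then show ?thesis unfolding Suc heavy_ball.simps by measurable
    qed simp
  qed
qed

theorem theorem13:
  fixes L :: real
    and f :: "real ^ 'd \<Rightarrow> real"
    and xstar x0 :: "real ^ 'd"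
    and M :: "'w measure"
    and V U :: "nat \<Rightarrow> 'w \<Rightarrow> real"
    and u :: "nat \<Rightarrow> 'w \<Rightarrow> real"
    and X :: "nat \<Rightarrow> 'w \<Rightarrow> real ^ 'd"
  defines "u \<equiv> \<lambda>k \<omega>. u_seq (\<lambda>j. V j \<omega>) (\<lambda>j. U j \<omega>) k"
    and "X \<equiv> \<lambda>k \<omega>. heavy_ball L f x0 (\<lambda>j. V j \<omega>) (\<lambda>j. U j \<omega>) k"
  assumes "L > 0"
    and "convex_on UNIV f"
    and "L_smooth L f"
    and "\<forall>y. f xstar \<le> f y"
    and "prob_space M"
    and "prob_space.indep_vars M (\<lambda>_. borel) (case_sum V U) UNIV"
    and "\<forall>k. distr M borel (V k) = uniform_measure lborel {1..2}"
    and "\<forall>k. distr M borel (U k) = uniform_measure lborel {0..1}"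
  shows "(AE \<omega> in M. (\<forall>k. 0 < (u k \<omega>)\<^sup>2) \<and>
            (\<forall>k\<ge>1. 0 < u (k - 1) \<omega> powi (-2) - u k \<omega> powi (-2))) \<and>
         (\<forall>K\<ge>1.
            integrable M (\<lambda>\<omega>. f (X K \<omega>) - f xstar) \<and>
            (\<integral>\<omega>. f (X K \<omega>) - f xstar \<partial>M)
              \<le> 4 * L * (norm (x0 - xstar))\<^sup>2 / (1 + real K / 1024) powr (3/2) \<and>
            4 * L * (norm (x0 - xstar))\<^sup>2 / (1 + real K / 1024) powr (3/2)
              \<le> 131072 * L * (norm (x0 - xstar))\<^sup>2 / real K powr (3/2)) \<and>
         measure M {\<omega> \<in> space M.
            (SUP K\<in>{1..}. ereal (real K powr (3/2) * (f (X K \<omega>) - f xstar))) < \<infinity>} = 1 \<and>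
         (AE \<omega> in M. (\<lambda>K. f (X K \<omega>) - f xstar) \<in> O(\<lambda>K. real K powr (-3/2)))"
proof -
  note L = \<open>L > 0\<close>
  interpret prob_space M by fact
  define F G where "F = (\<lambda>x. (f x - f xstar) / L)" and "G = (\<lambda>x. (1 / L) *\<^sub>R grad f x)"
  interpret unit_smooth_convex F G xstar
    unfolding F_def G_def by (rule unit_smooth_convex_normalized) fact+
  define W where "W = (\<lambda>k \<omega>. (V k \<omega>, U k \<omega>))"
  define \<nu> where "\<nu> = uniform_measure lborel {1..2::real} \<Otimes>\<^sub>M uniform_measure lborel {0..1::real}"
  interpret iid_noise M W "borel \<Otimes>\<^sub>M borel" \<nu>
    unfolding W_def \<nu>_def using assms(8-10) by (intro iid_noise_pairs) auto
  have rv: "random_variable borel (case_sum V U i)" for i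
    using assms(8) by (auto simp: indep_vars_def2)
  have [measurable]: "random_variable borel (V k)" "random_variable borel (U k)" for k
    using rv[of "Inl k"] rv[of "Inr k"] by auto
  have grad_eq: "grad f x = L *\<^sub>R G x" for x using L by (simp add: G_def)
  have f_eq: "f x - f xstar = L * F x" for x using L by (simp add: F_def)
  have "(\<lambda>x. L *\<^sub>R G x) \<in> borel_measurable borel" by measurable
  then have [measurable]: "grad f \<in> borel_measurable borel" by (simp add: grad_eq[abs_def])
  have X [measurable]: "X K \<in> borel_measurable M" for K
    unfolding X_def by (rule heavy_ball_measurable) measurable

  define D where "D = (norm (x0 - xstar))\<^sup>2"
  define Y where "Y = (\<lambda>k \<omega>. driven_chain chain_step (1, x0, 0) (\<lambda>j. W j \<omega>) k)"
  let ?S = "borel \<Otimes>\<^sub>M borel \<Otimes>\<^sub>M borel :: (real \<times> (real ^ 'd) \<times> (real ^ 'd)) measure"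
  have s0: "(1, x0, 0) \<in> space ?S" by (simp add: space_pair_measure)
  have super: "(\<integral>\<^sup>+w. chain_potential (chain_step s w) \<partial>\<nu>) \<le> chain_potential s" for s
    unfolding \<nu>_def by (rule chain_supermartingale)
  have mean: "(\<integral>\<^sup>+\<omega>. chain_potential (Y K \<omega>) \<partial>M) \<le> ennreal (2 * D)" for K
    using supermartingale_expectation[OF chain_step_measurable s0 chain_potential_measurable super, of K]
      chain_potential_initial[of x0] unfolding Y_def D_def by (rule order_trans)
  have bounded: "AE \<omega> in M. \<exists>n::nat. \<forall>k. chain_potential (Y k \<omega>) < of_nat n"
    unfolding Y_def
    by (rule supermartingale_bounded[OF chain_step_measurable s0 chain_potential_measurable _ super])
       (simp add: chain_potential_def)

  have "AE \<omega> in M. \<forall>k. 1 < V k \<omega> \<and> V k \<omega> < 2" "AE \<omega> in M. \<forall>k. 0 < U k \<omega> \<and> U k \<omega> < 1"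
    unfolding AE_all_countable using assms(9,10) by (intro allI AE_distr_uniform_Icc; simp)+
  then have good: "AE \<omega> in M. \<forall>k. 1 \<le> V k \<omega> \<and> V k \<omega> \<le> 2 \<and> 0 < U k \<omega> \<and> U k \<omega> < 1"
    by eventually_elim (auto intro: less_imp_le)

  define r where "r = (\<lambda>K. (1 + real K / 1024) powr (3/2))"
  have r0: "0 < r K" for K by (simp add: r_def add_pos_nonneg)
  \<comment> \<open>Pathwise link of the iterates to the supermartingale. It uses the growth of A,
    the identification of the iterate with the query point and the value bound there. Both the mean
    and the almost sure statement follow from it.\<close>
  have key: "AE \<omega> in M. \<forall>K. ennreal (r K * F (X K \<omega>)) \<le> 2 * chain_potential (Y K \<omega>)"
    using good
  proof eventually_elim
    fix \<omega> assume \<omega>: "\<forall>k. 1 \<le> V k \<omega> \<and> V k \<omega> \<le> 2 \<and> 0 < U k \<omega> \<and> U k \<omega> < 1"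
    show "\<forall>K. ennreal (r K * F (X K \<omega>)) \<le> 2 * chain_potential (Y K \<omega>)"
    proof
      fix K
      define A z d where "A = A_seq (\<lambda>j. V j \<omega>) K" and "z = fst (snd (Y K \<omega>))" and "d = snd (snd (Y K \<omega>))"
      have A: "1 \<le> A" "r K \<le> A" unfolding A_def r_def using \<omega> by (intro A_seq_ge_1 A_seq_growth; simp)+
      have Yeq: "fst (Y K \<omega>) = A" and Xeq: "X K \<omega> = query A z d (V K \<omega>) (U K \<omega>)"
        unfolding Y_def W_def X_def A_def z_def d_def
        using heavy_ball_eq_query[OF L grad_eq, of "\<lambda>j. V j \<omega>" "\<lambda>j. U j \<omega>" x0 K] \<omega> by auto
      have "V K \<omega> * U K \<omega> \<le> 2 * 1" using \<omega> by (intro mult_mono) (auto intro: less_imp_le order_trans[of 0 1])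
      moreover have "0 \<le> V K \<omega> * U K \<omega>"
        using \<omega> by (intro mult_nonneg_nonneg) (auto intro: less_imp_le order_trans[of 0 1])
      ultimately have "A * F (X K \<omega>) \<le> 2 * potential A z d"
        unfolding Xeq using A by (intro query_value_le) auto
      moreover have "r K * F (X K \<omega>) \<le> A * F (X K \<omega>)" using A nonneg by (intro mult_right_mono)
      ultimately have "ennreal (r K * F (X K \<omega>)) \<le> ennreal (2 * potential A z d)" by (intro ennreal_leI) simp
      also have "\<dots> = 2 * chain_potential (Y K \<omega>)"
        using A potential_nonneg[of A z d] by (simp add: chain_potential_def Yeq z_def d_def ennreal_mult')
      finally show "ennreal (r K * F (X K \<omega>)) \<le> 2 * chain_potential (Y K \<omega>)" .
    qed
  qed

  have "AE \<omega> in M. (\<forall>k. 0 < (u k \<omega>)\<^sup>2) \<and>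
            (\<forall>k\<ge>1. 0 < u (k - 1) \<omega> powi (-2) - u k \<omega> powi (-2))"
    using good
  proof eventually_elim
    fix \<omega> assume \<omega>: "\<forall>k. 1 \<le> V k \<omega> \<and> V k \<omega> \<le> 2 \<and> 0 < U k \<omega> \<and> U k \<omega> < 1"
    have pos: "0 < u k \<omega>" and inc: "u k \<omega> < u (Suc k) \<omega>" for k
      unfolding u_def using \<omega> by (intro u_seq_positions; simp)+
    have "0 < u (k - 1) \<omega> powi (-2) - u k \<omega> powi (-2)" if "1 \<le> k" for k
    proof -
      have "u (k - 1) \<omega> < u k \<omega>" using inc[of "k - 1"] that by simp
      then have "(u (k - 1) \<omega>)\<^sup>2 < (u k \<omega>)\<^sup>2" using pos[of "k - 1"] by (intro power_strict_mono) auto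
      then have "1 / (u k \<omega>)\<^sup>2 < 1 / (u (k - 1) \<omega>)\<^sup>2" using pos[of "k - 1"] by (intro frac_less2) auto
      then show ?thesis by (simp add: power_int_minus_two)
    qed
    then show "(\<forall>k. 0 < (u k \<omega>)\<^sup>2) \<and> (\<forall>k\<ge>1. 0 < u (k - 1) \<omega> powi (-2) - u k \<omega> powi (-2))"
      using pos by (metis zero_less_power)
  qed
  moreover have "integrable M (\<lambda>\<omega>. f (X K \<omega>) - f xstar) \<and>
      (\<integral>\<omega>. f (X K \<omega>) - f xstar \<partial>M) \<le> 4 * L * D / r K" for K
  proof -
    have "ennreal (r K) * (\<integral>\<^sup>+\<omega>. ennreal (F (X K \<omega>)) \<partial>M) = (\<integral>\<^sup>+\<omega>. ennreal (r K * F (X K \<omega>)) \<partial>M)"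
      using r0[of K] nonneg by (subst nn_integral_cmult[symmetric]) (auto simp: ennreal_mult less_imp_le)
    also have "\<dots> \<le> (\<integral>\<^sup>+\<omega>. 2 * chain_potential (Y K \<omega>) \<partial>M)"
      using key by (intro nn_integral_mono_AE) auto
    also have "\<dots> = 2 * (\<integral>\<^sup>+\<omega>. chain_potential (Y K \<omega>) \<partial>M)"
      using measurable_compose[OF trajectory_measurable[OF chain_step_measurable s0] chain_potential_measurable, of K]
      unfolding Y_def by (rule nn_integral_cmult)
    also have "\<dots> \<le> 2 * ennreal (2 * D)" using mean by (intro mult_left_mono) auto
    finally have le: "ennreal (r K) * (\<integral>\<^sup>+\<omega>. ennreal (F (X K \<omega>)) \<partial>M) \<le> ennreal (4 * D)"
      by (simp add: D_def ennreal_mult'[symmetric] flip: ennreal_numeral)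
    have "(\<integral>\<^sup>+\<omega>. ennreal (F (X K \<omega>)) \<partial>M) \<noteq> \<infinity>"
    proof
      assume "(\<integral>\<^sup>+\<omega>. ennreal (F (X K \<omega>)) \<partial>M) = \<infinity>"
      then show False using le r0[of K] by (simp add: ennreal_mult_top top_unique)
    qed
    then have int: "integrable M (\<lambda>\<omega>. F (X K \<omega>))"
      using nonneg by (intro integrableI_bounded) (auto simp: less_top)
    have "r K * (\<integral>\<omega>. F (X K \<omega>) \<partial>M) \<le> 4 * D"
      using le r0[of K] nonneg
      by (simp add: nn_integral_eq_integral[OF int] ennreal_mult'[symmetric] D_def)
    then have "(\<integral>\<omega>. F (X K \<omega>) \<partial>M) \<le> 4 * D / r K" using r0[of K] by (simp add: field_simps)
    then have "L * (\<integral>\<omega>. F (X K \<omega>) \<partial>M) \<le> L * (4 * D / r K)" using L by (intro mult_left_mono) auto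
    then show ?thesis unfolding f_eq using int by (simp add: mult_ac)
  qed
  \<comment> \<open>32768 = 1024^(3/2) = 32^3, and 4 * 32768 = 131072 is the second
    constant.\<close>
  moreover have rK: "real K powr (3/2) \<le> 32768 * r K" for K
  proof -
    have "real K powr (3/2) = 32768 * (real K / 1024) powr (3/2)"
    proof -
      have "(1024::real) powr (3/2) = (32\<^sup>2) powr (3/2)" by simp
      also have "\<dots> = 32 powr 3" by (subst powr_numeral[symmetric]) (simp_all add: powr_powr del: powr_numeral)
      also have "\<dots> = 32768" by simp
      finally show ?thesis by (simp add: powr_divide)
    qed
    also have "\<dots> \<le> 32768 * r K" unfolding r_def by (intro mult_left_mono powr_mono2) auto
    finally show ?thesis .
  qed
  moreover have "4 * L * D / r K \<le> 131072 * L * D / real K powr (3/2)" if "1 \<le> K" for K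
  proof -
    have "4 * L * D / r K = 131072 * L * D / (32768 * r K)" by simp
    also have "\<dots> \<le> 131072 * L * D / real K powr (3/2)"
      using rK[of K] L that by (intro divide_left_mono mult_pos_pos) (auto simp: D_def r0)
    finally show ?thesis .
  qed
  moreover have uniform: "AE \<omega> in M. \<exists>C. \<forall>K. real K powr (3/2) * (f (X K \<omega>) - f xstar) \<le> C"
    using key bounded
  proof eventually_elim
    fix \<omega> assume key: "\<forall>K. ennreal (r K * F (X K \<omega>)) \<le> 2 * chain_potential (Y K \<omega>)"
      and "\<exists>n::nat. \<forall>k. chain_potential (Y k \<omega>) < of_nat n"
    then obtain n :: nat where n: "\<And>k. chain_potential (Y k \<omega>) < of_nat n" by blast
    have "real K powr (3/2) * (f (X K \<omega>) - f xstar) \<le> 32768 * L * (2 * real n)" for K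
    proof -
      have "ennreal (r K * F (X K \<omega>)) \<le> 2 * of_nat n"
        using key n[of K] by (meson less_imp_le mult_left_mono order_trans zero_le)
      also have "\<dots> = ennreal (2 * real n)" by (simp add: ennreal_mult ennreal_of_nat_eq_real_of_nat)
      finally have "r K * F (X K \<omega>) \<le> 2 * real n" by simp
      have "real K powr (3/2) * (L * F (X K \<omega>)) \<le> (32768 * r K) * (L * F (X K \<omega>))"
        using rK[of K] L nonneg by (intro mult_right_mono) auto
      also have "\<dots> = 32768 * L * (r K * F (X K \<omega>))" by simp
      also have "\<dots> \<le> 32768 * L * (2 * real n)"
        using \<open>r K * F (X K \<omega>) \<le> 2 * real n\<close> L by (intro mult_left_mono) auto
      finally show ?thesis by (simp only: f_eq)
    qed
    then show "\<exists>C. \<forall>K. real K powr (3/2) * (f (X K \<omega>) - f xstar) \<le> C" by blast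
  qed
  moreover have "measure M {\<omega> \<in> space M.
      (SUP K\<in>{1..}. ereal (real K powr (3/2) * (f (X K \<omega>) - f xstar))) < \<infinity>} = 1"
  proof (subst prob_Collect_eq_1)
    show "{\<omega> \<in> space M. (SUP K\<in>{1..}. ereal (real K powr (3/2) * (f (X K \<omega>) - f xstar))) < \<infinity>} \<in> events"
      unfolding f_eq by measurable
    show "AE \<omega> in M. (SUP K\<in>{1..}. ereal (real K powr (3/2) * (f (X K \<omega>) - f xstar))) < \<infinity>"
      using uniform
    proof eventually_elim
      fix \<omega> assume "\<exists>C. \<forall>K. real K powr (3/2) * (f (X K \<omega>) - f xstar) \<le> C"
      then obtain C where C: "\<And>K. real K powr (3/2) * (f (X K \<omega>) - f xstar) \<le> C" by blast
      have "(SUP K\<in>{1..}. ereal (real K powr (3/2) * (f (X K \<omega>) - f xstar))) \<le> ereal C"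
        by (intro SUP_least) (simp add: C)
      then show "(SUP K\<in>{1..}. ereal (real K powr (3/2) * (f (X K \<omega>) - f xstar))) < \<infinity>"
        by (rule order_le_less_trans) simp
    qed
  qed
  moreover have "AE \<omega> in M. (\<lambda>K. f (X K \<omega>) - f xstar) \<in> O(\<lambda>K. real K powr (-3/2))"
    using uniform
  proof eventually_elim
    fix \<omega> assume "\<exists>C. \<forall>K. real K powr (3/2) * (f (X K \<omega>) - f xstar) \<le> C"
    then obtain C where C: "\<And>K. real K powr (3/2) * (f (X K \<omega>) - f xstar) \<le> C" by blast
    \<comment> \<open>Only for K \<ge> 1: \<open>0 powr (-3/2)\<close> is 0, which bounds
      nothing.\<close>
    have "norm (f (X K \<omega>) - f xstar) \<le> C * norm (real K powr (-3/2))" if "1 \<le> K" for K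
    proof -
      have "real K powr (-3/2) * real K powr (3/2) = 1" using that by (simp flip: powr_add)
      then have "f (X K \<omega>) - f xstar = real K powr (-3/2) * (real K powr (3/2) * (f (X K \<omega>) - f xstar))"
        by (simp only: mult.assoc[symmetric] mult_1)
      also have "\<dots> \<le> real K powr (-3/2) * C" using C by (intro mult_left_mono) auto
      finally show ?thesis using assms(6) by (simp add: mult.commute)
    qed
    then have "eventually (\<lambda>K. norm (f (X K \<omega>) - f xstar) \<le> C * norm (real K powr (-3/2))) at_top"
      by (intro eventually_at_top_linorderI[of 1]) auto
    then show "(\<lambda>K. f (X K \<omega>) - f xstar) \<in> O(\<lambda>K. real K powr (-3/2))" by (rule bigoI)
  qed
  ultimately show ?thesis unfolding D_def r_def by blast
qed

end
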